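(* Let $\sigma_x,\sigma_k>0$, $f,g\in\mathcal{S}(\mathbb{R}^n)$, $L(x,k)\in\mathcal{S}'(\mathbb{R}^{2n})$, and let $L$ be the operator with Weyl symbol $L(x,k)$. Then $$\tilde W[Lf,g](x,k)=\tilde{\mathcal{L}}\,\tilde W[f,g](x,k),$$ where, for $w=\tilde W[f,g]$, $$\tilde{\mathcal{L}}w(x,k)=2^{2n}\int_{X,K,S,T\in\mathbb{R}^n}e^{2\pi i\left[S(x-K+i\sigma_x^2X)+T(k+X+i\sigma_k^2K)+xX+kK\right]}\,\hat L(2S,2T)\,\hat w(X-S,K-T)\,dS\,dT\,dX\,dK,$$ or, equivalently, $$\tilde{\mathcal{L}}w(x,k)=\int_{S,T\in\mathbb{R}^n}\hat L(S,T)\,e^{2\pi i(Sx+Tk)-\frac{\pi}{2}(\sigma_x^2S^2+\sigma_k^2T^2)}\,w\left(x+\frac{T+i\sigma_x^2S}{2},\,k-\frac{S-i\sigma_k^2T}{2}\right)dS\,dT.$$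
   Context: Fourier transform: $\hat f(k)=\int_{\mathbb{R}^n}e^{-2\pi i k\cdot x}f(x)\,dx$; $\hat L(S,T)$ is the Fourier transform of $L(x,k)$ in both variables ($x\to S$, $k\to T$), and $\hat w(X,K)$ that of $w(x,k)$. The operator $L$ with Weyl symbol $L(x,k)$ is $Lf(x)=\int_{y,k\in\mathbb{R}^n}e^{2\pi i k(x-y)}L\left(\frac{x+y}{2},k\right)f(y)\,dy\,dk$. The smoothed Wigner transform (SWT) is $$\tilde W[f,g](x,k)=\left(\frac{\sqrt2}{\sigma_x}\right)^n\int_{u,y\in\mathbb{R}^n}e^{-2\pi i k y-\frac{\pi\sigma_k^2y^2}{2}-\frac{2\pi(u-x)^2}{\sigma_x^2}}\,f\left(u+\frac y2\right)\bar g\left(u-\frac y2\right)du\,dy,$$ i.e. $\tilde W[f,g]=\Phi W[f,g]$, where $W[f,g](x,k)=\int_{\mathbb{R}^n}e^{-2\pi i k y}f(x+\frac y2)\bar g(x-\frac y2)\,dy$ and $\Phi$ is the Fourier multiplier $e^{-\frac{\pi}{2}(\sigma_x^2X^2+\sigma_k^2K^2)}$ on $\mathbb{R}^{2n}$. Products of vectors are dot products and squares are dot squares. For $f,g\in\mathcal{S}$, $\tilde W[f,g]$ extends to an entire function on $\mathbb{C}^{2n}$, and its values at complex arguments are those of this extension. Integrals containing $\hat L$ are, for fixed $(x,k)$, duality pairings in $(S,T)$ of the tempered distribution $\hat L$ with a Schwartz function (in the first formula, after integrating in $X,K$). *)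

theory Defs
  imports "HOL-Analysis.Analysis"
begin

section \<open>Schwartz functions, tempered distributions, Fourier transform\<close>

text \<open>Iterated directional derivatives; a list of basis vectors plays the role of a multi-index.\<close>

primrec iter_deriv :: "'a list \<Rightarrow> ('a::euclidean_space \<Rightarrow> complex) \<Rightarrow> 'a \<Rightarrow> complex" where
  "iter_deriv [] f = f"
| "iter_deriv (b # bs) f = (\<lambda>x. frechet_derivative (iter_deriv bs f) (at x) b)"

definition schwartz :: "('a::euclidean_space \<Rightarrow> complex) \<Rightarrow> bool" where
  "schwartz f \<longleftrightarrow>
     (\<forall>bs. set bs \<subseteq> Basis \<longrightarrow>
        (\<forall>x. iter_deriv bs f differentiable (at x)) \<and>
        (\<forall>m. bounded (range (\<lambda>x. norm x ^ m *\<^sub>R iter_deriv bs f x))))"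

definition schwartz_seminorm ::
    "nat \<Rightarrow> 'a list \<Rightarrow> ('a::euclidean_space \<Rightarrow> complex) \<Rightarrow> real" where
  "schwartz_seminorm m bs f = (SUP x. norm x ^ m * norm (iter_deriv bs f x))"

text \<open>A tempered distribution is represented by a functional on all functions, of which only
  the values on Schwartz functions are constrained (and meaningful).  Pairings are bilinear:
  no complex conjugation is involved.\<close>

definition tempered_distribution :: "(('a::euclidean_space \<Rightarrow> complex) \<Rightarrow> complex) \<Rightarrow> bool" where
  "tempered_distribution u \<longleftrightarrow>
     (\<forall>\<phi> \<psi>. schwartz \<phi> \<longrightarrow> schwartz \<psi> \<longrightarrow> u (\<lambda>x. \<phi> x + \<psi> x) = u \<phi> + u \<psi>) \<and>
     (\<forall>c \<phi>. schwartz \<phi> \<longrightarrow> u (\<lambda>x. c * \<phi> x) = c * u \<phi>) \<and>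
     (\<exists>C N. \<forall>\<phi>. schwartz \<phi> \<longrightarrow>
        norm (u \<phi>) \<le> C * (\<Sum>m\<le>N. \<Sum>bs\<in>{bs. set bs \<subseteq> Basis \<and> length bs \<le> N}.
                              schwartz_seminorm m bs \<phi>))"

definition fourier :: "('a::euclidean_space \<Rightarrow> complex) \<Rightarrow> 'a \<Rightarrow> complex" where
  "fourier f k = (LINT x|lborel. exp (- 2 * pi * \<i> * (k \<bullet> x)) * f x)"

definition fourier_dist ::
    "(('a::euclidean_space \<Rightarrow> complex) \<Rightarrow> complex) \<Rightarrow> ('a \<Rightarrow> complex) \<Rightarrow> complex" where
  "fourier_dist u \<phi> = u (fourier \<phi>)"

text \<open>The distribution \<open>u(c z)\<close>, for a real \<open>c \<noteq> 0\<close>.\<close>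

definition dilate_dist ::
    "real \<Rightarrow> (('a::euclidean_space \<Rightarrow> complex) \<Rightarrow> complex) \<Rightarrow> ('a \<Rightarrow> complex) \<Rightarrow> complex" where
  "dilate_dist c u \<phi> = u (\<lambda>z. \<phi> (z /\<^sub>R c)) / \<bar>c\<bar> ^ DIM('a)"


section \<open>Weyl operators and the smoothed Wigner transform\<close>

text \<open>For a tempered distribution \<open>L\<close>, \<open>L f\<close> is the tempered distribution obtained by pairing
  the kernel \<open>\<integral> exp (2 \<pi> i k (x-y)) L((x+y)/2, k) dk\<close> with \<open>h(x) f(y)\<close>; substituting \<open>z = (x+y)/2\<close>, \<open>v = x-y\<close>
  (unit Jacobian) leaves \<open>L(z,k)\<close> paired with the Schwartz function below.\<close>

definition weyl_op ::
    "(((real^'n) \<times> (real^'n) \<Rightarrow> complex) \<Rightarrow> complex) \<Rightarrow> (real^'n \<Rightarrow> complex) \<Rightarrow>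
     (real^'n \<Rightarrow> complex) \<Rightarrow> complex" where
  "weyl_op L f h =
     L (\<lambda>(z, k). LINT v|lborel. exp (2 * pi * \<i> * (k \<bullet> v)) * f (z - v /\<^sub>R 2) * h (z + v /\<^sub>R 2))"

definition swt ::
    "real \<Rightarrow> real \<Rightarrow> (real^'n \<Rightarrow> complex) \<Rightarrow> (real^'n \<Rightarrow> complex) \<Rightarrow>
     (real^'n) \<times> (real^'n) \<Rightarrow> complex" where
  "swt \<sigma>\<^sub>x \<sigma>\<^sub>k f g = (\<lambda>(x, k).
     (sqrt 2 / \<sigma>\<^sub>x) ^ CARD('n) *
     (LINT (u, y)|lborel.
        exp (- 2 * pi * \<i> * (k \<bullet> y) - pi * \<sigma>\<^sub>k\<^sup>2 * (y \<bullet> y) / 2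
             - 2 * pi * ((u - x) \<bullet> (u - x)) / \<sigma>\<^sub>x\<^sup>2)
        * f (u + y /\<^sub>R 2) * cnj (g (u - y /\<^sub>R 2))))"

text \<open>The same formula when the first argument is a tempered distribution \<open>F\<close>: for fixed \<open>y\<close> put
  \<open>p = u + y/2\<close> and pair \<open>F(p)\<close> with the remaining integral over \<open>y\<close>, a Schwartz function of \<open>p\<close>.\<close>

definition swt_dist ::
    "real \<Rightarrow> real \<Rightarrow> ((real^'n \<Rightarrow> complex) \<Rightarrow> complex) \<Rightarrow> (real^'n \<Rightarrow> complex) \<Rightarrow>
     (real^'n) \<times> (real^'n) \<Rightarrow> complex" where
  "swt_dist \<sigma>\<^sub>x \<sigma>\<^sub>k F g = (\<lambda>(x, k).
     F (\<lambda>p. (sqrt 2 / \<sigma>\<^sub>x) ^ CARD('n) *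
       (LINT y|lborel.
          exp (- 2 * pi * \<i> * (k \<bullet> y) - pi * \<sigma>\<^sub>k\<^sup>2 * (y \<bullet> y) / 2
               - 2 * pi * ((p - y /\<^sub>R 2 - x) \<bullet> (p - y /\<^sub>R 2 - x)) / \<sigma>\<^sub>x\<^sup>2)
          * cnj (g (p - y)))))"


section \<open>Complex arguments\<close>

definition cvec :: "real^'n \<Rightarrow> complex^'n" where
  "cvec x = (\<chi> i. complex_of_real (x $ i))"

text \<open>The bilinear (not Hermitian) dot product.\<close>

definition cdot :: "complex^'n \<Rightarrow> complex^'n \<Rightarrow> complex" (infixl "\<bullet>\<^sub>c" 70) where
  "z \<bullet>\<^sub>c w = (\<Sum>i\<in>UNIV. z $ i * w $ i)"

definition entire :: "((complex^'n) \<times> (complex^'n) \<Rightarrow> complex) \<Rightarrow> bool" where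
  "entire F \<longleftrightarrow>
     (\<forall>z. \<exists>D. (F has_derivative D) (at z) \<and>
              (\<forall>c v w. D (c *s v, c *s w) = c * D (v, w)))"

text \<open>By the identity theorem an entire extension is unique if it exists.\<close>

definition entire_extension ::
    "((real^'n) \<times> (real^'n) \<Rightarrow> complex) \<Rightarrow> (complex^'n) \<times> (complex^'n) \<Rightarrow> complex" where
  "entire_extension w =
     (THE F. entire F \<and> (\<forall>x k. F (cvec x, cvec k) = w (x, k)))"


section \<open>The two expressions for the smoothed operator\<close>

text \<open>The distribution \<open>L\<close> is Fourier transformed in both variables, \<open>x \<rightarrow> S\<close> and \<open>k \<rightarrow> T\<close>, and
  integrals over \<open>(S, T)\<close> are pairings with the resulting distribution.\<close>

definition smoothed_op ::
    "real \<Rightarrow> real \<Rightarrow> (((real^'n) \<times> (real^'n) \<Rightarrow> complex) \<Rightarrow> complex) \<Rightarrow>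
     ((real^'n) \<times> (real^'n) \<Rightarrow> complex) \<Rightarrow> (real^'n) \<times> (real^'n) \<Rightarrow> complex" where
  "smoothed_op \<sigma>\<^sub>x \<sigma>\<^sub>k L w = (\<lambda>(x, k).
     2 ^ (2 * CARD('n)) *
     dilate_dist 2 (fourier_dist L) (\<lambda>(S, T).
       LINT (X, K)|lborel.
         exp (2 * pi * \<i> *
              (cvec S \<bullet>\<^sub>c (cvec (x - K) + (\<i> * \<sigma>\<^sub>x\<^sup>2) *s cvec X)
               + cvec T \<bullet>\<^sub>c (cvec (k + X) + (\<i> * \<sigma>\<^sub>k\<^sup>2) *s cvec K)
               + x \<bullet> X + k \<bullet> K))
         * fourier w (X - S, K - T)))"

definition smoothed_op' ::
    "real \<Rightarrow> real \<Rightarrow> (((real^'n) \<times> (real^'n) \<Rightarrow> complex) \<Rightarrow> complex) \<Rightarrow>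
     ((real^'n) \<times> (real^'n) \<Rightarrow> complex) \<Rightarrow> (real^'n) \<times> (real^'n) \<Rightarrow> complex" where
  "smoothed_op' \<sigma>\<^sub>x \<sigma>\<^sub>k L w = (\<lambda>(x, k).
     fourier_dist L (\<lambda>(S, T).
       exp (2 * pi * \<i> * (S \<bullet> x + T \<bullet> k)
            - pi / 2 * (\<sigma>\<^sub>x\<^sup>2 * (S \<bullet> S) + \<sigma>\<^sub>k\<^sup>2 * (T \<bullet> T)))
       * entire_extension w
           (cvec x + (1 / 2) *s (cvec T + (\<i> * \<sigma>\<^sub>x\<^sup>2) *s cvec S),
            cvec k - (1 / 2) *s (cvec S - (\<i> * \<sigma>\<^sub>k\<^sup>2) *s cvec T))))"

end

theory Submission
  imports Defs "HOL-Probability.Probability" "HOL-Complex_Analysis.Complex_Analysis"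
begin

text \<open>Every distributional operation in the statement is defined by duality: the Weyl operator, the
Fourier transform and the dilation of a distribution are all moved onto the test function.  Hence the
three expressions are values of the functional \<open>L\<close> at three functions of \<open>(z, \<kappa>)\<close>, and the theorem
follows once these three functions are shown to be equal.  Write \<open>w\<close> for the smoothed Wigner
transform of \<open>f\<close> and \<open>g\<close>, \<open>a\<close> and \<open>b\<close> for the complex arguments \<open>x + (T + i \<sigma>\<^sub>x\<^sup>2 S)/2\<close> and
\<open>k - (S - i \<sigma>\<^sub>k\<^sup>2 T)/2\<close>, and \<open>A(S, T)\<close> for the function \<open>exp(2\<pi>i(Sx + Tk) - (\<pi>/2)(\<sigma>\<^sub>x\<^sup>2 S\<^sup>2 + \<sigma>\<^sub>k\<^sup>2 T\<^sup>2)) w(a, b)\<close>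
that is paired with the transform of \<open>L\<close> in the second formula for the smoothed operator.

\<^bold>\<open>The Weyl operator against \<open>A\<close>.\<close>  In the Gaussian integral that defines \<open>w\<close>, the imaginary parts of
\<open>a\<close> and \<open>b\<close> produce phases and real exponential factors, and the prefactor in \<open>A\<close> cancels the latter.  After the
substitution \<open>u = z - y/2\<close>, \<open>y \<rightarrow> y + T\<close> what is left is
\<open>A(S, T) = \<integral>\<integral> exp(2\<pi>i S z) M(z, T, y) dz dy\<close> with a Schwartz function \<open>M\<close>
(\<open>swt_complex_eq_partial_fourier\<close>).  Taking the Fourier transform of \<open>A\<close> at \<open>(z, \<kappa>)\<close>, Fourier inversion
in \<open>S\<close> undoes the integral over \<open>z\<close> and leaves \<open>\<integral>\<integral> exp(-2\<pi>i \<kappa> T) M(z, T, y) dT dy\<close>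
(\<open>fourier_partial_fourier_marginal\<close>), which is the test function of the Weyl operator, its integration
variable \<open>v\<close> being \<open>-T\<close> (\<open>weyl_op_test_function\<close>).  The analytic content is that \<open>A\<close> is integrable: integration by parts
lets a Schwartz function absorb polynomial weights in \<open>S\<close> (\<open>partial_fourier_weight\<close>).

\<^bold>\<open>The two formulas for the smoothed operator.\<close>  Shifting \<open>(X, K)\<close> by \<open>(S/2, T/2)\<close> in the first formula
splits its exponent into the prefactor of \<open>A\<close> and \<open>2\<pi>i(X a + K b)\<close>, so that the claim becomes the Fourier
inversion formula for \<open>w\<close> at the complex point \<open>(a, b)\<close> (\<open>smoothed_op_integral\<close>).  Since the Fourier transform of \<open>w\<close> is
a Gaussian times a bounded function (\<open>fourier_swt\<close>), the inversion integral converges at all complex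
arguments; carrying out the Gaussian integral over \<open>X\<close> turns it into the integral that
defines \<open>w\<close>, with complex \<open>(a, b)\<close> in place of \<open>(x, k)\<close> (\<open>swt_complex_eq_fourier_integral\<close>).
The same inversion integral is entire, and an entire function is determined
by its real values because each complex point lies on a complex line along which the identity
theorem of one variable applies (\<open>entire_eqI\<close>); so it is the entire extension of \<open>w\<close>.\<close>


section \<open>Schwartz functions\<close>

text \<open>The weight \<open>(1 + |x|)\<^sup>m\<close>, unlike \<open>|x|\<^sup>m\<close>, is submultiplicative under products of spaces and
changes by at most a constant factor under injective affine maps.\<close>

definition rapidly_decreasing :: "('a::real_normed_vector \<Rightarrow> complex) \<Rightarrow> bool" where
  "rapidly_decreasing f \<longleftrightarrow> (\<forall>m::nat. \<exists>C. \<forall>x. (1 + norm x) ^ m * norm (f x) \<le> C)"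

lemma rapidly_decreasing_iff:
  "rapidly_decreasing f \<longleftrightarrow> (\<forall>m. bounded (range (\<lambda>x. norm x ^ m *\<^sub>R f x)))"
proof
  assume *: "rapidly_decreasing f"
  show "\<forall>m. bounded (range (\<lambda>x. norm x ^ m *\<^sub>R f x))"
  proof
    fix m
    obtain C where C: "\<And>x. (1 + norm x) ^ m * norm (f x) \<le> C"
      using * unfolding rapidly_decreasing_def by blast
    have "norm (norm x ^ m *\<^sub>R f x) \<le> C" for x
    proof -
      have "norm x ^ m * norm (f x) \<le> (1 + norm x) ^ m * norm (f x)"
        by (intro mult_right_mono power_mono) auto
      with C[of x] show ?thesis by simp
    qed
    then show "bounded (range (\<lambda>x. norm x ^ m *\<^sub>R f x))"
      unfolding bounded_iff by blast
  qed
next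
  assume *: "\<forall>m. bounded (range (\<lambda>x. norm x ^ m *\<^sub>R f x))"
  show "rapidly_decreasing f"
    unfolding rapidly_decreasing_def
  proof
    fix m
    obtain C0 where C0: "\<And>x. norm (norm x ^ 0 *\<^sub>R f x) \<le> C0"
      using *[rule_format, of 0] unfolding bounded_iff by blast
    obtain C where C: "\<And>x. norm (norm x ^ m *\<^sub>R f x) \<le> C"
      using *[rule_format, of m] unfolding bounded_iff by blast
    have "(1 + norm x) ^ m * norm (f x) \<le> 2 ^ m * (C0 + C)" for x
    proof -
      have "(1 + norm x) ^ m \<le> (2 * max 1 (norm x)) ^ m"
        by (intro power_mono) auto
      also have "\<dots> = 2 ^ m * max 1 (norm x) ^ m"
        by (simp add: power_mult_distrib)
      also have "max 1 (norm x) ^ m \<le> 1 + norm x ^ m"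
        by (auto simp: max_def)
      finally have "(1 + norm x) ^ m * norm (f x) \<le> 2 ^ m * (1 + norm x ^ m) * norm (f x)"
        by (intro mult_right_mono) auto
      also have "\<dots> = 2 ^ m * (norm (norm x ^ 0 *\<^sub>R f x) + norm (norm x ^ m *\<^sub>R f x))"
        by (simp add: algebra_simps)
      also have "\<dots> \<le> 2 ^ m * (C0 + C)"
        by (intro mult_left_mono add_mono C0 C) auto
      finally show ?thesis .
    qed
    then show "\<exists>C. \<forall>x. (1 + norm x) ^ m * norm (f x) \<le> C" by blast
  qed
qed

lemma rapidly_decreasing_lincomb:
  assumes "rapidly_decreasing f" "rapidly_decreasing g"
  shows "rapidly_decreasing (\<lambda>x. c * f x + d * g x)"
  unfolding rapidly_decreasing_def
proof
  fix m
  obtain A B where A: "\<And>x. (1 + norm x) ^ m * norm (f x) \<le> A"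
    and B: "\<And>x. (1 + norm x) ^ m * norm (g x) \<le> B"
    using assms unfolding rapidly_decreasing_def by metis
  have "(1 + norm x) ^ m * norm (c * f x + d * g x) \<le> norm c * A + norm d * B" for x
  proof -
    have "(1 + norm x) ^ m * norm (c * f x + d * g x)
        \<le> (1 + norm x) ^ m * (norm c * norm (f x) + norm d * norm (g x))"
      by (intro mult_left_mono order_trans[OF norm_triangle_ineq]) (auto simp: norm_mult)
    also have "\<dots> = norm c * ((1 + norm x) ^ m * norm (f x)) + norm d * ((1 + norm x) ^ m * norm (g x))"
      by (simp add: algebra_simps)
    also have "\<dots> \<le> norm c * A + norm d * B"
      by (intro add_mono mult_left_mono A B) auto
    finally show ?thesis .
  qed
  then show "\<exists>C. \<forall>x. (1 + norm x) ^ m * norm (c * f x + d * g x) \<le> C" by blast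
qed

lemma rapidly_decreasing_linear_growth_mult:
  assumes "rapidly_decreasing f" and "\<And>x. norm (p x) \<le> A * (1 + norm x)"
  shows "rapidly_decreasing (\<lambda>x. p x * f x)"
  unfolding rapidly_decreasing_def
proof
  fix m
  obtain C where C: "\<And>x. (1 + norm x) ^ Suc m * norm (f x) \<le> C"
    using assms unfolding rapidly_decreasing_def by metis
  have "norm (p 0) \<le> A" using assms(2)[of 0] by simp
  then have A: "A \<ge> 0" using norm_ge_zero[of "p 0"] by linarith
  have "(1 + norm x) ^ m * norm (p x * f x) \<le> A * C" for x
  proof -
    have "(1 + norm x) ^ m * norm (p x * f x) \<le> (1 + norm x) ^ m * (A * (1 + norm x) * norm (f x))"
      by (auto simp: norm_mult intro!: mult_left_mono mult_right_mono assms(2))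
    also have "\<dots> = A * ((1 + norm x) ^ Suc m * norm (f x))" by (simp add: algebra_simps)
    also have "\<dots> \<le> A * C" using A C by (intro mult_left_mono) auto
    finally show ?thesis .
  qed
  then show "\<exists>C. \<forall>x. (1 + norm x) ^ m * norm (p x * f x) \<le> C" by blast
qed

lemma norm_of_real_inner_le:
  "norm (of_real (x \<bullet> a) :: complex) \<le> norm a * (1 + norm x)"
proof -
  have "norm (of_real (x \<bullet> a) :: complex) \<le> norm x * norm a"
    using Cauchy_Schwarz_ineq2[of x a] by simp
  also have "\<dots> \<le> norm a * (1 + norm x)" by (simp add: algebra_simps)
  finally show ?thesis .
qed

lemma iter_deriv_append: "iter_deriv (as @ bs) f = iter_deriv as (iter_deriv bs f)"
  by (induction as) auto

text \<open>All closure properties of Schwartz functions below come from exhibiting a class of functions that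
is closed under partial derivatives; this avoids Leibniz formulas for iterated derivatives.\<close>

lemma schwartz_coinduct:
  fixes f :: "'a::euclidean_space \<Rightarrow> complex"
  assumes "X f"
    and "\<And>g x. X g \<Longrightarrow> g differentiable (at x)"
    and "\<And>g. X g \<Longrightarrow> rapidly_decreasing g"
    and "\<And>g b. X g \<Longrightarrow> b \<in> Basis \<Longrightarrow> X (\<lambda>x. frechet_derivative g (at x) b)"
  shows "schwartz f"
proof -
  have "X (iter_deriv bs f)" if "set bs \<subseteq> Basis" for bs
    using that by (induction bs) (auto simp: assms)
  then show ?thesis
    unfolding schwartz_def using assms(2,3) by (auto simp: rapidly_decreasing_iff)
qed

lemma schwartz_rapidly_decreasing: "schwartz f \<Longrightarrow> rapidly_decreasing f"
  unfolding schwartz_def rapidly_decreasing_iff by (drule spec[of _ "[]"]) simp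

lemma schwartz_differentiable: "schwartz f \<Longrightarrow> f differentiable (at x)"
  unfolding schwartz_def by (drule spec[of _ "[]"]) simp

lemma schwartz_has_derivative:
  "schwartz f \<Longrightarrow> (f has_derivative frechet_derivative f (at x)) (at x)"
  using schwartz_differentiable frechet_derivative_works by blast

lemma schwartz_continuous: "schwartz f \<Longrightarrow> continuous_on S f"
  by (meson continuous_at_imp_continuous_on differentiable_imp_continuous_within
      schwartz_differentiable)

lemma schwartz_measurable [measurable]:
  "schwartz f \<Longrightarrow> f \<in> borel_measurable borel"
  by (simp add: borel_measurable_continuous_onI schwartz_continuous)

lemma schwartz_basis_deriv:
  assumes "schwartz f" "b \<in> Basis"
  shows "schwartz (\<lambda>x. frechet_derivative f (at x) b)"
proof -
  have "iter_deriv bs (\<lambda>x. frechet_derivative f (at x) b) = iter_deriv (bs @ [b]) f" for bs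
    by (simp add: iter_deriv_append)
  with assms show ?thesis
    unfolding schwartz_def by simp
qed

lemma schwartz_lincomb:
  fixes f g :: "'a::euclidean_space \<Rightarrow> complex"
  assumes "schwartz f" "schwartz g"
  shows "schwartz (\<lambda>x. c * f x + d * g x)"
proof (rule schwartz_coinduct[where X = "\<lambda>h. \<exists>f g. schwartz f \<and> schwartz g \<and> h = (\<lambda>x. c * f x + d * g x)"])
  show "\<exists>f' g'. schwartz f' \<and> schwartz g' \<and> (\<lambda>x. c * f x + d * g x) = (\<lambda>x. c * f' x + d * g' x)"
    using assms by blast
next
  fix h :: "'a \<Rightarrow> complex" and x assume "\<exists>f g. schwartz f \<and> schwartz g \<and> h = (\<lambda>x. c * f x + d * g x)"
  then obtain f g where fg: "schwartz f" "schwartz g" and h: "h = (\<lambda>x. c * f x + d * g x)" by blast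
  show "h differentiable at x" unfolding h
    by (intro derivative_intros fg[THEN schwartz_differentiable])
next
  fix h :: "'a \<Rightarrow> complex" assume "\<exists>f g. schwartz f \<and> schwartz g \<and> h = (\<lambda>x. c * f x + d * g x)"
  then obtain f g where fg: "schwartz f" "schwartz g" and h: "h = (\<lambda>x. c * f x + d * g x)" by blast
  show "rapidly_decreasing h" unfolding h
    by (intro rapidly_decreasing_lincomb fg[THEN schwartz_rapidly_decreasing])
next
  fix h :: "'a \<Rightarrow> complex" and b :: 'a
  assume "\<exists>f g. schwartz f \<and> schwartz g \<and> h = (\<lambda>x. c * f x + d * g x)" and b: "b \<in> Basis"
  then obtain f g where fg: "schwartz f" "schwartz g" and h: "h = (\<lambda>x. c * f x + d * g x)" by blast
  have "(h has_derivative (\<lambda>v. c * frechet_derivative f (at x) v + d * frechet_derivative g (at x) v)) (at x)" for x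
    unfolding h by (intro derivative_intros schwartz_has_derivative fg)
  then have "frechet_derivative h (at x) = (\<lambda>v. c * frechet_derivative f (at x) v + d * frechet_derivative g (at x) v)" for x
    by (rule frechet_derivative_at[symmetric])
  then have "(\<lambda>x. frechet_derivative h (at x) b)
      = (\<lambda>x. c * frechet_derivative f (at x) b + d * frechet_derivative g (at x) b)" by simp
  then show "\<exists>f g. schwartz f \<and> schwartz g \<and>
      (\<lambda>x. frechet_derivative h (at x) b) = (\<lambda>x. c * f x + d * g x)"
    using schwartz_basis_deriv[OF fg(1) b] schwartz_basis_deriv[OF fg(2) b]
    by (intro exI[of _ "\<lambda>x. frechet_derivative f (at x) b"]
        exI[of _ "\<lambda>x. frechet_derivative g (at x) b"]) simp
qed

lemma schwartz_add: "schwartz f \<Longrightarrow> schwartz g \<Longrightarrow> schwartz (\<lambda>x. f x + g x)"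
  using schwartz_lincomb[of f g 1 1] by simp

lemma schwartz_cmult: "schwartz f \<Longrightarrow> schwartz (\<lambda>x. c * f x)"
  using schwartz_lincomb[of f f c 0] by simp

lemma schwartz_sum:
  assumes "finite I" "I \<noteq> {}" "\<And>i. i \<in> I \<Longrightarrow> schwartz (f i)"
  shows "schwartz (\<lambda>x. \<Sum>i\<in>I. f i x)"
  using assms by (induction I rule: finite_ne_induct) (auto intro!: schwartz_add)

lemma schwartz_directional_deriv:
  fixes f :: "'a::euclidean_space \<Rightarrow> complex"
  assumes "schwartz f"
  shows "schwartz (\<lambda>x. frechet_derivative f (at x) v)"
proof -
  have "frechet_derivative f (at x) v = (\<Sum>b\<in>Basis. of_real (v \<bullet> b) * frechet_derivative f (at x) b)" for x
  proof -
    have l: "linear (frechet_derivative f (at x))"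
      using linear_frechet_derivative schwartz_differentiable[OF assms] by blast
    have "frechet_derivative f (at x) v = frechet_derivative f (at x) (\<Sum>b\<in>Basis. (v \<bullet> b) *\<^sub>R b)"
      by (simp add: euclidean_representation)
    also have "\<dots> = (\<Sum>b\<in>Basis. of_real (v \<bullet> b) * frechet_derivative f (at x) b)"
      using l by (simp add: linear_sum linear_cmul scaleR_conv_of_real)
    finally show ?thesis .
  qed
  moreover have "schwartz (\<lambda>x. \<Sum>b\<in>Basis. of_real (v \<bullet> b) * frechet_derivative f (at x) b)"
    by (intro schwartz_sum schwartz_cmult schwartz_basis_deriv assms) auto
  ultimately show ?thesis by simp
qed

text \<open>The functions \<open>(x \<bullet> a) f + g\<close> with Schwartz \<open>f\<close> and \<open>g\<close> form a suitable class: the coordinate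
factor has a constant derivative, so differentiating it only changes \<open>g\<close>.\<close>

lemma schwartz_inner_mult:
  fixes f :: "'a::euclidean_space \<Rightarrow> complex"
  assumes "schwartz f"
  shows "schwartz (\<lambda>x. of_real (x \<bullet> a) * f x)"
proof -
  let ?X = "\<lambda>h :: 'a \<Rightarrow> complex. \<exists>f g. schwartz f \<and> schwartz g \<and> h = (\<lambda>x. of_real (x \<bullet> a) * f x + g x)"
  show ?thesis
  proof (rule schwartz_coinduct[where X = ?X])
    have "schwartz (\<lambda>x. 0 * f x)" by (rule schwartz_cmult[OF assms])
    with assms show "?X (\<lambda>x. of_real (x \<bullet> a) * f x)"
      by (intro exI[of _ f] exI[of _ "\<lambda>x. 0 * f x"]) auto
  next
    fix h :: "'a \<Rightarrow> complex" and x assume "?X h"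
    then obtain f g where fg: "schwartz f" "schwartz g" and h: "h = (\<lambda>x. of_real (x \<bullet> a) * f x + g x)" by blast
    show "h differentiable at x"
      unfolding h by (rule differentiableI) (rule derivative_eq_intros schwartz_has_derivative fg refl)+
  next
    fix h :: "'a \<Rightarrow> complex" assume "?X h"
    then obtain f g where fg: "schwartz f" "schwartz g" and h: "h = (\<lambda>x. of_real (x \<bullet> a) * f x + g x)" by blast
    have "rapidly_decreasing (\<lambda>x. of_real (x \<bullet> a) * f x)"
      by (rule rapidly_decreasing_linear_growth_mult[OF schwartz_rapidly_decreasing[OF fg(1)]
          norm_of_real_inner_le])
    from rapidly_decreasing_lincomb[OF this schwartz_rapidly_decreasing[OF fg(2)], of 1 1]
    show "rapidly_decreasing h" unfolding h by simp
  next
    fix h :: "'a \<Rightarrow> complex" and b :: 'a assume "?X h" and b: "b \<in> Basis"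
    then obtain f g where fg: "schwartz f" "schwartz g" and h: "h = (\<lambda>x. of_real (x \<bullet> a) * f x + g x)" by blast
    have "(h has_derivative (\<lambda>v. of_real (x \<bullet> a) * frechet_derivative f (at x) v + of_real (v \<bullet> a) * f x
         + frechet_derivative g (at x) v)) (at x)" for x
      unfolding h by (rule derivative_eq_intros schwartz_has_derivative fg refl)+
    then have "frechet_derivative h (at x) = (\<lambda>v. of_real (x \<bullet> a) * frechet_derivative f (at x) v + of_real (v \<bullet> a) * f x
         + frechet_derivative g (at x) v)" for x
      by (rule frechet_derivative_at[symmetric])
    then have "(\<lambda>x. frechet_derivative h (at x) b)
      = (\<lambda>x. of_real (x \<bullet> a) * frechet_derivative f (at x) b +
           (of_real (b \<bullet> a) * f x + 1 * frechet_derivative g (at x) b))" by (simp add: algebra_simps)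
    moreover note schwartz_basis_deriv[OF fg(1) b]
      schwartz_lincomb[OF fg(1) schwartz_basis_deriv[OF fg(2) b], of "of_real (b \<bullet> a)" 1]
    ultimately show "?X (\<lambda>x. frechet_derivative h (at x) b)"
      by (intro exI[of _ "\<lambda>x. frechet_derivative f (at x) b"]
        exI[of _ "\<lambda>x. of_real (b \<bullet> a) * f x + 1 * frechet_derivative g (at x) b"]) simp
  qed
qed

lemma schwartz_cnj:
  fixes f :: "'a::euclidean_space \<Rightarrow> complex"
  assumes "schwartz f"
  shows "schwartz (\<lambda>x. cnj (f x))"
proof -
  let ?X = "\<lambda>h :: 'a \<Rightarrow> complex. \<exists>f. schwartz f \<and> h = (\<lambda>x. cnj (f x))"
  have deriv: "((\<lambda>x. cnj (f x)) has_derivative (\<lambda>v. cnj (frechet_derivative f (at x) v))) (at x)"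
    if "schwartz f" for f :: "'a \<Rightarrow> complex" and x
    by (rule bounded_linear.has_derivative[OF bounded_linear_cnj schwartz_has_derivative[OF that]])
  show ?thesis
  proof (rule schwartz_coinduct[where X = ?X])
    show "?X (\<lambda>x. cnj (f x))" using assms by blast
  next
    fix h :: "'a \<Rightarrow> complex" and x assume "?X h"
    then obtain f where "schwartz f" and h: "h = (\<lambda>x. cnj (f x))" by blast
    then show "h differentiable at x" using differentiableI[OF deriv[of f x]] by simp
  next
    fix h :: "'a \<Rightarrow> complex" assume "?X h"
    then obtain f where "schwartz f" and h: "h = (\<lambda>x. cnj (f x))" by blast
    then show "rapidly_decreasing h"
      using schwartz_rapidly_decreasing[of f] unfolding rapidly_decreasing_def by simp
  next
    fix h :: "'a \<Rightarrow> complex" and b :: 'a assume "?X h" and b: "b \<in> Basis"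
    then obtain f where f: "schwartz f" and h: "h = (\<lambda>x. cnj (f x))" by blast
    have "frechet_derivative h (at x) = (\<lambda>v. cnj (frechet_derivative f (at x) v))" for x
      unfolding h by (rule frechet_derivative_at[OF deriv[OF f], symmetric])
    then show "?X (\<lambda>x. frechet_derivative h (at x) b)" using schwartz_basis_deriv[OF f b] by auto
  qed
qed

text \<open>A basis vector of a product space lies in one of the factors, so a partial derivative of a tensor
product is again a single tensor product, and these form a suitable class without taking sums.\<close>

lemma schwartz_tensor:
  fixes f :: "'a::euclidean_space \<Rightarrow> complex" and g :: "'b::euclidean_space \<Rightarrow> complex"
  assumes "schwartz f" "schwartz g"
  shows "schwartz (\<lambda>(x, y). f x * g y)"
proof -
  let ?X = "\<lambda>h. \<exists>(f :: 'a \<Rightarrow> complex) (g :: 'b \<Rightarrow> complex). schwartz f \<and> schwartz g \<and> h = (\<lambda>z. f (fst z) * g (snd z))"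
  have deriv: "((\<lambda>z. f (fst z) * g (snd z)) has_derivative
      (\<lambda>v. f (fst z) * frechet_derivative g (at (snd z)) (snd v)
           + frechet_derivative f (at (fst z)) (fst v) * g (snd z))) (at z)"
    if "schwartz f" "schwartz g" for f :: "'a \<Rightarrow> complex" and g :: "'b \<Rightarrow> complex" and z
    by (intro has_derivative_mult has_derivative_compose[OF _ schwartz_has_derivative]
        has_derivative_fst has_derivative_snd has_derivative_ident that)
  have "schwartz (\<lambda>z. f (fst z) * g (snd z))"
  proof (rule schwartz_coinduct[where X = ?X])
    show "?X (\<lambda>z. f (fst z) * g (snd z))" using assms by blast
  next
    fix h :: "'a \<times> 'b \<Rightarrow> complex" and x assume "?X h"
    then obtain f :: "'a \<Rightarrow> complex" and g :: "'b \<Rightarrow> complex"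
      where "schwartz f" "schwartz g" and h: "h = (\<lambda>z. f (fst z) * g (snd z))" by blast
    then show "h differentiable at x" using differentiableI[OF deriv[of f g x]] by simp
  next
    fix h :: "'a \<times> 'b \<Rightarrow> complex" assume "?X h"
    then obtain f :: "'a \<Rightarrow> complex" and g :: "'b \<Rightarrow> complex"
      where fg: "schwartz f" "schwartz g" and h: "h = (\<lambda>z. f (fst z) * g (snd z))" by blast
    show "rapidly_decreasing h"
      unfolding rapidly_decreasing_def
    proof
      fix m
      obtain A where A: "\<And>x. (1 + norm x) ^ m * norm (f x) \<le> A"
        using schwartz_rapidly_decreasing[OF fg(1)] unfolding rapidly_decreasing_def by blast
      obtain B where B: "\<And>x. (1 + norm x) ^ m * norm (g x) \<le> B"
        using schwartz_rapidly_decreasing[OF fg(2)] unfolding rapidly_decreasing_def by blast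
      have "(1 + norm z) ^ m * norm (h z) \<le> A * B" for z
      proof -
        have "1 + norm z \<le> (1 + norm (fst z)) * (1 + norm (snd z))"
        proof -
          have "norm z \<le> norm (fst z) + norm (snd z)" using norm_Pair_le[of "fst z" "snd z"] by simp
          moreover have "0 \<le> norm (fst z) * norm (snd z)" by simp
          moreover have "(1 + norm (fst z)) * (1 + norm (snd z))
              = 1 + (norm (fst z) + norm (snd z)) + norm (fst z) * norm (snd z)"
            by (simp add: distrib_left distrib_right)
          ultimately show ?thesis by linarith
        qed
        then have "(1 + norm z) ^ m * norm (h z) \<le> ((1 + norm (fst z)) * (1 + norm (snd z))) ^ m * norm (h z)"
          by (intro mult_right_mono power_mono) auto
        also have "\<dots> = ((1 + norm (fst z)) ^ m * norm (f (fst z))) * ((1 + norm (snd z)) ^ m * norm (g (snd z)))"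
          by (simp add: h norm_mult power_mult_distrib)
        also have "\<dots> \<le> A * B"
          by (intro mult_mono' A B mult_nonneg_nonneg) auto
        finally show ?thesis .
      qed
      then show "\<exists>C. \<forall>x. (1 + norm x) ^ m * norm (h x) \<le> C" by blast
    qed
  next
    fix h :: "'a \<times> 'b \<Rightarrow> complex" and b :: "'a \<times> 'b" assume "?X h" and b: "b \<in> Basis"
    then obtain f :: "'a \<Rightarrow> complex" and g :: "'b \<Rightarrow> complex"
      where fg: "schwartz f" "schwartz g" and h: "h = (\<lambda>z. f (fst z) * g (snd z))" by blast
    have D: "frechet_derivative h (at z) = (\<lambda>v. f (fst z) * frechet_derivative g (at (snd z)) (snd v)
           + frechet_derivative f (at (fst z)) (fst v) * g (snd z))" for z
      unfolding h by (rule frechet_derivative_at[OF deriv[OF fg], symmetric])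
    \<comment> \<open>the zero component of a basis vector contributes nothing\<close>
    have 0: "frechet_derivative f (at x) 0 = 0" "frechet_derivative g (at y) 0 = 0" for x y
      by (rule linear_0 linear_frechet_derivative schwartz_differentiable fg)+
    from b consider c where "c \<in> Basis" "b = (c, 0)" | c where "c \<in> Basis" "b = (0, c)"
      unfolding Basis_prod_def by blast
    then show "?X (\<lambda>x. frechet_derivative h (at x) b)"
    proof cases
      case 1
      then have "(\<lambda>z. frechet_derivative h (at z) b) = (\<lambda>z. frechet_derivative f (at (fst z)) c * g (snd z))"
        using 0 by (simp add: D)
      then show ?thesis using schwartz_basis_deriv[OF fg(1) 1(1)] fg(2)
        by (intro exI[of _ "\<lambda>x. frechet_derivative f (at x) c"] exI[of _ g]) auto
    next
      case 2
      then have "(\<lambda>z. frechet_derivative h (at z) b) = (\<lambda>z. f (fst z) * frechet_derivative g (at (snd z)) c)"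
        using 0 by (simp add: D)
      then show ?thesis using schwartz_basis_deriv[OF fg(2) 2(1)] fg(1)
        by (intro exI[of _ f] exI[of _ "\<lambda>x. frechet_derivative g (at x) c"]) auto
    qed
  qed
  then show ?thesis by (simp add: case_prod_unfold)
qed

text \<open>By the chain rule the derivative of \<open>F(l v + c)\<close> along \<open>b\<close> is the derivative of \<open>F\<close> along \<open>l b\<close>,
composed with the same affine map.  The lower bound on \<open>l\<close> is what carries the decay of \<open>F\<close> over to
the composition.\<close>

lemma schwartz_compose_affine:
  fixes F :: "'b::euclidean_space \<Rightarrow> complex" and l :: "'a::euclidean_space \<Rightarrow> 'b"
  assumes F: "schwartz F" and l: "bounded_linear l" and inj: "\<And>v. norm v \<le> K * norm (l v)"
  shows "schwartz (\<lambda>v. F (l v + c))"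
proof -
  let ?X = "\<lambda>h :: 'a \<Rightarrow> complex. \<exists>F. schwartz F \<and> h = (\<lambda>v. F (l v + c))"
  have deriv: "((\<lambda>v. F (l v + c)) has_derivative (\<lambda>w. frechet_derivative F (at (l v + c)) (l w))) (at v)"
    if "schwartz F" for F v
    by (rule has_derivative_compose[OF _ schwartz_has_derivative[OF that]])
      (auto intro!: derivative_eq_intros bounded_linear.has_derivative[OF l])
  show ?thesis
  proof (rule schwartz_coinduct[where X = ?X])
    show "?X (\<lambda>v. F (l v + c))" using assms by blast
  next
    fix h :: "'a \<Rightarrow> complex" and x assume "?X h"
    then obtain F where "schwartz F" and h: "h = (\<lambda>v. F (l v + c))" by blast
    then show "h differentiable at x" using differentiableI[OF deriv[of F x]] by simp
  next
    fix h :: "'a \<Rightarrow> complex" assume "?X h"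
    then obtain F where F: "schwartz F" and h: "h = (\<lambda>v. F (l v + c))" by blast
    define A where "A = (1 + \<bar>K\<bar>) * (1 + norm c)"
    have A: "1 + norm v \<le> A * (1 + norm (l v + c))" for v
    proof -
      have "norm v \<le> K * norm (l v)" by (rule inj)
      also have "\<dots> \<le> \<bar>K\<bar> * (norm (l v + c) + norm c)"
        using norm_triangle_ineq4[of "l v + c" c] by (intro mult_mono) auto
      finally have 1: "norm v \<le> \<bar>K\<bar> * (norm (l v + c) + norm c)" .
      have "0 \<le> norm (l v + c)" "0 \<le> norm c" "0 \<le> \<bar>K\<bar>" "0 \<le> norm c * norm (l v + c)"
         "0 \<le> \<bar>K\<bar> * (norm c * norm (l v + c))" by auto
      moreover have "A * (1 + norm (l v + c)) = 1 + \<bar>K\<bar> * (norm (l v + c) + norm c) + (norm c + norm (l v + c) + \<bar>K\<bar>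
          + norm c * norm (l v + c) + \<bar>K\<bar> * (norm c * norm (l v + c)))"
        unfolding A_def by (simp add: algebra_simps)
      ultimately show ?thesis using 1 by linarith
    qed
    show "rapidly_decreasing h"
      unfolding rapidly_decreasing_def
    proof
      fix m
      obtain C where C: "\<And>x. (1 + norm x) ^ m * norm (F x) \<le> C"
        using F[THEN schwartz_rapidly_decreasing] unfolding rapidly_decreasing_def by metis
      have "(1 + norm v) ^ m * norm (h v) \<le> A ^ m * C" for v
      proof -
        have "(1 + norm v) ^ m * norm (h v) \<le> (A * (1 + norm (l v + c))) ^ m * norm (h v)"
          by (intro mult_right_mono power_mono A) auto
        also have "\<dots> = A ^ m * ((1 + norm (l v + c)) ^ m * norm (F (l v + c)))"
          by (simp add: h power_mult_distrib)
        also have "\<dots> \<le> A ^ m * C"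
          by (intro mult_left_mono C) (auto simp: A_def)
        finally show ?thesis .
      qed
      then show "\<exists>C. \<forall>x. (1 + norm x) ^ m * norm (h x) \<le> C" by blast
    qed
  next
    fix h :: "'a \<Rightarrow> complex" and b :: 'a assume "?X h" and b: "b \<in> Basis"
    then obtain F where F: "schwartz F" and h: "h = (\<lambda>v. F (l v + c))" by blast
    have "frechet_derivative h (at v) = (\<lambda>w. frechet_derivative F (at (l v + c)) (l w))" for v
      unfolding h by (rule frechet_derivative_at[OF deriv[OF F], symmetric])
    then show "?X (\<lambda>x. frechet_derivative h (at x) b)"
      using schwartz_directional_deriv[OF F, of "l b"]
      by (intro exI[of _ "\<lambda>x. frechet_derivative F (at x) (l b)"]) auto
  qed
qed

lemma schwartz_slice:
  fixes M :: "'a::euclidean_space \<times> 'b::euclidean_space \<Rightarrow> complex"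
  assumes "schwartz M"
  shows "schwartz (\<lambda>z. M (z, t))"
proof -
  have "schwartz (\<lambda>z. M ((z, 0) + (0, t)))"
    by (rule schwartz_compose_affine[OF assms, of "\<lambda>z. (z, 0)" 1])
      (auto intro!: bounded_linear_Pair bounded_linear_ident bounded_linear_zero)
  then show ?thesis by simp
qed

lemma schwartz_slice_snd:
  fixes M :: "'a::euclidean_space \<times> 'b::euclidean_space \<Rightarrow> complex"
  assumes "schwartz M"
  shows "schwartz (\<lambda>t. M (z, t))"
proof -
  have "schwartz (\<lambda>t. M ((0, t) + (z, 0)))"
    by (rule schwartz_compose_affine[OF assms, of "\<lambda>z. (0, z)" 1])
      (auto intro!: bounded_linear_Pair bounded_linear_ident bounded_linear_zero)
  then show ?thesis by simp
qed

text \<open>The Wigner-type integrands below have this form, with two Gaussians next to \<open>f\<close> and \<open>g\<close>.  No single factor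
decays in all directions; it is enough that the four arguments together control \<open>v\<close>.\<close>

lemma schwartz_prod4:
  fixes F1 F2 F3 F4 :: "'b::euclidean_space \<Rightarrow> complex" and l1 l2 l3 l4 :: "'a::euclidean_space \<Rightarrow> 'b"
  assumes F: "schwartz F1" "schwartz F2" "schwartz F3" "schwartz F4"
    and l: "bounded_linear l1" "bounded_linear l2" "bounded_linear l3" "bounded_linear l4"
    and inj: "\<And>v. norm v \<le> K * (norm (l1 v) + norm (l2 v) + norm (l3 v) + norm (l4 v))"
  shows "schwartz (\<lambda>v. F1 (l1 v + c1) * F2 (l2 v + c2) * F3 (l3 v + c3) * F4 (l4 v + c4))"
proof -
  let ?l = "\<lambda>v. (l1 v, l2 v, l3 v, l4 v)"
  have "schwartz (\<lambda>v. (\<lambda>(x1, y). F1 x1 * (\<lambda>(x2, y). F2 x2 * (\<lambda>(x3, x4). F3 x3 * F4 x4) y) y) (?l v + (c1, c2, c3, c4)))"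
  proof (rule schwartz_compose_affine[where K = "4 * \<bar>K\<bar>"])
    show "schwartz (\<lambda>(x1, y). F1 x1 * (\<lambda>(x2, y). F2 x2 * (\<lambda>(x3, x4). F3 x3 * F4 x4) y) y)"
      by (intro schwartz_tensor F)
    show "bounded_linear ?l" by (intro bounded_linear_Pair l)
    fix v
    have n1: "norm (l1 v) \<le> norm (?l v)" by (rule norm_fst_le)
    have n2: "norm (l2 v) \<le> norm (?l v)"
      by (rule order_trans[OF norm_fst_le norm_snd_le])
    have n3: "norm (l3 v) \<le> norm (?l v)"
      by (rule order_trans[OF order_trans[OF norm_fst_le norm_snd_le] norm_snd_le])
    have n4: "norm (l4 v) \<le> norm (?l v)"
      by (rule order_trans[OF order_trans[OF norm_snd_le norm_snd_le] norm_snd_le])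
    have "norm v \<le> \<bar>K\<bar> * (norm (l1 v) + norm (l2 v) + norm (l3 v) + norm (l4 v))"
      by (rule order_trans[OF inj mult_right_mono]) auto
    also have "\<dots> \<le> \<bar>K\<bar> * (4 * norm (?l v))" using n1 n2 n3 n4 by (intro mult_left_mono) auto
    finally show "norm v \<le> 4 * \<bar>K\<bar> * norm (?l v)" by simp
  qed
  then show ?thesis by (simp add: mult.assoc)
qed


section \<open>Lebesgue integration on Euclidean spaces\<close>

lemma integrable_lborel_prod:
  fixes \<phi> :: "'a::euclidean_space \<Rightarrow> real \<Rightarrow> 'b::{real_normed_field, banach, second_countable_topology}"
  assumes "\<And>b. b \<in> Basis \<Longrightarrow> integrable lborel (\<phi> b)"
  shows "integrable lborel (\<lambda>x. \<Prod>b\<in>Basis. \<phi> b (x \<bullet> b))" (is ?I)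
    and "(LINT x|lborel. (\<Prod>b\<in>Basis. \<phi> b (x \<bullet> b))) = (\<Prod>b\<in>Basis. (LINT t|lborel. \<phi> b t))" (is ?E)
proof -
  interpret product_sigma_finite "\<lambda>_::'a. lborel :: real measure" ..
  have [measurable]: "\<phi> b \<in> borel_measurable borel" if "b \<in> Basis" for b
    using assms[OF that] by auto
  have [measurable]: "(\<lambda>x. \<Prod>b\<in>Basis. \<phi> b (x \<bullet> b)) \<in> borel_measurable borel"
    by (intro borel_measurable_prod) measurable
  have s: "(\<Prod>b\<in>Basis. \<phi> b ((\<Sum>c\<in>Basis. f c *\<^sub>R c) \<bullet> b)) = (\<Prod>b\<in>Basis. \<phi> b (f b))" for f :: "'a \<Rightarrow> real"
    by (intro prod.cong) auto
  show ?I
    by (subst lborel_eq, subst integrable_distr_eq) (auto simp: s intro!: product_integrable_prod assms)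
  show ?E
    by (subst lborel_eq, subst integral_distr) (auto simp: s intro!: product_integral_prod assms)
qed

lemma lborel_integral_affine:
  fixes f :: "'a::euclidean_space \<Rightarrow> 'b::{banach, second_countable_topology}"
  assumes [measurable]: "f \<in> borel_measurable borel" and c: "c \<noteq> 0"
  shows "(LINT x|lborel. f (t + c *\<^sub>R x)) = (LINT x|lborel. f x) /\<^sub>R \<bar>c\<bar> ^ DIM('a)"
proof -
  have "(LINT x|lborel. f x) = \<bar>c\<bar> ^ DIM('a) *\<^sub>R (LINT x|lborel. f (t + c *\<^sub>R x))"
    by (subst lborel_affine[OF c, of t], subst integral_density)
       (auto simp: integral_distr)
  with c show ?thesis by simp
qed

lemma lborel_integrable_affine:
  fixes f :: "'a::euclidean_space \<Rightarrow> 'b::{banach, second_countable_topology}"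
  assumes f: "integrable lborel f" and c: "c \<noteq> 0"
  shows "integrable lborel (\<lambda>x. f (t + c *\<^sub>R x))"
proof -
  have [measurable]: "f \<in> borel_measurable borel" using f by auto
  have "integrable (density (distr lborel borel (\<lambda>x. t + c *\<^sub>R x)) (\<lambda>_. ennreal (\<bar>c\<bar>^DIM('a)))) f"
    using f lborel_affine[OF c, of t] by (simp add: ennreal_power)
  then have "integrable lborel (\<lambda>x. \<bar>c\<bar> ^ DIM('a) *\<^sub>R f (t + c *\<^sub>R x))"
    by (subst (asm) integrable_density) (auto simp: integrable_distr_eq)
  from integrable_scaleR_right[OF this, of "inverse (\<bar>c\<bar> ^ DIM('a))"] show ?thesis
    using c by simp
qed

lemma lborel_integral_translate:
  fixes f :: "'a::euclidean_space \<Rightarrow> 'b::{banach, second_countable_topology}"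
  assumes "f \<in> borel_measurable borel"
  shows "(LINT x|lborel. f (x + t)) = (LINT x|lborel. f x)"
  using lborel_integral_affine[OF assms, of 1 t] by (simp add: add.commute)

lemma lborel_integral_uminus:
  fixes f :: "'a::euclidean_space \<Rightarrow> 'b::{banach, second_countable_topology}"
  assumes "f \<in> borel_measurable borel"
  shows "(LINT x|lborel. f (- x)) = (LINT x|lborel. f x)"
  using lborel_integral_affine[OF assms, of "-1" 0] by simp

lemma
  fixes f :: "'a::euclidean_space \<Rightarrow> 'b::euclidean_space \<Rightarrow> 'c::{banach, second_countable_topology}"
  assumes "integrable lborel (\<lambda>(x, y). f x y)"
  shows lborel_fubini: "(LINT (x, y)|lborel. f x y) = (LINT x|lborel. LINT y|lborel. f x y)"
    and lborel_fubini_swap: "(LINT (x, y)|lborel. f x y) = (LINT y|lborel. LINT x|lborel. f x y)"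
proof -
  have i: "integrable (lborel \<Otimes>\<^sub>M lborel) (case_prod f)" using assms by (simp add: lborel_prod)
  show 1: "(LINT (x, y)|lborel. f x y) = (LINT x|lborel. LINT y|lborel. f x y)"
    using lborel_pair.integral_fst'[OF i] by (simp add: lborel_prod)
  show "(LINT (x, y)|lborel. f x y) = (LINT y|lborel. LINT x|lborel. f x y)"
    unfolding 1 by (rule lborel_pair.Fubini_integral[OF i, symmetric])
qed

lemma lborel_integrable_swap:
  fixes f :: "'a::euclidean_space \<Rightarrow> 'b::euclidean_space \<Rightarrow> 'c::{banach, second_countable_topology}"
  assumes "integrable lborel (\<lambda>(x, y). f x y)"
  shows "integrable lborel (\<lambda>(y, x). f x y)"
  using lborel_pair.integrable_product_swap[of "case_prod f"] assms by (simp add: lborel_prod case_prod_unfold)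

lemma lborel_integral_swap:
  fixes f :: "'a::euclidean_space \<Rightarrow> 'b::euclidean_space \<Rightarrow> 'c::{banach, second_countable_topology}"
  assumes "(\<lambda>(x, y). f x y) \<in> borel_measurable borel"
  shows "(LINT (x, y)|lborel. f x y) = (LINT (y, x)|lborel. f x y)"
  using lborel_pair.integral_product_swap[of "case_prod f"] assms by (simp add: lborel_prod case_prod_unfold)

lemma borel_measurable_lborel_integral:
  fixes f :: "'a::euclidean_space \<Rightarrow> 'b::euclidean_space \<Rightarrow> 'c::{banach, second_countable_topology}"
  assumes "(\<lambda>(x, y). f x y) \<in> borel_measurable borel"
  shows "(\<lambda>x. LINT y|lborel. f x y) \<in> borel_measurable borel"
proof (rule lborel.borel_measurable_lebesgue_integral)
  have "sets (borel \<Otimes>\<^sub>M (lborel :: 'b measure)) = sets (borel :: ('a \<times> 'b) measure)"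
    by (subst borel_prod[symmetric], rule sets_pair_measure_cong) simp_all
  then show "(\<lambda>(x, y). f x y) \<in> borel_measurable (borel \<Otimes>\<^sub>M lborel)"
    using assms measurable_cong_sets[of _ _ "borel :: 'c measure", OF _ refl] by blast
qed

lemma integrable_tensor_bound:
  fixes F :: "'a::euclidean_space \<Rightarrow> 'b::euclidean_space \<Rightarrow> 'c::{banach, second_countable_topology}"
  assumes m: "(\<lambda>(x, y). F x y) \<in> borel_measurable borel"
    and f: "integrable lborel f" and g: "integrable lborel g"
    and le: "\<And>x y. norm (F x y) \<le> f x * (g y :: real)"
  shows "integrable lborel (\<lambda>(x, y). F x y)"
proof -
  have [measurable]: "f \<in> borel_measurable borel" "g \<in> borel_measurable borel"
    using f g by auto
  have "integrable (lborel \<Otimes>\<^sub>M lborel) (\<lambda>(x, y). f x * g y)"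
  proof (rule lborel_pair.Fubini_integrable)
    show "(\<lambda>(x, y). f x * g y) \<in> borel_measurable (lborel \<Otimes>\<^sub>M lborel)"
      by measurable
    show "AE x in lborel. integrable lborel (\<lambda>y. case (x, y) of (x, y) \<Rightarrow> f x * g y)"
      using g by auto
    have "integrable lborel (\<lambda>x. \<bar>f x\<bar> * (LINT y|lborel. \<bar>g y\<bar>))" using f by auto
    then show "integrable lborel (\<lambda>x. LINT y|lborel. norm (case (x, y) of (x, y) \<Rightarrow> f x * g y))"
      by (simp add: abs_mult)
  qed
  then have "integrable lborel (\<lambda>(x, y). f x * g y)" by (simp add: lborel_prod)
  then show ?thesis
  proof (rule Bochner_Integration.integrable_bound)
    show "AE z in lborel. norm (case z of (x, y) \<Rightarrow> F x y) \<le> norm (case z of (x, y) \<Rightarrow> f x * g y)"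
      using le by (intro AE_I2) (auto intro: order_trans[OF _ abs_ge_self])
  qed (use m in simp)
qed

text \<open>The domination by \<open>f x * h (y, z)\<close>, with all slices of \<open>h\<close> integrable, makes each iterated
integral absolutely convergent for all values of the outer variables.  This gives the exchange from
Fubini's theorem for pairs, without reassociating the product measure.\<close>

lemma lborel_fubini3:
  fixes J :: "'a::euclidean_space \<Rightarrow> 'b::euclidean_space \<Rightarrow> 'c::euclidean_space \<Rightarrow> 'd::{banach, second_countable_topology}"
  assumes m: "(\<lambda>(x, t). J x (fst t) (snd t)) \<in> borel_measurable borel"
    and f: "integrable lborel f" and h: "integrable lborel h"
    and h_slice: "\<And>y. integrable lborel (\<lambda>z. h (y, z))"
    and le: "\<And>x y z. norm (J x y z) \<le> f x * (h (y, z) :: real)"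
  shows "(LINT (x, y)|lborel. LINT z|lborel. J x y z) = (LINT (y, z)|lborel. LINT x|lborel. J x y z)"
proof -
  have mc: "(\<lambda>p. J (l1 p) (l2 p) (l3 p)) \<in> borel_measurable borel"
    if "continuous_on UNIV (\<lambda>p. (l1 p, l2 p, l3 p))" for l1 :: "'x::euclidean_space \<Rightarrow> 'a" and l2 l3
    using measurable_compose[OF borel_measurable_continuous_onI[OF that] m] by simp
  have i: "integrable lborel (\<lambda>(x, t). J x (fst t) (snd t))"
    by (rule integrable_tensor_bound[OF m f h]) (use le[of _ "fst t" "snd t" for t] in simp)
  have i1: "integrable lborel (\<lambda>(y, z). J x y z)" for x
  proof (rule Bochner_Integration.integrable_bound)
    show "integrable lborel (\<lambda>t. f x * h t)" by (intro integrable_mult_right h)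
    show "(\<lambda>(y, z). J x y z) \<in> borel_measurable lborel"
      using mc[of "\<lambda>_. x" fst snd] by (simp add: case_prod_unfold continuous_intros)
    show "AE t in lborel. norm (case t of (y, z) \<Rightarrow> J x y z) \<le> norm (f x * h t)"
      by (intro AE_I2) (auto intro: order_trans[OF le abs_ge_self])
  qed
  have h': "integrable lborel (\<lambda>y. LINT z|lborel. h (y, z))"
    using lborel_pair.integrable_fst'[of h] h by (simp add: lborel_prod)
  have i2: "integrable lborel (\<lambda>(x, y). LINT z|lborel. J x y z)"
  proof (rule integrable_tensor_bound[OF _ f h'])
    show "(\<lambda>(x, y). LINT z|lborel. J x y z) \<in> borel_measurable borel"
      unfolding case_prod_unfold
      by (rule borel_measurable_lborel_integral)
        (use mc[of "\<lambda>p. fst (fst p)" "\<lambda>p. snd (fst p)" snd] in \<open>simp add: case_prod_unfold continuous_intros\<close>)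
    fix x y
    have "norm (LINT z|lborel. J x y z) \<le> (LINT z|lborel. norm (J x y z))" by (rule integral_norm_bound)
    also have "\<dots> \<le> (LINT z|lborel. f x * h (y, z))"
    proof (rule integral_mono)
      show "integrable lborel (\<lambda>z. norm (J x y z))"
      proof (rule integrable_norm, rule Bochner_Integration.integrable_bound)
        show "integrable lborel (\<lambda>z. f x * h (y, z))" by (intro integrable_mult_right h_slice)
        show "(\<lambda>z. J x y z) \<in> borel_measurable lborel"
          using mc[of "\<lambda>_. x" "\<lambda>_. y" "\<lambda>z. z"] by (simp add: continuous_intros)
        show "AE z in lborel. norm (J x y z) \<le> norm (f x * h (y, z))"
          by (intro AE_I2) (auto intro: order_trans[OF le abs_ge_self])
      qed
    qed (intro integrable_mult_right h_slice le)+
    finally show "norm (LINT z|lborel. J x y z) \<le> f x * (LINT z|lborel. h (y, z))" by simp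
  qed
  have "(LINT (x, y)|lborel. LINT z|lborel. J x y z) = (LINT x|lborel. LINT y|lborel. LINT z|lborel. J x y z)"
    by (rule lborel_fubini[OF i2])
  also have "\<dots> = (LINT x|lborel. LINT (y, z)|lborel. J x y z)"
    using lborel_fubini[OF i1] by simp
  also have "\<dots> = (LINT (y, z)|lborel. LINT x|lborel. J x y z)"
    using lborel_fubini[OF i] lborel_fubini_swap[OF i] by (simp add: case_prod_unfold)
  finally show ?thesis .
qed

text \<open>Integration by parts from translation invariance alone: \<open>F(x + b) - F(x)\<close> has integral \<open>0\<close>, and it
is the integral over \<open>t\<close> in \<open>[0, 1]\<close> of the derivative at \<open>x + t b\<close>, whose integral over \<open>x\<close> does not
depend on \<open>t\<close>.\<close>

lemma integral_directional_derivative_eq_0: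
  fixes F :: "'a::euclidean_space \<Rightarrow> complex"
  assumes D: "\<And>x. (F has_derivative D x) (at x)"
    and F: "integrable lborel F" and DF: "integrable lborel (\<lambda>x. D x b)"
    and cont: "continuous_on UNIV (\<lambda>x. D x b)"
  shows "(LINT x|lborel. D x b) = 0"
proof -
  let ?G = "\<lambda>(x::'a) (t::real). indicator {0..1} t *\<^sub>R D (x + t *\<^sub>R b) b"
  have [measurable]: "(\<lambda>x. D x b) \<in> borel_measurable borel" "F \<in> borel_measurable borel"
    using DF F by auto
  have FTC: "(LINT t|lborel. ?G x t) = F (x + b) - F x" for x
  proof -
    have "(LINT t|lborel. ?G x t) = F (x + 1 *\<^sub>R b) - F (x + 0 *\<^sub>R b)"
    proof (rule integral_FTC_Icc)
      fix t :: real
      have "((\<lambda>t. F (x + t *\<^sub>R b)) has_derivative (\<lambda>s. D (x + t *\<^sub>R b) (s *\<^sub>R b))) (at t within {0..1})"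
        by (rule has_derivative_compose[OF _ D]) (auto intro!: derivative_eq_intros)
      then show "((\<lambda>t. F (x + t *\<^sub>R b)) has_vector_derivative D (x + t *\<^sub>R b) b) (at t within {0..1})"
        using linear_cmul[OF has_derivative_linear[OF D]] by (simp add: has_vector_derivative_def)
      show "continuous_on {0..1} (\<lambda>t. D (x + t *\<^sub>R b) b)"
        by (rule continuous_on_compose2[OF cont]) (auto intro!: continuous_intros)
    qed simp
    then show ?thesis by simp
  qed
  have trD: "(LINT x|lborel. D (x + c) b) = (LINT x|lborel. D x b)" for c
    using lborel_integral_translate[of "\<lambda>x. D x b" c] by simp
  have trN: "(LINT x|lborel. norm (D (x + c) b)) = (LINT x|lborel. norm (D x b))" for c
    using lborel_integral_translate[of "\<lambda>x. norm (D x b)" c] by simp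
  have iD: "integrable lborel (\<lambda>x. D (x + c) b)" for c
    using lborel_integrable_affine[OF DF, of 1 c] by (simp add: add.commute)
  have i: "integrable (lborel \<Otimes>\<^sub>M lborel) (\<lambda>(t, x). ?G x t)"
  proof (rule lborel_pair.Fubini_integrable)
    show "(\<lambda>(t, x). ?G x t) \<in> borel_measurable (lborel \<Otimes>\<^sub>M lborel)"
      unfolding case_prod_unfold by measurable
    show "integrable lborel (\<lambda>t. LINT x|lborel. norm (case (t, x) of (t, x) \<Rightarrow> ?G x t))"
      by (simp add: trN)
    show "AE t in lborel. integrable lborel (\<lambda>x. case (t, x) of (t, x) \<Rightarrow> ?G x t)"
      using iD by auto
  qed
  have "(LINT x|lborel. LINT t|lborel. ?G x t) = (LINT t|lborel. LINT x|lborel. ?G x t)"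
    by (rule lborel_pair.Fubini_integral[OF i])
  also have "\<dots> = (LINT x|lborel. D x b)"
    by (simp add: trD)
  also have "(LINT x|lborel. LINT t|lborel. ?G x t) = (LINT x|lborel. F (x + b) - F x)"
    by (simp only: FTC)
  also have "\<dots> = (LINT x|lborel. F (x + b)) - (LINT x|lborel. F x)"
    using lborel_integrable_affine[OF F, of 1 b] by (intro Bochner_Integration.integral_diff F) (simp add: add.commute)
  also have "\<dots> = 0" by (simp add: lborel_integral_translate)
  finally show ?thesis by simp
qed


section \<open>Integrability of Schwartz functions\<close>

text \<open>The product form reduces the integrability of the weight to one dimension, and its reciprocal is a
polynomial, so that dividing by the weight keeps a function in the Schwartz class.\<close>

definition weight :: "'a::euclidean_space \<Rightarrow> real" where
  "weight x = (\<Prod>b\<in>Basis. inverse (1 + (x \<bullet> b)\<^sup>2))"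

lemma weight_pos: "weight x > 0"
  unfolding weight_def by (intro prod_pos) (auto intro: add_pos_nonneg)

lemma weight_le_1: "weight x \<le> 1"
  unfolding weight_def
proof (intro prod_le_1 conjI)
  fix b :: 'a
  show "inverse (1 + (x \<bullet> b)\<^sup>2) \<le> 1"
    by (rule inverse_le_1_iff[THEN iffD2]) simp
qed simp

lemma weight_Pair: "weight (x, y) = weight x * weight y"
proof -
  have "weight (x, y) = (\<Prod>b\<in>(\<lambda>u. (u, 0)) ` Basis. inverse (1 + ((x, y) \<bullet> b)\<^sup>2)) *
     (\<Prod>b\<in>(\<lambda>u. (0, u)) ` Basis. inverse (1 + ((x, y) \<bullet> b)\<^sup>2))"
    unfolding weight_def Basis_prod_def by (rule prod.union_disjoint) auto
  also have "(\<Prod>b\<in>(\<lambda>u. (u, 0)) ` Basis. inverse (1 + ((x, y) \<bullet> b)\<^sup>2)) = weight x"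
    unfolding weight_def by (subst prod.reindex) (auto simp: inj_on_def)
  also have "(\<Prod>b\<in>(\<lambda>u. (0, u)) ` Basis. inverse (1 + ((x, y) \<bullet> b)\<^sup>2)) = weight y"
    unfolding weight_def by (subst prod.reindex) (auto simp: inj_on_def)
  finally show ?thesis .
qed

lemma weight_measurable [measurable]: "weight \<in> borel_measurable borel"
  unfolding weight_def by measurable

lemma integrable_weight: "integrable lborel (weight :: 'a::euclidean_space \<Rightarrow> real)"
proof -
  have "integrable lborel (\<lambda>t::real. inverse (1 + t\<^sup>2))"
    using integrable_inverse_1_plus_square by (simp add: set_integrable_def)
  then have "integrable lborel (\<lambda>x::'a. \<Prod>b\<in>Basis. (\<lambda>_ t. inverse (1 + t\<^sup>2)) b (x \<bullet> b))"
    by (intro integrable_lborel_prod) auto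
  then show ?thesis unfolding weight_def .
qed

lemma integrable_weight_bound:
  fixes f :: "'a::euclidean_space \<Rightarrow> 'b::{banach, second_countable_topology}"
  assumes "f \<in> borel_measurable borel" "\<And>x. norm (f x) \<le> C * weight x"
  shows "integrable lborel f"
proof (rule Bochner_Integration.integrable_bound)
  show "integrable lborel (\<lambda>x :: 'a. C * weight x)" by (intro integrable_mult_right integrable_weight)
  show "AE x in lborel. norm (f x) \<le> norm (C * weight x)"
    using assms(2) by (intro AE_I2) (simp add: order_trans[OF _ abs_ge_self])
qed (use assms in simp)

lemma norm_prod_eq_inverse_weight:
  "norm (\<Prod>b\<in>Basis. complex_of_real (1 + (x \<bullet> b)\<^sup>2)) = inverse (weight x)"
proof -
  have "norm (\<Prod>b\<in>Basis. complex_of_real (1 + (x \<bullet> b)\<^sup>2)) = (\<Prod>b\<in>Basis. 1 + (x \<bullet> b)\<^sup>2)"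
    by (simp add: prod_norm[symmetric] norm_of_real del: of_real_add)
  then show ?thesis
    unfolding weight_def by (simp add: prod_inversef[symmetric] comp_def)
qed

text \<open>Multiplying by \<open>1 + (x \<bullet> b)\<^sup>2\<close> for every basis vector \<open>b\<close> leaves a Schwartz function, which is
bounded.\<close>

lemma schwartz_le_weight:
  fixes f :: "'a::euclidean_space \<Rightarrow> complex"
  assumes "schwartz f"
  shows "\<exists>C\<ge>0. \<forall>x. norm (f x) \<le> C * weight x"
proof -
  have "schwartz (\<lambda>x. (\<Prod>b\<in>B. of_real (1 + (x \<bullet> b)\<^sup>2)) * f x)" if "finite B" for B
    using that
  proof (induction B)
    case empty then show ?case using assms by simp
  next
    case (insert b B)
    let ?g = "\<lambda>x. (\<Prod>b\<in>B. of_real (1 + (x \<bullet> b)\<^sup>2)) * f x"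
    have "schwartz (\<lambda>x. ?g x + of_real (x \<bullet> b) * (of_real (x \<bullet> b) * ?g x))"
      by (intro schwartz_add schwartz_inner_mult insert)
    then show ?case using insert.hyps by (simp add: algebra_simps power2_eq_square)
  qed
  from this[OF finite_Basis]
  have "rapidly_decreasing (\<lambda>x. (\<Prod>b\<in>Basis. of_real (1 + (x \<bullet> b)\<^sup>2)) * f x)"
    by (rule schwartz_rapidly_decreasing)
  then obtain C where C: "\<And>x. (1 + norm x) ^ 0 * norm ((\<Prod>b\<in>Basis. of_real (1 + (x \<bullet> b)\<^sup>2)) * f x) \<le> C"
    unfolding rapidly_decreasing_def by blast
  have "norm (f x) \<le> C * weight x" for x
  proof -
    have "inverse (weight x) * norm (f x) \<le> C"
      using C[of x] by (simp only: norm_mult norm_prod_eq_inverse_weight power_0 mult_1)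
    then show ?thesis using weight_pos[of x] by (simp add: field_simps)
  qed
  moreover have "C \<ge> 0" using order_trans[OF _ C[of 0]] by simp
  ultimately show ?thesis by blast
qed

lemma schwartz_integrable: "schwartz f \<Longrightarrow> integrable lborel f"
  using schwartz_le_weight[of f] integrable_weight_bound[of f] schwartz_measurable[of f] by blast

lemma schwartz_bounded:
  assumes "schwartz f" shows "\<exists>C\<ge>0. \<forall>x. norm (f x) \<le> C"
proof -
  obtain C where "C \<ge> 0" "\<And>x. norm (f x) \<le> C * weight x" using schwartz_le_weight[OF assms] by blast
  moreover have "C * weight x \<le> C" for x using \<open>C \<ge> 0\<close> weight_le_1[of x] by (simp add: mult_left_le)
  ultimately show ?thesis by (intro exI[of _ C]) (auto intro: order_trans)
qed


section \<open>Gaussians\<close>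

lemma power_le_exp:
  fixes t :: real assumes "t \<ge> 0"
  shows "t ^ m \<le> real m ^ m * exp t"
proof (cases "m = 0")
  case False
  have "t / m \<le> exp (t / m)" using exp_ge_add_one_self[of "t / m"] by linarith
  then have "(t / m) ^ m \<le> exp (t / m) ^ m" using assms by (intro power_mono) auto
  also have "\<dots> = exp t" using False by (simp add: exp_of_nat_mult[symmetric])
  finally show ?thesis using False by (simp add: power_divide field_simps)
qed (use assms in simp)

text \<open>Completing the square; this lets a Gaussian absorb exponential growth.\<close>

lemma linear_minus_square_le:
  fixes r c A :: real
  assumes "c > 0"
  shows "A * r - c * r\<^sup>2 \<le> A\<^sup>2 / (4 * c)"
proof -
  have "0 \<le> (2 * c * r - A)\<^sup>2 / (4 * c)" using assms by simp
  also have "\<dots> = A\<^sup>2 / (4 * c) - (A * r - c * r\<^sup>2)" using assms by (simp add: field_simps power2_eq_square)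
  finally show ?thesis by simp
qed

text \<open>The polynomial multiples of \<open>G\<close>.  For a Gaussian \<open>G\<close> the derivative of \<open>G\<close> is one of them, so this
class is closed under partial derivatives.\<close>

inductive gaussian_poly :: "('a::euclidean_space \<Rightarrow> complex) \<Rightarrow> ('a \<Rightarrow> complex) \<Rightarrow> bool" for G where
  gaussian: "gaussian_poly G G"
| coordinate: "gaussian_poly G h \<Longrightarrow> gaussian_poly G (\<lambda>x. of_real (x \<bullet> b) * h x)"
| lincomb: "gaussian_poly G g \<Longrightarrow> gaussian_poly G h \<Longrightarrow> gaussian_poly G (\<lambda>x. c * g x + d * h x)"

lemma schwartz_gaussian:
  fixes k :: "'a::euclidean_space"
  assumes c: "c > 0"
  shows "schwartz (\<lambda>x. exp (of_real (- c * (x \<bullet> x)) + \<i> * of_real (k \<bullet> x)))" (is "schwartz ?G")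
proof -
  have dG: "(?G has_derivative (\<lambda>v. of_real (-2 * c) * (of_real (x \<bullet> v) * ?G x) + \<i> * of_real (k \<bullet> v) * ?G x)) (at x)" for x
  proof -
    have q: "((\<lambda>x. of_real (- c * (x \<bullet> x)) + \<i> * of_real (k \<bullet> x)) has_derivative
        (\<lambda>v. of_real (- c * (x \<bullet> v + v \<bullet> x)) + \<i> * of_real (k \<bullet> v))) (at x)"
      by (intro derivative_intros)
    show ?thesis
      using has_derivative_compose[OF q DERIV_exp[unfolded has_field_derivative_def]]
      by (simp add: inner_commute algebra_simps)
  qed
  have rG: "rapidly_decreasing ?G"
    unfolding rapidly_decreasing_def
  proof
    fix m
    have "(1 + norm x) ^ m * norm (?G x) \<le> real m ^ m * exp (1 + 1 / (4 * c))" for x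
    proof -
      have "(1 + norm x) ^ m * norm (?G x) \<le> (real m ^ m * exp (1 + norm x)) * exp (- c * (norm x)\<^sup>2)"
        by (intro mult_mono power_le_exp) (auto simp: norm_exp_eq_Re power2_norm_eq_inner)
      also have "\<dots> = real m ^ m * exp (1 + (1 * norm x - c * (norm x)\<^sup>2))"
        by (simp add: exp_add exp_diff exp_minus field_simps)
      also have "\<dots> \<le> real m ^ m * exp (1 + 1\<^sup>2 / (4 * c))"
        using linear_minus_square_le[OF c, of 1 "norm x"] by (intro mult_left_mono) auto
      finally show ?thesis by simp
    qed
    then show "\<exists>C. \<forall>x. (1 + norm x) ^ m * norm (?G x) \<le> C" by blast
  qed
  have *: "(\<forall>x. h differentiable at x) \<and> rapidly_decreasing h \<and>
      (\<forall>b. gaussian_poly ?G (\<lambda>x. frechet_derivative h (at x) b))" if "gaussian_poly ?G h" for h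
    using that
  proof induction
    case gaussian
    have "frechet_derivative ?G (at x) = (\<lambda>v. of_real (-2 * c) * (of_real (x \<bullet> v) * ?G x) + \<i> * of_real (k \<bullet> v) * ?G x)" for x
      by (rule frechet_derivative_at[OF dG, symmetric])
    moreover have "gaussian_poly ?G (\<lambda>x. of_real (-2 * c) * (of_real (x \<bullet> b) * ?G x) + \<i> * of_real (k \<bullet> b) * ?G x)" for b
      by (intro gaussian_poly.intros)
    ultimately show ?case using rG differentiableI[OF dG] by simp
  next
    case (coordinate h b)
    have d: "((\<lambda>x. of_real (x \<bullet> b) * h x) has_derivative
        (\<lambda>v. of_real (x \<bullet> b) * frechet_derivative h (at x) v + of_real (v \<bullet> b) * h x)) (at x)" for x
      by (rule derivative_eq_intros refl coordinate.IH[THEN conjunct1, rule_format, THEN frechet_derivative_works[THEN iffD1]])+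
    have "frechet_derivative (\<lambda>x. of_real (x \<bullet> b) * h x) (at x) =
        (\<lambda>v. of_real (x \<bullet> b) * frechet_derivative h (at x) v + of_real (v \<bullet> b) * h x)" for x
      by (rule frechet_derivative_at[OF d, symmetric])
    moreover have "gaussian_poly ?G (\<lambda>x. 1 * (of_real (x \<bullet> b) * frechet_derivative h (at x) a) + of_real (a \<bullet> b) * h x)" for a
      by (intro gaussian_poly.intros coordinate)  (use coordinate in auto)
    moreover have "rapidly_decreasing (\<lambda>x. of_real (x \<bullet> b) * h x)"
      using rapidly_decreasing_linear_growth_mult[OF _ norm_of_real_inner_le] coordinate.IH by blast
    ultimately show ?case using differentiableI[OF d] by simp
  next
    case (lincomb g h c' d)
    have dd: "((\<lambda>x. c' * g x + d * h x) has_derivative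
        (\<lambda>v. c' * frechet_derivative g (at x) v + d * frechet_derivative h (at x) v)) (at x)" for x
      by (rule derivative_eq_intros refl lincomb.IH(1)[THEN conjunct1, rule_format, THEN frechet_derivative_works[THEN iffD1]]
         lincomb.IH(2)[THEN conjunct1, rule_format, THEN frechet_derivative_works[THEN iffD1]])+ simp
    have "frechet_derivative (\<lambda>x. c' * g x + d * h x) (at x) =
        (\<lambda>v. c' * frechet_derivative g (at x) v + d * frechet_derivative h (at x) v)" for x
      by (rule frechet_derivative_at[OF dd, symmetric])
    then show ?case using differentiableI[OF dd] lincomb.IH
      by (auto intro: gaussian_poly.intros rapidly_decreasing_lincomb)
  qed
  show ?thesis
    by (rule schwartz_coinduct[where X = "gaussian_poly ?G"]) (use * gaussian_poly.gaussian in auto)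
qed

lemma schwartz_real_gaussian:
  "c > 0 \<Longrightarrow> schwartz (\<lambda>x::'a::euclidean_space. exp (of_real (- c * (x \<bullet> x))))"
  using schwartz_gaussian[of c "0::'a"] by simp

text \<open>This is the characteristic function of the standard normal distribution, rescaled by
\<open>sqrt (2 \<pi> c)\<close>.\<close>

lemma gaussian_integral_1d:
  fixes c p :: real
  assumes c: "c > 0"
  shows "integrable lborel (\<lambda>t::real. exp (of_real (- pi * c * t\<^sup>2) + 2 * pi * \<i> * of_real (t * p)) :: complex)" (is ?I)
    and "(LINT t|lborel. exp (of_real (- pi * c * t\<^sup>2) + 2 * pi * \<i> * of_real (t * p)))
       = complex_of_real (1 / sqrt c * exp (- pi * p\<^sup>2 / c))" (is ?E)
proof -
  let ?g = "\<lambda>t. exp (of_real (- pi * c * t\<^sup>2) + 2 * pi * \<i> * of_real (t * p)) :: complex"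
  \<comment> \<open>integrability is that of a Schwartz function\<close>
  have pc: "pi * c > 0" using c by simp
  have "schwartz (\<lambda>t::real. exp (of_real (- (pi * c) * (t \<bullet> t)) + \<i> * of_real ((2 * pi * p) \<bullet> t)))"
    by (rule schwartz_gaussian[OF pc])
  also have "(\<lambda>t::real. exp (of_real (- (pi * c) * (t \<bullet> t)) + \<i> * of_real ((2 * pi * p) \<bullet> t))) = ?g"
    by (simp add: power2_eq_square mult_ac)
  finally show ?I by (rule schwartz_integrable)
  define s where "s = sqrt (2 * pi * c)"
  have s: "s > 0" "s\<^sup>2 = 2 * pi * c" using c by (auto simp: s_def)
  let ?t = "2 * pi * p / s"
  have "complex_of_real (exp (- (?t\<^sup>2) / 2)) = char std_normal_distribution ?t"
    by (simp add: char_std_normal_distribution)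
  also have "\<dots> = (LINT x|lborel. std_normal_density x *\<^sub>R iexp (?t * x))"
    unfolding char_def by (subst integral_density) (auto simp: normal_density_nonneg)
  also have "\<dots> = \<bar>s\<bar> *\<^sub>R (LINT x|lborel. std_normal_density (0 + s * x) *\<^sub>R iexp (?t * (0 + s * x)))"
    by (rule lborel_integral_real_affine) (use s in simp)
  also have "(\<lambda>x. std_normal_density (0 + s * x) *\<^sub>R iexp (?t * (0 + s * x))) = (\<lambda>x. (1 / sqrt (2 * pi)) *\<^sub>R ?g x)"
  proof
    fix x
    have "(s * x)\<^sup>2 / 2 = pi * c * x\<^sup>2" by (simp add: power_mult_distrib s(2))
    then have "std_normal_density (s * x) = 1 / sqrt (2 * pi) * exp (- pi * c * x\<^sup>2)"
      unfolding std_normal_density_def by (simp add: power_mult_distrib s(2))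
    moreover have "?g x = of_real (exp (- pi * c * x\<^sup>2)) * exp (2 * pi * \<i> * of_real (x * p))"
      by (simp only: exp_add exp_of_real)
    moreover have "iexp (?t * (s * x)) = exp (2 * pi * \<i> * of_real (x * p))"
      using s(1) by (simp add: mult_ac)
    ultimately show "std_normal_density (0 + s * x) *\<^sub>R iexp (?t * (0 + s * x)) = (1 / sqrt (2 * pi)) *\<^sub>R ?g x"
      by (simp add: scaleR_conv_of_real)
  qed
  also have "\<bar>s\<bar> *\<^sub>R (LINT x|lborel. (1 / sqrt (2 * pi)) *\<^sub>R ?g x) = sqrt c *\<^sub>R (LINT x|lborel. ?g x)"
    using c by (simp add: s_def real_sqrt_mult)
  finally have 1: "sqrt c *\<^sub>R (LINT x|lborel. ?g x) = complex_of_real (exp (- (?t\<^sup>2) / 2))" by simp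
  have 2: "?t\<^sup>2 / 2 = pi * p\<^sup>2 / c"
    using c by (simp add: power_divide s(2) power_mult_distrib) (simp add: power2_eq_square)
  have "(LINT x|lborel. ?g x) = (1 / sqrt c) *\<^sub>R (sqrt c *\<^sub>R (LINT x|lborel. ?g x))" using c by simp
  also have "\<dots> = complex_of_real (1 / sqrt c * exp (- pi * p\<^sup>2 / c))"
    unfolding 1 using 2 by (simp add: scaleR_conv_of_real)
  finally show ?E .
qed

lemma gaussian_fourier:
  fixes p :: "'a::euclidean_space"
  assumes c: "c > 0"
  shows "(LINT x|lborel. exp (of_real (- pi * c * (x \<bullet> x)) + 2 * pi * \<i> * of_real (x \<bullet> p)))
       = complex_of_real ((1 / sqrt c) ^ DIM('a) * exp (- pi * (p \<bullet> p) / c))"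
proof -
  let ?g = "\<lambda>b t. exp (of_real (- pi * c * t\<^sup>2) + 2 * pi * \<i> * of_real (t * (p \<bullet> b))) :: complex"
  have e: "exp (of_real (- pi * c * (x \<bullet> x)) + 2 * pi * \<i> * of_real (x \<bullet> p)) = (\<Prod>b\<in>Basis. ?g b (x \<bullet> b))" for x :: 'a
    by (simp add: exp_sum[symmetric] sum.distrib sum_distrib_left euclidean_inner[of x x]
        euclidean_inner[of x p] power2_eq_square sum_negf sum_subtractf)
  have "(LINT x|lborel. exp (of_real (- pi * c * (x \<bullet> x)) + 2 * pi * \<i> * of_real (x \<bullet> p)))
      = (\<Prod>b\<in>Basis. (LINT t|lborel. ?g b t))"
    unfolding e by (rule integrable_lborel_prod) (rule gaussian_integral_1d[OF c])
  also have "\<dots> = complex_of_real (\<Prod>b\<in>Basis. 1 / sqrt c * exp (- pi * (p \<bullet> b)\<^sup>2 / c))"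
    by (simp only: gaussian_integral_1d[OF c] of_real_prod)
  also have "(\<Prod>b\<in>Basis. 1 / sqrt c * exp (- pi * (p \<bullet> b)\<^sup>2 / c))
      = (1 / sqrt c) ^ DIM('a) * exp (\<Sum>b\<in>Basis. - pi * (p \<bullet> b)\<^sup>2 / c)"
    by (subst prod.distrib) (simp add: exp_sum)
  also have "(\<Sum>b\<in>Basis. - pi * (p \<bullet> b)\<^sup>2 / c) = - pi * (p \<bullet> p) / c"
    by (simp add: euclidean_inner[of p p] power2_eq_square sum_distrib_left sum_divide_distrib sum_negf)
  finally show ?thesis .
qed

text \<open>The frequency is the complex vector \<open>p - i q\<close>; translating \<open>x\<close> by \<open>q / c\<close> removes the real
exponential and leaves a real frequency.\<close>

lemma gaussian_fourier_complex:
  fixes p q :: "'a::euclidean_space"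
  assumes c: "c > 0"
  shows "(LINT x|lborel. exp (of_real (- pi * c * (x \<bullet> x) + 2 * pi * (x \<bullet> q)) + 2 * pi * \<i> * of_real (x \<bullet> p)))
       = complex_of_real ((1 / sqrt c) ^ DIM('a)) *
         exp (of_real (- pi / c * (p \<bullet> p - q \<bullet> q)) + 2 * pi * \<i> * of_real ((p \<bullet> q) / c))"
proof -
  let ?f = "\<lambda>x::'a. exp (of_real (- pi * c * (x \<bullet> x) + 2 * pi * (x \<bullet> q)) + 2 * pi * \<i> * of_real (x \<bullet> p))"
  let ?K = "exp (of_real (pi / c * (q \<bullet> q)) + 2 * pi * \<i> * of_real ((p \<bullet> q) / c))"
  have "continuous_on UNIV ?f" by (intro continuous_intros)
  then have [measurable]: "?f \<in> borel_measurable borel" by (rule borel_measurable_continuous_onI)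
  have e: "?f (x + q /\<^sub>R c) = ?K * exp (of_real (- pi * c * (x \<bullet> x)) + 2 * pi * \<i> * of_real (x \<bullet> p))" for x
    unfolding exp_add[symmetric]
    by (rule arg_cong[of _ _ exp], subst complex_eq_iff)
      (use c in \<open>simp add: inner_add_left inner_add_right inner_commute field_simps power2_eq_square\<close>)
  have "(LINT x|lborel. ?f x) = (LINT x|lborel. ?f (x + q /\<^sub>R c))"
    by (rule lborel_integral_translate[symmetric]) measurable
  also have "\<dots> = ?K * complex_of_real ((1 / sqrt c) ^ DIM('a) * exp (- pi * (p \<bullet> p) / c))"
    unfolding e by (simp only: integral_mult_right_zero gaussian_fourier[OF c])
  also have "\<dots> = complex_of_real ((1 / sqrt c) ^ DIM('a)) *
         exp (of_real (- pi / c * (p \<bullet> p - q \<bullet> q)) + 2 * pi * \<i> * of_real ((p \<bullet> q) / c))"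
    by (simp add: exp_of_real[symmetric] exp_add[symmetric] field_simps diff_divide_distrib exp_diff)
  finally show ?thesis .
qed


section \<open>Fourier inversion and partial Fourier transforms\<close>

lemma norm_exp_imaginary: "norm (exp (2 * pi * \<i> * of_real r)) = 1"
  by (simp add: norm_exp_eq_Re)

lemma norm_exp_imaginary': "norm (exp (- 2 * pi * \<i> * of_real r)) = 1"
  by (simp add: norm_exp_eq_Re)

lemma integrable_exp_mult:
  fixes f :: "'a::euclidean_space \<Rightarrow> complex"
  assumes "integrable lborel f"
  shows "integrable lborel (\<lambda>z. exp (2 * pi * \<i> * of_real (S \<bullet> z)) * f z)"
proof (rule Bochner_Integration.integrable_bound[OF assms])
  have [measurable]: "f \<in> borel_measurable borel" using assms by auto
  show "(\<lambda>z. exp (2 * pi * \<i> * of_real (S \<bullet> z)) * f z) \<in> borel_measurable lborel" by measurable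
qed (simp add: norm_mult norm_exp_imaginary)

text \<open>Regularise the outer integral by \<open>exp(-\<pi> s\<^sup>2 |S|\<^sup>2)\<close>.  By Fubini and the transform of the Gaussian
it becomes the mean of \<open>\<phi>\<close> around \<open>x\<close> against a Gaussian of width \<open>s\<close>, which tends to \<open>\<phi> x\<close> as
\<open>s\<close> tends to \<open>0\<close>, while dominated convergence applies to the regularised integral.\<close>

lemma fourier_inversion:
  fixes \<phi> :: "'a::euclidean_space \<Rightarrow> complex"
  assumes int: "integrable lborel \<phi>" and cont: "continuous_on UNIV \<phi>"
    and bdd: "\<And>z. norm (\<phi> z) \<le> B"
    and int': "integrable lborel (\<lambda>S. LINT z|lborel. exp (2 * pi * \<i> * of_real (S \<bullet> z)) * \<phi> z)"
  shows "(LINT S|lborel. exp (- 2 * pi * \<i> * of_real (S \<bullet> x)) *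
            (LINT z|lborel. exp (2 * pi * \<i> * of_real (S \<bullet> z)) * \<phi> z)) = \<phi> x"
proof -
  define \<psi> where "\<psi> S = (LINT z|lborel. exp (2 * pi * \<i> * of_real (S \<bullet> z)) * \<phi> z)" for S
  have \<psi>: "integrable lborel \<psi>" using int' unfolding \<psi>_def .
  have [measurable]: "\<phi> \<in> borel_measurable borel" "\<psi> \<in> borel_measurable borel"
    using int \<psi> by auto
  \<comment> \<open>the widths of the regularising Gaussians\<close>
  define s where "s n = inverse (real (Suc n))" for n
  have s: "s n > 0" "s n \<le> 1" for n by (auto simp: s_def field_simps)
  have s_lim: "s \<longlonglongrightarrow> 0" unfolding s_def by (rule LIMSEQ_inverse_real_of_nat)
  define I where "I n = (LINT S|lborel. exp (of_real (- pi * (s n)\<^sup>2 * (S \<bullet> S)) - 2 * pi * \<i> * of_real (S \<bullet> x)) * \<psi> S)" for n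
  have lim_left: "I \<longlonglongrightarrow> (LINT S|lborel. exp (- 2 * pi * \<i> * of_real (S \<bullet> x)) * \<psi> S)"
    unfolding I_def
  proof (rule integral_dominated_convergence[where w = "\<lambda>S. norm (\<psi> S)"])
    show "AE S in lborel. (\<lambda>n. exp (of_real (- pi * (s n)\<^sup>2 * (S \<bullet> S)) - 2 * pi * \<i> * of_real (S \<bullet> x)) * \<psi> S)
        \<longlonglongrightarrow> exp (- 2 * pi * \<i> * of_real (S \<bullet> x)) * \<psi> S"
    proof (rule AE_I2)
      fix S
      have "(\<lambda>n. exp (of_real (- pi * (s n)\<^sup>2 * (S \<bullet> S)) - 2 * pi * \<i> * of_real (S \<bullet> x)) * \<psi> S)
        \<longlonglongrightarrow> exp (of_real (- pi * 0\<^sup>2 * (S \<bullet> S)) - 2 * pi * \<i> * of_real (S \<bullet> x)) * \<psi> S"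
        by (intro tendsto_intros s_lim)
      then show "(\<lambda>n. exp (of_real (- pi * (s n)\<^sup>2 * (S \<bullet> S)) - 2 * pi * \<i> * of_real (S \<bullet> x)) * \<psi> S)
        \<longlonglongrightarrow> exp (- 2 * pi * \<i> * of_real (S \<bullet> x)) * \<psi> S" by simp
    qed
    show "AE S in lborel. norm (exp (of_real (- pi * (s n)\<^sup>2 * (S \<bullet> S)) - 2 * pi * \<i> * of_real (S \<bullet> x)) * \<psi> S)
        \<le> norm (\<psi> S)" for n
      by (intro AE_I2) (auto simp: norm_mult norm_exp_eq_Re intro!: mult_left_le_one_le)
    show "integrable lborel (\<lambda>S. norm (\<psi> S))" using \<psi> by auto
  qed measurable
  have I_eq: "I n = (LINT y|lborel. \<phi> (x + s n *\<^sub>R y) * of_real (exp (- pi * (y \<bullet> y))))" for n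
  proof -
    let ?c = "(s n)\<^sup>2"
    have c: "?c > 0" "sqrt ?c = s n" using s[of n] by auto
    let ?F = "\<lambda>S z. exp (of_real (- pi * ?c * (S \<bullet> S)) + 2 * pi * \<i> * of_real (S \<bullet> (z - x))) * \<phi> z"
    have g: "integrable lborel (\<lambda>S::'a. exp (- pi * ?c * (S \<bullet> S)))"
    proof -
      have pc: "pi * ?c > 0" using c by simp
      from schwartz_integrable[OF schwartz_gaussian[OF pc, of "0::'a"], THEN integrable_norm]
      show ?thesis by (simp add: norm_exp_eq_Re)
    qed
    have i: "integrable lborel (\<lambda>(S, z). ?F S z)"
    proof (rule integrable_tensor_bound[OF _ g integrable_norm[OF int]])
      have "continuous_on UNIV (\<lambda>p. ?F (fst p) (snd p))"
        by (intro continuous_intros continuous_on_compose2[OF cont]) auto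
      then show "(\<lambda>(S, z). ?F S z) \<in> borel_measurable borel"
        by (simp add: case_prod_unfold borel_measurable_continuous_onI)
      show "norm (?F S z) \<le> exp (- pi * ?c * (S \<bullet> S)) * norm (\<phi> z)" for S z
        by (simp add: norm_mult norm_exp_eq_Re)
    qed
    have "I n = (LINT S|lborel. LINT z|lborel. ?F S z)"
      unfolding I_def \<psi>_def integral_mult_right_zero[symmetric] mult.assoc[symmetric] exp_add[symmetric]
      by (simp add: algebra_simps inner_diff_right)
    also have "\<dots> = (LINT z|lborel. LINT S|lborel. ?F S z)"
      using lborel_fubini[OF i] lborel_fubini_swap[OF i] by simp
    also have "\<dots> = (LINT z|lborel. complex_of_real ((1 / s n) ^ DIM('a) * exp (- pi * ((z - x) \<bullet> (z - x)) / ?c)) * \<phi> z)"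
      unfolding integral_mult_left_zero gaussian_fourier[OF c(1)] c(2) ..
    also have "\<dots> = \<bar>s n\<bar> ^ DIM('a) *\<^sub>R (LINT y|lborel. complex_of_real ((1 / s n) ^ DIM('a) *
        exp (- pi * ((x + s n *\<^sub>R y - x) \<bullet> (x + s n *\<^sub>R y - x)) / ?c)) * \<phi> (x + s n *\<^sub>R y))"
      by (subst lborel_integral_affine[where f = "\<lambda>z. complex_of_real ((1 / s n) ^ DIM('a) * exp (- pi * ((z - x) \<bullet> (z - x)) / ?c)) * \<phi> z"])
         (use s[of n] in auto)
    also have "\<dots> = (LINT y|lborel. \<bar>s n\<bar> ^ DIM('a) *\<^sub>R (complex_of_real ((1 / s n) ^ DIM('a) *
        exp (- pi * ((x + s n *\<^sub>R y - x) \<bullet> (x + s n *\<^sub>R y - x)) / ?c)) * \<phi> (x + s n *\<^sub>R y)))"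
      by (rule integral_scaleR_right[symmetric])
    also have "\<dots> = (LINT y|lborel. \<phi> (x + s n *\<^sub>R y) * of_real (exp (- pi * (y \<bullet> y))))"
    proof (intro Bochner_Integration.integral_cong refl)
      fix y
      have "- pi * ((x + s n *\<^sub>R y - x) \<bullet> (x + s n *\<^sub>R y - x)) / ?c = - pi * (y \<bullet> y)"
        using s[of n] by (simp add: power2_eq_square)
      then show "\<bar>s n\<bar> ^ DIM('a) *\<^sub>R (complex_of_real ((1 / s n) ^ DIM('a) *
        exp (- pi * ((x + s n *\<^sub>R y - x) \<bullet> (x + s n *\<^sub>R y - x)) / ?c)) * \<phi> (x + s n *\<^sub>R y))
        = \<phi> (x + s n *\<^sub>R y) * of_real (exp (- pi * (y \<bullet> y)))"
        using s[of n] by (simp add: scaleR_conv_of_real power_one_over field_simps)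
    qed
    finally show ?thesis .
  qed
  have lim_right: "(\<lambda>n. LINT y|lborel. \<phi> (x + s n *\<^sub>R y) * of_real (exp (- pi * (y \<bullet> y))))
      \<longlonglongrightarrow> (LINT y|lborel. \<phi> x * of_real (exp (- pi * ((y::'a) \<bullet> y))))"
  proof (rule integral_dominated_convergence[where w = "\<lambda>y::'a. B * exp (- pi * (y \<bullet> y))"])
    have "(\<lambda>n. \<phi> (x + s n *\<^sub>R y)) \<longlonglongrightarrow> \<phi> x" for y
    proof -
      have "(\<lambda>n. x + s n *\<^sub>R y) \<longlonglongrightarrow> x + 0 *\<^sub>R y" by (intro tendsto_intros s_lim)
      then have l: "(\<lambda>n. x + s n *\<^sub>R y) \<longlonglongrightarrow> x" by simp
      have "isCont \<phi> x" using cont by (simp add: continuous_on_eq_continuous_at)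
      then show ?thesis using l by (rule isCont_tendsto_compose)
    qed
    then show "AE y in lborel. (\<lambda>n. \<phi> (x + s n *\<^sub>R y) * of_real (exp (- pi * (y \<bullet> y))))
        \<longlonglongrightarrow> \<phi> x * of_real (exp (- pi * (y \<bullet> y)))"
      by (intro AE_I2 tendsto_intros)
    show "AE y in lborel. norm (\<phi> (x + s n *\<^sub>R y) * of_real (exp (- pi * (y \<bullet> y)))) \<le> B * exp (- pi * (y \<bullet> y))" for n
      by (intro AE_I2) (simp add: norm_mult bdd)
    have pp: "(0::real) < pi" by simp
    from schwartz_integrable[OF schwartz_gaussian[OF pp, of "0::'a"], THEN integrable_norm]
    show "integrable lborel (\<lambda>y::'a. B * exp (- pi * (y \<bullet> y)))"
      by (simp add: norm_exp_eq_Re)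
  qed measurable
  have value_right: "(LINT y|lborel. \<phi> x * of_real (exp (- pi * ((y::'a) \<bullet> y)))) = \<phi> x"
    using gaussian_fourier[of 1 "0::'a"] by (simp add: exp_of_real[symmetric])
  have "I \<longlonglongrightarrow> \<phi> x"
    using lim_right unfolding value_right I_eq[symmetric] .
  from LIMSEQ_unique[OF lim_left this] show ?thesis unfolding \<psi>_def .
qed

text \<open>The kernel has the sign of the inverse transform, as in the phases \<open>exp(2\<pi>i S z)\<close> produced by the
smoothed Wigner transform.\<close>

definition partial_fourier :: "('a::euclidean_space \<times> 'b::euclidean_space \<Rightarrow> complex) \<Rightarrow> 'a \<Rightarrow> 'b \<Rightarrow> complex" where
  "partial_fourier M S t = (LINT z|lborel. exp (2 * pi * \<i> * of_real (S \<bullet> z)) * M (z, t))"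

text \<open>Integration by parts in \<open>z\<close>.\<close>

lemma partial_fourier_deriv:
  fixes M :: "'a::euclidean_space \<times> 'b::euclidean_space \<Rightarrow> complex"
  assumes M: "schwartz M"
  shows "partial_fourier (\<lambda>p. frechet_derivative M (at p) (b, 0)) S t
       = - (2 * pi * \<i> * of_real (S \<bullet> b)) * partial_fourier M S t"
proof -
  let ?e = "\<lambda>z. exp (2 * pi * \<i> * of_real (S \<bullet> z))"
  let ?D = "\<lambda>z v. ?e z * frechet_derivative M (at (z, t)) (v, 0) + 2 * pi * \<i> * of_real (S \<bullet> v) * ?e z * M (z, t)"
  have M': "schwartz (\<lambda>p. frechet_derivative M (at p) (b, 0))"
    by (rule schwartz_directional_deriv[OF M])
  note iM = integrable_exp_mult[OF schwartz_integrable[OF schwartz_slice[OF M]], of S t]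
  note iM' = integrable_exp_mult[OF schwartz_integrable[OF schwartz_slice[OF M']], of S t]
  have "(LINT z|lborel. ?D z b) = 0"
  proof (rule integral_directional_derivative_eq_0[where D = ?D and F = "\<lambda>z. ?e z * M (z, t)"])
    fix z
    have q: "((\<lambda>z. 2 * pi * \<i> * of_real (S \<bullet> z)) has_derivative (\<lambda>v. 2 * pi * \<i> * of_real (S \<bullet> v))) (at z)"
      by (intro derivative_intros)
    have e: "(?e has_derivative (\<lambda>v. 2 * pi * \<i> * of_real (S \<bullet> v) * ?e z)) (at z)"
      using has_derivative_compose[OF q DERIV_exp[unfolded has_field_derivative_def]] by (simp add: mult_ac)
    have m: "((\<lambda>z. M (z, t)) has_derivative (\<lambda>v. frechet_derivative M (at (z, t)) (v, 0))) (at z)"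
      by (rule has_derivative_compose[OF _ schwartz_has_derivative[OF M]]) (auto intro!: derivative_eq_intros)
    show "((\<lambda>z. ?e z * M (z, t)) has_derivative ?D z) (at z)"
      by (rule has_derivative_mult[OF e m])
  next
    show "integrable lborel (\<lambda>z. ?e z * M (z, t))" by (rule iM)
    show "integrable lborel (\<lambda>z. ?D z b)"
      unfolding mult.assoc by (intro Bochner_Integration.integrable_add iM'[unfolded mult.assoc] integrable_mult_right iM[unfolded mult.assoc])
    show "continuous_on UNIV (\<lambda>z. ?D z b)"
      by (intro continuous_intros schwartz_continuous[OF schwartz_slice[OF M]] schwartz_continuous[OF schwartz_slice[OF M']])
  qed
  also have "(LINT z|lborel. ?D z b) = (LINT z|lborel. ?e z * frechet_derivative M (at (z, t)) (b, 0))
       + (LINT z|lborel. 2 * pi * \<i> * of_real (S \<bullet> b) * (?e z * M (z, t)))"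
    unfolding mult.assoc by (intro Bochner_Integration.integral_add iM'[unfolded mult.assoc] integrable_mult_right iM[unfolded mult.assoc])
  finally show ?thesis unfolding partial_fourier_def integral_mult_right_zero
    by (simp add: eq_neg_iff_add_eq_0)
qed

text \<open>Passing from \<open>M\<close> to \<open>M - (2\<pi>)\<^sup>-\<^sup>2 \<partial>\<^sub>b\<^sup>2 M\<close> multiplies the transform by \<open>1 + (S \<bullet> b)\<^sup>2\<close>, so
polynomial weights in \<open>S\<close> are absorbed by the Schwartz function.\<close>

lemma partial_fourier_weight:
  fixes M :: "'a::euclidean_space \<times> 'b::euclidean_space \<Rightarrow> complex"
  assumes "schwartz M" and "finite B"
  shows "\<exists>M'. schwartz M' \<and> (\<forall>S t. partial_fourier M' S t = (\<Prod>b\<in>B. of_real (1 + (S \<bullet> b)\<^sup>2)) * partial_fourier M S t)"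
  using assms(2)
proof (induction B)
  case empty then show ?case using assms(1) by auto
next
  case (insert b B)
  then obtain N where N: "schwartz N"
    and eq: "\<And>S t. partial_fourier N S t = (\<Prod>b\<in>B. of_real (1 + (S \<bullet> b)\<^sup>2)) * partial_fourier M S t" by blast
  define D where "D F = (\<lambda>p. frechet_derivative F (at p) (b, 0))" for F :: "'a \<times> 'b \<Rightarrow> complex"
  have D: "schwartz (D F)" if "schwartz F" for F unfolding D_def by (rule schwartz_directional_deriv[OF that])
  \<comment> \<open>two derivatives give the factor \<open>-(2\<pi> S \<bullet> b)\<^sup>2\<close>\<close>
  define a :: complex where "a = - of_real (1 / (2 * pi)\<^sup>2)"
  let ?N = "\<lambda>p. 1 * N p + a * D (D N) p"
  have "partial_fourier ?N S t = (1 + (S \<bullet> b)\<^sup>2) * partial_fourier N S t" for S t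
  proof -
    note i = integrable_exp_mult[OF schwartz_integrable[OF schwartz_slice]]
    have "partial_fourier ?N S t = (LINT z|lborel. exp (2 * pi * \<i> * of_real (S \<bullet> z)) * N (z, t)
        + a * (exp (2 * pi * \<i> * of_real (S \<bullet> z)) * D (D N) (z, t)))"
      unfolding partial_fourier_def by (simp add: algebra_simps)
    also have "\<dots> = partial_fourier N S t + a * partial_fourier (D (D N)) S t"
      unfolding partial_fourier_def integral_mult_right_zero[symmetric]
      by (intro Bochner_Integration.integral_add integrable_mult_right i N D)
    also have "partial_fourier (D (D N)) S t = (2 * pi * \<i> * of_real (S \<bullet> b))\<^sup>2 * partial_fourier N S t"
      using partial_fourier_deriv[OF D[OF N], of b S t] partial_fourier_deriv[OF N, of b S t]
      unfolding D_def[symmetric] by (simp add: power2_eq_square)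
    also have "partial_fourier N S t + a * ((2 * pi * \<i> * of_real (S \<bullet> b))\<^sup>2 * partial_fourier N S t)
        = (1 + (S \<bullet> b)\<^sup>2) * partial_fourier N S t"
      by (simp add: a_def power_mult_distrib field_simps)
    finally show ?thesis .
  qed
  then have "\<forall>S t. partial_fourier ?N S t = (\<Prod>b\<in>insert b B. of_real (1 + (S \<bullet> b)\<^sup>2)) * partial_fourier M S t"
    using insert.hyps by (simp add: eq mult.assoc)
  moreover have "schwartz ?N" by (intro schwartz_lincomb N D)
  ultimately show ?case by blast
qed

text \<open>The decay in \<open>S\<close> comes from absorbing the reciprocal of the weight into \<open>M\<close>, the decay in \<open>t\<close> from
that of the resulting Schwartz function in its second argument.\<close>

lemma partial_fourier_le_weight:
  fixes M :: "'a::euclidean_space \<times> 'b::euclidean_space \<Rightarrow> complex"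
  assumes M: "schwartz M"
  shows "\<exists>C\<ge>0. \<forall>S t. norm (partial_fourier M S t) \<le> C * weight S * weight t"
proof -
  obtain N where N: "schwartz N"
    and eq: "\<And>S t. partial_fourier N S t = (\<Prod>b\<in>Basis. of_real (1 + (S \<bullet> b)\<^sup>2)) * partial_fourier M S t"
    using partial_fourier_weight[OF M finite_Basis] by blast
  obtain C where C: "C \<ge> 0" "\<And>p. norm (N p) \<le> C * weight p" using schwartz_le_weight[OF N] by blast
  let ?K = "C * (LINT z|lborel. weight (z::'a))"
  have "norm (partial_fourier M S t) \<le> ?K * weight S * weight t" for S t
  proof -
    have "norm (partial_fourier N S t)
        \<le> (LINT z|lborel. norm (exp (2 * pi * \<i> * of_real (S \<bullet> z)) * N (z, t)))"
      unfolding partial_fourier_def by (rule integral_norm_bound)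
    also have "\<dots> \<le> (LINT z|lborel. C * weight t * weight (z::'a))"
    proof (rule integral_mono)
      show "integrable lborel (\<lambda>z. norm (exp (2 * pi * \<i> * of_real (S \<bullet> z)) * N (z, t)))"
        by (intro integrable_norm integrable_exp_mult schwartz_integrable schwartz_slice N)
      show "integrable lborel (\<lambda>z::'a. C * weight t * weight z)"
        by (intro integrable_mult_right integrable_weight)
      show "norm (exp (2 * pi * \<i> * of_real (S \<bullet> z)) * N (z, t)) \<le> C * weight t * weight z" for z
        using C(2)[of "(z, t)"] by (simp add: norm_mult norm_exp_imaginary weight_Pair mult_ac)
    qed
    also have "\<dots> = ?K * weight t" by (simp add: mult_ac)
    finally have 1: "norm (partial_fourier N S t) \<le> ?K * weight t" .
    have "inverse (weight S) * norm (partial_fourier M S t) \<le> ?K * weight t"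
      using 1 by (simp only: eq norm_mult norm_prod_eq_inverse_weight)
    then show ?thesis using weight_pos[of S] by (simp add: field_simps)
  qed
  moreover have "?K \<ge> 0" using C(1) weight_pos by (intro mult_nonneg_nonneg integral_nonneg_AE) (auto intro: less_imp_le)
  ultimately show ?thesis by blast
qed

lemma partial_fourier_measurable:
  fixes M :: "'a::euclidean_space \<times> 'b::euclidean_space \<Rightarrow> complex"
  assumes M: "schwartz M"
  shows "(\<lambda>p. partial_fourier M (fst p) (snd p)) \<in> borel_measurable borel"
  unfolding partial_fourier_def
proof (rule borel_measurable_lborel_integral)
  have "continuous_on UNIV (\<lambda>q::('a \<times> 'b) \<times> 'a. exp (2 * pi * \<i> * of_real (fst (fst q) \<bullet> snd q)) * M (snd q, snd (fst q)))"
    by (intro continuous_intros continuous_on_compose2[OF schwartz_continuous[OF M, of UNIV]]) auto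
  then show "(\<lambda>(p::'a \<times> 'b, z). exp (2 * pi * \<i> * of_real (fst p \<bullet> z)) * M (z, snd p)) \<in> borel_measurable borel"
    by (simp add: case_prod_unfold borel_measurable_continuous_onI)
qed

lemma partial_fourier_inversion:
  fixes M :: "'a::euclidean_space \<times> 'b::euclidean_space \<Rightarrow> complex"
  assumes M: "schwartz M"
  shows "(LINT S|lborel. exp (- 2 * pi * \<i> * of_real (S \<bullet> z)) * partial_fourier M S t) = M (z, t)"
proof -
  obtain C where C: "C \<ge> 0" "\<And>S t. norm (partial_fourier M S t) \<le> C * weight S * weight t"
    using partial_fourier_le_weight[OF M] by blast
  obtain B where B: "\<And>p. norm (M p) \<le> B" using schwartz_bounded[OF M] by blast
  have [measurable]: "(\<lambda>S. partial_fourier M S t) \<in> borel_measurable borel"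
    using measurable_compose[OF _ partial_fourier_measurable[OF M], of "\<lambda>S. (S, t)" borel] by simp
  have "integrable lborel (\<lambda>S. partial_fourier M S t)"
    by (rule integrable_weight_bound[where C = "C * weight t"]) (use C in \<open>auto simp: mult_ac\<close>)
  then show ?thesis
    unfolding partial_fourier_def
    by (intro fourier_inversion[where B = B] schwartz_integrable[OF schwartz_slice[OF M]]
        schwartz_continuous[OF schwartz_slice[OF M]] B)
qed

text \<open>Integrating out \<open>q\<close> commutes with all other operations, by the bound on partial transforms.  In the
Fourier transform over \<open>(S, T)\<close> the integral over \<open>S\<close> is then inverted and recovers \<open>M\<close> itself.\<close>

lemma
  fixes M :: "'a::euclidean_space \<times> 'b::euclidean_space \<times> 'c::euclidean_space \<Rightarrow> complex"
  assumes M: "schwartz M"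
  defines "A \<equiv> \<lambda>S T. LINT q|lborel. partial_fourier M S (T, q)"
  shows integrable_partial_fourier_marginal: "integrable lborel (\<lambda>(S, T). A S T)"
    and fourier_partial_fourier_marginal:
      "fourier (\<lambda>(S, T). A S T) (z, k) = (LINT (T, q)|lborel. exp (- 2 * pi * \<i> * of_real (k \<bullet> T)) * M (z, T, q))"
proof -
  obtain C where C: "C \<ge> 0" "\<And>S t. norm (partial_fourier M S t) \<le> C * weight S * weight t"
    using partial_fourier_le_weight[OF M] by blast
  have A_le: "norm (A S T) \<le> C * (LINT q|lborel. weight (q::'c)) * weight S * weight T" for S T
  proof -
    have m: "(\<lambda>q. partial_fourier M S (T, q)) \<in> borel_measurable borel"
      using measurable_compose[OF _ partial_fourier_measurable[OF M], of "\<lambda>q. (S, T, q)" borel] by simp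
    have le: "norm (partial_fourier M S (T, q)) \<le> (C * weight S * weight T) * weight q" for q
      using C(2)[of S "(T, q)"] by (simp add: weight_Pair mult_ac)
    have "norm (A S T) \<le> (LINT q|lborel. norm (partial_fourier M S (T, q)))"
      unfolding A_def by (rule integral_norm_bound)
    also have "\<dots> \<le> (LINT q|lborel. (C * weight S * weight T) * weight (q::'c))"
      by (intro integral_mono le integrable_mult_right integrable_weight integrable_norm
           integrable_weight_bound[OF m le])
    finally have "norm (A S T) \<le> (LINT q|lborel. (C * weight S * weight T) * weight (q::'c))" .
    then show ?thesis by (simp add: mult_ac)
  qed
  have mA: "(\<lambda>p. A (fst p) (snd p)) \<in> borel_measurable borel"
    unfolding A_def
    by (rule borel_measurable_lborel_integral, unfold case_prod_unfold,
        rule measurable_compose[OF _ partial_fourier_measurable[OF M], of "\<lambda>x. (fst (fst x), snd (fst x), snd x)", simplified])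
      (simp add: borel_measurable_continuous_onI continuous_intros)
  have iA: "integrable lborel (\<lambda>p. A (fst p) (snd p))"
    by (rule integrable_weight_bound[OF mA, where C = "C * (LINT q|lborel. weight (q::'c))"])
      (use A_le in \<open>auto simp: weight_Pair[of "fst p" "snd p" for p, simplified] mult_ac\<close>)
  then show "integrable lborel (\<lambda>(S, T). A S T)" by (simp add: case_prod_unfold)
  let ?e = "\<lambda>r. exp (- 2 * pi * \<i> * of_real r)"
  let ?J = "\<lambda>S T q. ?e (z \<bullet> S) * ?e (k \<bullet> T) * partial_fourier M S (T, q)"
  have "fourier (\<lambda>(S, T). A S T) (z, k) = (LINT (S, T)|lborel. LINT q|lborel. ?J S T q)"
    unfolding fourier_def A_def
    by (simp add: case_prod_unfold exp_add[symmetric] algebra_simps inner_prod_def)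
  also have "\<dots> = (LINT (T, q)|lborel. LINT S|lborel. ?J S T q)"
  proof (rule lborel_fubini3[where f = "\<lambda>S. C * weight S" and h = weight])
    have e: "(\<lambda>p :: 'a \<times> 'b \<times> 'c. ?e (z \<bullet> fst p) * ?e (k \<bullet> fst (snd p))) \<in> borel_measurable borel"
      by (intro borel_measurable_continuous_onI continuous_intros)
    from borel_measurable_times[OF e partial_fourier_measurable[OF M]]
    show "(\<lambda>(S, t). ?J S (fst t) (snd t)) \<in> borel_measurable borel"
      by (simp add: case_prod_unfold)
    show "norm (?J S T q) \<le> C * weight S * weight (T, q)" for S T q
      using C(2)[of S "(T, q)"] by (simp add: norm_mult norm_exp_imaginary')
    show "integrable lborel (\<lambda>q::'c. weight (T, q))" for T :: 'b
      unfolding weight_Pair by (intro integrable_mult_right integrable_weight)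
  qed (intro integrable_mult_right integrable_weight)+
  also have "\<dots> = (LINT (T, q)|lborel. ?e (k \<bullet> T) * M (z, T, q))"
  proof (intro Bochner_Integration.integral_cong refl)
    fix t :: "'b \<times> 'c"
    obtain T q where t: "t = (T, q)" by fastforce
    have "(LINT S|lborel. ?J S T q) = ?e (k \<bullet> T) * (LINT S|lborel. ?e (S \<bullet> z) * partial_fourier M S (T, q))"
      unfolding integral_mult_right_zero[symmetric] by (simp add: mult_ac inner_commute)
    then have "(LINT S|lborel. ?J S T q) = ?e (k \<bullet> T) * M (z, T, q)"
      by (simp only: partial_fourier_inversion[OF M])
    then show "(case t of (T, q) \<Rightarrow> LINT S|lborel. ?J S T q) = (case t of (T, q) \<Rightarrow> ?e (k \<bullet> T) * M (z, T, q))"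
      by (simp only: t prod.case)
  qed
  finally show "fourier (\<lambda>(S, T). A S T) (z, k) = (LINT (T, q)|lborel. ?e (k \<bullet> T) * M (z, T, q))" .
qed


section \<open>Entire functions of several variables\<close>

lemma cdot_add_left: "(a + b) \<bullet>\<^sub>c c = a \<bullet>\<^sub>c c + b \<bullet>\<^sub>c c"
  and cdot_add_right: "c \<bullet>\<^sub>c (a + b) = c \<bullet>\<^sub>c a + c \<bullet>\<^sub>c b"
  and cdot_diff_left: "(a - b) \<bullet>\<^sub>c c = a \<bullet>\<^sub>c c - b \<bullet>\<^sub>c c"
  and cdot_diff_right: "c \<bullet>\<^sub>c (a - b) = c \<bullet>\<^sub>c a - c \<bullet>\<^sub>c b"
  and cdot_scale_left: "(r *s a) \<bullet>\<^sub>c c = r * (a \<bullet>\<^sub>c c)"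
  and cdot_scale_right: "c \<bullet>\<^sub>c (r *s a) = r * (c \<bullet>\<^sub>c a)"
  by (simp_all add: cdot_def sum.distrib sum_subtractf sum_distrib_left algebra_simps)

lemma cdot_cvec: "cvec x \<bullet>\<^sub>c cvec y = of_real (x \<bullet> y)"
  by (simp add: cdot_def cvec_def inner_vec_def)

lemma cvec_add: "cvec (x + y) = cvec x + cvec y"
  and cvec_diff: "cvec (x - y) = cvec x - cvec y"
  and cvec_scaleR: "cvec (r *\<^sub>R x) = of_real r *s cvec x"
  by (simp_all add: cvec_def vec_eq_iff)

lemmas cdot_simps = cdot_add_left cdot_add_right cdot_diff_left cdot_diff_right
  cdot_scale_left cdot_scale_right cdot_cvec cvec_add cvec_diff cvec_scaleR

definition vec_Re :: "complex^'n \<Rightarrow> real^'n" where "vec_Re a = (\<chi> i. Re (a $ i))"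

definition vec_Im :: "complex^'n \<Rightarrow> real^'n" where "vec_Im a = (\<chi> i. Im (a $ i))"

lemma cvec_Re_Im: "a = cvec (vec_Re a) + \<i> *s cvec (vec_Im a)"
  by (simp add: vec_eq_iff cvec_def vec_Re_def vec_Im_def complex_eq_iff)

lemma entire_line_holomorphic:
  fixes F :: "(complex^'n) \<times> (complex^'n) \<Rightarrow> complex"
  assumes "entire F"
  shows "(\<lambda>t. F (a + t *s v, b + t *s w)) holomorphic_on UNIV"
proof (rule holomorphic_onI)
  fix t
  have lin: "((\<lambda>t. t *s u) has_derivative (\<lambda>\<tau>. \<tau> *s u)) (at t)" for u :: "complex^'n"
  proof -
    have "linear (\<lambda>t. t *s u)"
      by (rule linearI) (simp_all add: vec_eq_iff algebra_simps)
    then show ?thesis by (simp add: linear_conv_bounded_linear bounded_linear_imp_has_derivative)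
  qed
  obtain D where D: "(F has_derivative D) (at (a + t *s v, b + t *s w))"
    and hom: "\<And>c v w. D (c *s v, c *s w) = c * D (v, w)"
    using assms unfolding entire_def by blast
  have "((\<lambda>t. (a + t *s v, b + t *s w)) has_derivative (\<lambda>\<tau>. (0 + \<tau> *s v, 0 + \<tau> *s w))) (at t)"
    by (intro has_derivative_Pair has_derivative_add has_derivative_const lin)
  from has_derivative_compose[OF this D]
  have "((\<lambda>t. F (a + t *s v, b + t *s w)) has_field_derivative D (v, w)) (at t)"
    by (simp add: hom has_field_derivative_def mult.commute[of _ "D (v, w)"])
  then show "(\<lambda>t. F (a + t *s v, b + t *s w)) field_differentiable at t within UNIV"
    by (auto simp: field_differentiable_def)
qed

text \<open>The complex point \<open>x + i y\<close> lies on the complex line \<open>t \<mapsto> x + t y\<close>, along which \<open>F\<close> and \<open>G\<close> are entire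
functions of one variable that agree for real \<open>t\<close>.\<close>

lemma entire_eqI:
  fixes F G :: "(complex^'n) \<times> (complex^'n) \<Rightarrow> complex"
  assumes F: "entire F" and G: "entire G"
    and eq: "\<And>x k. F (cvec x, cvec k) = G (cvec x, cvec k)"
  shows "F = G"
proof
  fix z :: "(complex^'n) \<times> (complex^'n)"
  obtain a b where z: "z = (a, b)" by fastforce
  let ?h = "\<lambda>H t. H (cvec (vec_Re a) + t *s cvec (vec_Im a), cvec (vec_Re b) + t *s cvec (vec_Im b)) :: complex"
  have "?h F t - ?h G t = 0" for t
  proof (rule analytic_continuation[where f = "\<lambda>t. ?h F t - ?h G t" and S = UNIV and U = "range complex_of_real" and \<xi> = 0])
    show "(\<lambda>t. ?h F t - ?h G t) holomorphic_on UNIV"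
      by (intro holomorphic_intros entire_line_holomorphic F G)
    have "0 islimpt (range complex_of_real)"
      unfolding islimpt_approachable
    proof (intro allI impI)
      fix e :: real assume "e > 0"
      then show "\<exists>x'\<in>range complex_of_real. x' \<noteq> 0 \<and> dist x' 0 < e"
        by (intro bexI[of _ "complex_of_real (e / 2)"] rangeI) auto
    qed
    then show "0 islimpt (range complex_of_real)" .
    show "?h F r - ?h G r = 0" if r: "r \<in> range complex_of_real" for r
    proof -
      from r obtain s where s: "r = of_real s" by blast
      have "cvec (vec_Re c) + r *s cvec (vec_Im c) = cvec (vec_Re c + s *\<^sub>R vec_Im c)" for c :: "complex^'n"
        by (simp add: s vec_eq_iff cvec_def)
      then show ?thesis using eq by simp
    qed
  qed auto
  from this[of \<i>] show "F z = G z" by (simp add: cvec_Re_Im[symmetric] z)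
qed

lemma entire_extension_eqI:
  assumes "entire F" "\<And>x k. F (cvec x, cvec k) = w (x, k)"
  shows "entire_extension w = F"
  unfolding entire_extension_def
proof (rule the_equality)
  show "entire F \<and> (\<forall>x k. F (cvec x, cvec k) = w (x, k))" using assms by simp
  show "G = F" if "entire G \<and> (\<forall>x k. G (cvec x, cvec k) = w (x, k))" for G
    using that assms by (intro entire_eqI) auto
qed

lemma integrable_exp_norm_mult_gaussian:
  fixes V :: "'p::euclidean_space \<Rightarrow> complex"
  assumes V: "V \<in> borel_measurable borel" "\<And>p. norm (V p) \<le> C * exp (- c * (p \<bullet> p))" and c: "c > 0"
  shows "integrable lborel (\<lambda>p. exp (A * norm p) * norm (V p))"
proof -
  note [measurable] = V(1)
  have c2: "c / 2 > 0" using c by simp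
  have i: "integrable lborel (\<lambda>p::'p. C * exp (A\<^sup>2 / (2 * c)) * exp (- (c / 2) * (p \<bullet> p)))"
    using schwartz_integrable[OF schwartz_gaussian[OF c2, of "0::'p"], THEN integrable_norm]
    by (intro integrable_mult_right) (simp add: norm_exp_eq_Re)
  show ?thesis
  proof (rule Bochner_Integration.integrable_bound[OF i])
    show "AE p in lborel. norm (exp (A * norm p) * norm (V p))
        \<le> norm (C * exp (A\<^sup>2 / (2 * c)) * exp (- (c / 2) * (p \<bullet> p)))"
    proof (rule AE_I2)
      fix p :: 'p
      have "norm (V 0) \<le> C" using V(2)[of 0] by simp
      then have C: "C \<ge> 0" using norm_ge_zero order_trans by blast
      have "exp (A * norm p) * norm (V p) \<le> exp (A * norm p) * (C * exp (- c * (p \<bullet> p)))"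
        by (intro mult_left_mono V) auto
      also have "\<dots> = C * exp (A * norm p - (c / 2) * (norm p)\<^sup>2 + - (c / 2) * (p \<bullet> p))"
        by (simp add: exp_add[symmetric] power2_norm_eq_inner)
      also have "\<dots> \<le> C * exp (A\<^sup>2 / (2 * c) + - (c / 2) * (p \<bullet> p))"
        using linear_minus_square_le[OF c2, of A "norm p"] C by (intro mult_left_mono) auto
      also have "\<dots> = C * exp (A\<^sup>2 / (2 * c)) * exp (- (c / 2) * (p \<bullet> p))"
        by (simp only: exp_add mult.assoc)
      finally show "norm (exp (A * norm p) * norm (V p))
        \<le> norm (C * exp (A\<^sup>2 / (2 * c)) * exp (- (c / 2) * (p \<bullet> p)))" using C by simp
    qed
  qed measurable
qed

text \<open>Differentiation under the integral sign: the error \<open>|exp w - 1 - w| \<le> exp |w| |w|\<^sup>2\<close> at \<open>w = l \<eta> p\<close> is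
quadratic in \<open>\<eta>\<close>, and its exponential growth in \<open>p\<close> is absorbed by the Gaussian decay of \<open>V\<close>.\<close>

lemma has_derivative_exp_integral:
  fixes l :: "'z::euclidean_space \<Rightarrow> 'p::euclidean_space \<Rightarrow> complex"
  assumes l: "bounded_bilinear l"
    and V: "V \<in> borel_measurable borel" "\<And>p. norm (V p) \<le> C * exp (- c * (p \<bullet> p))" and c: "c > 0"
  shows "((\<lambda>\<zeta>. LINT p|lborel. exp (l \<zeta> p) * V p) has_derivative
          (\<lambda>\<eta>. LINT p|lborel. l \<eta> p * (exp (l \<zeta> p) * V p))) (at \<zeta>)"
proof -
  interpret l: bounded_bilinear l by fact
  obtain K where K: "K > 0" "\<And>a b. norm (l a b) \<le> norm a * norm b * K"
    using l.pos_bounded by blast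
  have [measurable]: "l \<eta> \<in> borel_measurable borel" for \<eta>
    by (intro borel_measurable_continuous_onI linear_continuous_on l.bounded_linear_right)
  note [measurable] = V(1)
  note maj = integrable_exp_norm_mult_gaussian[OF V c]
  have Re_le: "Re (l \<eta> p) \<le> K * norm \<eta> * norm p" for \<eta> p
  proof -
    have "Re (l \<eta> p) \<le> norm (l \<eta> p)" by (rule complex_Re_le_cmod)
    also have "\<dots> \<le> K * norm \<eta> * norm p" using K(2)[of \<eta> p] by (simp add: mult_ac)
    finally show ?thesis .
  qed
  have exp_le: "norm (exp (l \<eta> p)) \<le> exp (K * norm \<eta> * norm p)" for \<eta> p
    using Re_le[of \<eta> p] by (simp add: norm_exp_eq_Re)
  have id_le: "t \<le> exp t" for t :: real using exp_ge_add_one_self[of t] by linarith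
  have int: "integrable lborel (\<lambda>p. exp (l \<eta> p) * V p)" for \<eta>
  proof (rule Bochner_Integration.integrable_bound[OF maj[of "K * norm \<eta>"]])
    show "AE p in lborel. norm (exp (l \<eta> p) * V p) \<le> norm (exp (K * norm \<eta> * norm p) * norm (V p))"
      by (intro AE_I2) (simp add: norm_mult mult_right_mono Re_le)
  qed measurable
  have int': "integrable lborel (\<lambda>p. l \<eta> p * (exp (l \<zeta> p) * V p))" for \<eta>
  proof (rule Bochner_Integration.integrable_bound)
    show "integrable lborel (\<lambda>p. norm \<eta> * K * (exp ((1 + K * norm \<zeta>) * norm p) * norm (V p)))"
      by (intro integrable_mult_right maj)
    show "AE p in lborel. norm (l \<eta> p * (exp (l \<zeta> p) * V p))
      \<le> norm (norm \<eta> * K * (exp ((1 + K * norm \<zeta>) * norm p) * norm (V p)))"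
    proof (rule AE_I2)
      fix p
      have "norm (l \<eta> p) \<le> norm \<eta> * K * norm p" using K(2)[of \<eta> p] by (simp add: mult_ac)
      also have "\<dots> \<le> norm \<eta> * K * exp (norm p)" using K(1) id_le by (intro mult_left_mono) auto
      finally have "norm (l \<eta> p) * (norm (exp (l \<zeta> p)) * norm (V p))
         \<le> (norm \<eta> * K * exp (norm p)) * (exp (K * norm \<zeta> * norm p) * norm (V p))"
        using exp_le K(1) by (intro mult_mono) auto
      also have "\<dots> = norm \<eta> * K * (exp ((1 + K * norm \<zeta>) * norm p) * norm (V p))"
        by (simp add: distrib_right exp_add)
      finally show "norm (l \<eta> p * (exp (l \<zeta> p) * V p))
        \<le> norm (norm \<eta> * K * (exp ((1 + K * norm \<zeta>) * norm p) * norm (V p)))"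
        using K(1) by (simp add: norm_mult)
    qed
  qed measurable
  let ?D = "\<lambda>\<eta>. LINT p|lborel. l \<eta> p * (exp (l \<zeta> p) * V p)"
  have "linear ?D"
  proof (rule linearI)
    show "?D (a + b) = ?D a + ?D b" for a b
      by (simp add: l.add_left distrib_right int' Bochner_Integration.integral_add)
    show "?D (r *\<^sub>R a) = r *\<^sub>R ?D a" for r a
      by (simp add: l.scaleR_left int')
  qed
  then have bl: "bounded_linear ?D" by (simp add: linear_conv_bounded_linear)
  define M where "M = K\<^sup>2 * (LINT p|lborel. exp ((K * norm \<zeta> + K + 2) * norm p) * norm (V p))"
  show ?thesis
  proof (rule has_derivativeI_sandwich[where e = 1 and H = "\<lambda>y. M * norm (y - \<zeta>)", OF _ bl])
    fix y assume y: "y \<noteq> \<zeta>" "dist y \<zeta> < 1"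
    define \<eta> where "\<eta> = y - \<zeta>"
    have \<eta>: "norm \<eta> \<le> 1" "\<eta> \<noteq> 0" using y by (auto simp: \<eta>_def dist_norm)
    let ?R = "\<lambda>p. exp (l y p) * V p - exp (l \<zeta> p) * V p - l \<eta> p * (exp (l \<zeta> p) * V p)"
    have R_le: "norm (?R p) \<le> (norm \<eta>)\<^sup>2 * K\<^sup>2 * (exp ((K * norm \<zeta> + K + 2) * norm p) * norm (V p))" for p
    proof -
      let ?w = "l \<eta> p"
      have w: "norm ?w \<le> K * norm \<eta> * norm p" using K(2)[of \<eta> p] by (simp add: mult_ac)
      have w1: "norm ?w \<le> K * norm p"
      proof -
        have "K * norm \<eta> * norm p \<le> K * 1 * norm p" using \<eta>(1) K(1) by (intro mult_mono) auto
        with w show ?thesis by simp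
      qed
      have "?R p = exp (l \<zeta> p) * (exp ?w - (1 + ?w)) * V p"
        by (simp add: \<eta>_def l.diff_left exp_diff algebra_simps)
      then have "norm (?R p) = norm (exp (l \<zeta> p)) * norm (exp ?w - (1 + ?w)) * norm (V p)"
        by (simp add: norm_mult)
      also have "norm (exp ?w - (1 + ?w)) \<le> exp \<bar>Re ?w\<bar> * (norm ?w)\<^sup>2"
        using Taylor_exp[of ?w 1] by (simp add: power2_eq_square)
      also have "\<dots> \<le> exp (K * norm p) * (K * norm \<eta> * norm p)\<^sup>2"
        using w w1 abs_Re_le_cmod[of ?w] by (intro mult_mono power_mono) auto
      also have "(K * norm \<eta> * norm p)\<^sup>2 = (norm \<eta>)\<^sup>2 * K\<^sup>2 * (norm p)\<^sup>2" by (simp add: power_mult_distrib)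
      also have "(norm p)\<^sup>2 \<le> (exp (norm p))\<^sup>2" by (intro power_mono id_le) auto
      finally have "norm (?R p) \<le> norm (exp (l \<zeta> p)) * (exp (K * norm p) * ((norm \<eta>)\<^sup>2 * K\<^sup>2 * (exp (norm p))\<^sup>2)) * norm (V p)"
        by (simp add: mult_left_mono mult_right_mono)
      also have "\<dots> \<le> exp (K * norm \<zeta> * norm p) * (exp (K * norm p) * ((norm \<eta>)\<^sup>2 * K\<^sup>2 * (exp (norm p))\<^sup>2)) * norm (V p)"
        by (intro mult_right_mono exp_le) auto
      also have "\<dots> = (norm \<eta>)\<^sup>2 * K\<^sup>2 * (exp ((K * norm \<zeta> + K + 2) * norm p) * norm (V p))"
      proof -
        have "exp ((K * norm \<zeta> + K + 2) * norm p) = exp (K * norm \<zeta> * norm p) * exp (K * norm p) * (exp (norm p))\<^sup>2"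
          by (simp only: distrib_right exp_add exp_double)
        then show ?thesis by (simp only: mult_ac)
      qed
      finally show ?thesis .
    qed
    have "(LINT p|lborel. exp (l y p) * V p) - (LINT p|lborel. exp (l \<zeta> p) * V p) - ?D \<eta> = (LINT p|lborel. ?R p)"
      by (simp add: int int')
    also have "norm \<dots> \<le> (LINT p|lborel. norm (?R p))" by (rule integral_norm_bound)
    also have "\<dots> \<le> (LINT p|lborel. (norm \<eta>)\<^sup>2 * K\<^sup>2 * (exp ((K * norm \<zeta> + K + 2) * norm p) * norm (V p)))"
      by (intro integral_mono R_le integrable_norm integrable_mult_right maj Bochner_Integration.integrable_diff int int')
    also have "\<dots> = M * norm \<eta> * norm \<eta>" by (simp add: M_def power2_eq_square mult_ac)
    finally show "norm ((LINT p|lborel. exp (l y p) * V p) - (LINT p|lborel. exp (l \<zeta> p) * V p) - ?D (y - \<zeta>)) / norm (y - \<zeta>)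
        \<le> M * norm (y - \<zeta>)"
      using \<eta>(2) unfolding \<eta>_def by (simp add: divide_le_eq)
  next
    have "((\<lambda>y. M * norm (y - \<zeta>)) \<longlongrightarrow> M * norm (\<zeta> - \<zeta>)) (at \<zeta>)"
      by (intro tendsto_intros)
    then show "((\<lambda>y. M * norm (y - \<zeta>)) \<longlongrightarrow> 0) (at \<zeta>)" by simp
  qed auto
qed

text \<open>The exponent of the Fourier integral, as a real bilinear map of the complex point and the
integration variable.\<close>

lemma cdot_bounded_bilinear:
  "bounded_bilinear (\<lambda>(a::complex^'n, b::complex^'n) (X, K). 2 * pi * \<i> * (cvec X \<bullet>\<^sub>c a + cvec K \<bullet>\<^sub>c b))"
proof -
  have cd: "norm (cvec X \<bullet>\<^sub>c a) \<le> real CARD('n) * (norm X * norm a)" for X :: "real^'n" and a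
  proof -
    have "norm (cvec X \<bullet>\<^sub>c a) \<le> (\<Sum>i\<in>UNIV. norm (cvec X $ i * a $ i))"
      unfolding cdot_def by (rule norm_sum)
    also have "\<dots> \<le> (\<Sum>i\<in>(UNIV::'n set). norm X * norm a)"
      by (intro sum_mono) (auto simp: norm_mult cvec_def component_le_norm_cart Finite_Cartesian_Product.norm_nth_le intro!: mult_mono)
    finally show ?thesis by simp
  qed
  let ?l = "\<lambda>(a::complex^'n, b::complex^'n) (X, K). 2 * pi * \<i> * (cvec X \<bullet>\<^sub>c a + cvec K \<bullet>\<^sub>c b)"
  show ?thesis
  proof
    show "?l (x + x') y = ?l x y + ?l x' y" for x x' y
      by (cases x; cases x'; cases y) (simp add: cdot_def sum.distrib algebra_simps)
    show "?l x (y + y') = ?l x y + ?l x y'" for x y y'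
      by (cases x; cases y; cases y') (simp add: cdot_def cvec_def sum.distrib algebra_simps)
    show "?l (r *\<^sub>R x) y = r *\<^sub>R ?l x y" for r x y
      by (cases x; cases y) (simp add: cdot_def scaleR_conv_of_real[where 'a=complex] sum_distrib_left distrib_left mult_ac)
    show "?l x (r *\<^sub>R y) = r *\<^sub>R ?l x y" for r x y
      by (cases x; cases y) (simp add: cdot_def cvec_def scaleR_conv_of_real[where 'a=complex] sum_distrib_left distrib_left mult_ac)
    show "\<exists>B. \<forall>x y. norm (?l x y) \<le> norm x * norm y * B"
    proof (intro exI allI)
      fix x :: "(complex^'n) \<times> (complex^'n)" and y :: "(real^'n) \<times> (real^'n)"
      obtain a b X K where xy: "x = (a, b)" "y = (X, K)" by fastforce
      have n: "norm a \<le> norm x" "norm b \<le> norm x" "norm X \<le> norm y" "norm K \<le> norm y"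
        unfolding xy using norm_fst_le[of a b] norm_snd_le[of b a] norm_fst_le[of X K] norm_snd_le[of K X] by simp_all
      have "norm (?l x y) = 2 * pi * norm (cvec X \<bullet>\<^sub>c a + cvec K \<bullet>\<^sub>c b)"
        by (simp add: xy norm_mult)
      also have "\<dots> \<le> 2 * pi * (real CARD('n) * (norm y * norm x) + real CARD('n) * (norm y * norm x))"
        by (intro mult_left_mono norm_triangle_mono order_trans[OF cd] mult_mono n) auto
      finally show "norm (?l x y) \<le> norm x * norm y * (4 * pi * real CARD('n))" by (simp add: algebra_simps)
    qed
  qed
qed

text \<open>The derivative is complex homogeneous because the exponent is.\<close>

lemma entire_exp_integral:
  fixes V :: "(real^'n) \<times> (real^'n) \<Rightarrow> complex"
  assumes V: "V \<in> borel_measurable borel" "\<And>p. norm (V p) \<le> C * exp (- c * (p \<bullet> p))" and c: "c > 0"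
  shows "entire (\<lambda>(a, b). LINT (X, K)|lborel. exp (2 * pi * \<i> * (cvec X \<bullet>\<^sub>c a + cvec K \<bullet>\<^sub>c b)) * V (X, K))"
proof -
  let ?l = "\<lambda>(a::complex^'n, b::complex^'n) (X, K). 2 * pi * \<i> * (cvec X \<bullet>\<^sub>c a + cvec K \<bullet>\<^sub>c b)"
  have eq: "(\<lambda>(a, b). LINT (X, K)|lborel. exp (2 * pi * \<i> * (cvec X \<bullet>\<^sub>c a + cvec K \<bullet>\<^sub>c b)) * V (X, K))
      = (\<lambda>\<zeta>. LINT p|lborel. exp (?l \<zeta> p) * V p)"
    by (auto simp: fun_eq_iff case_prod_unfold)
  show ?thesis
    unfolding entire_def eq
  proof (intro allI exI conjI)
    fix \<zeta>
    show "((\<lambda>\<zeta>. LINT p|lborel. exp (?l \<zeta> p) * V p) has_derivative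
        (\<lambda>\<eta>. LINT p|lborel. ?l \<eta> p * (exp (?l \<zeta> p) * V p))) (at \<zeta>)"
      by (rule has_derivative_exp_integral[OF cdot_bounded_bilinear V c])
    fix r v w
    have "?l (r *s v, r *s w) p = r * ?l (v, w) p" for p
      by (cases p) (simp add: cdot_def sum_distrib_left algebra_simps)
    then show "(LINT p|lborel. ?l (r *s v, r *s w) p * (exp (?l \<zeta> p) * V p))
        = r * (LINT p|lborel. ?l (v, w) p * (exp (?l \<zeta> p) * V p))"
      by (simp add: mult.assoc)
  qed
qed


section \<open>The smoothed Wigner transform at complex arguments\<close>

lemma continuous_on_cvec [continuous_intros]:
  "continuous_on S f \<Longrightarrow> continuous_on S (\<lambda>x. cvec (f x))"
  unfolding cvec_def by (intro continuous_intros)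

lemma continuous_on_cdot [continuous_intros]:
  "continuous_on S f \<Longrightarrow> continuous_on S g \<Longrightarrow> continuous_on S (\<lambda>x. f x \<bullet>\<^sub>c g x)"
  unfolding cdot_def by (intro continuous_intros)

text \<open>The substitution \<open>(u, y) \<mapsto> (u + y/2, u - y/2)\<close> is invertible.\<close>

lemma schwartz_wigner_product:
  fixes f g :: "'a::euclidean_space \<Rightarrow> complex"
  assumes f: "schwartz f" and g: "schwartz g"
  shows "schwartz (\<lambda>(u, y). f (u + y /\<^sub>R 2) * cnj (g (u - y /\<^sub>R 2)))"
proof -
  let ?l = "\<lambda>(p :: 'a \<times> 'a). (fst p + snd p /\<^sub>R 2, fst p - snd p /\<^sub>R 2)"
  have "schwartz (\<lambda>v. (\<lambda>(r, s). f r * cnj (g s)) (?l v + 0))"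
  proof (rule schwartz_compose_affine[where K = 3])
    show "schwartz (\<lambda>(r, s). f r * cnj (g s))" by (intro schwartz_tensor f schwartz_cnj g)
    show "bounded_linear ?l"
      by (intro bounded_linear_Pair bounded_linear_add bounded_linear_sub bounded_linear_fst
          bounded_linear_compose[OF bounded_linear_scaleR_right bounded_linear_snd])
    \<comment> \<open>invert the substitution: \<open>u = (r + s)/2\<close> and \<open>y = r - s\<close>\<close>
    fix v :: "'a \<times> 'a"
    obtain u y where v: "v = (u, y)" by fastforce
    define r s where "r = u + y /\<^sub>R 2" and "s = u - y /\<^sub>R 2"
    have uy: "u = (r + s) /\<^sub>R 2" "y = r - s" by (simp_all add: r_def s_def scaleR_left.add[symmetric] algebra_simps)
    have "norm v \<le> norm u + norm y" unfolding v by (rule norm_Pair_le)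
    also have "\<dots> \<le> (norm r + norm s) / 2 + (norm r + norm s)"
      unfolding uy using norm_triangle_ineq[of r s] norm_triangle_ineq4[of r s]
      by (intro add_mono) simp_all
    also have "\<dots> = 3 / 2 * norm r + 3 / 2 * norm s" by (simp add: field_simps)
    also have "\<dots> \<le> 3 / 2 * norm (r, s) + 3 / 2 * norm (r, s)"
      by (intro add_mono mult_left_mono norm_fst_le norm_snd_le) auto
    also have "\<dots> = 3 * norm (r, s)" by simp
    finally show "norm v \<le> 3 * norm (?l v)" by (simp add: v r_def s_def)
  qed
  then show ?thesis by (simp add: case_prod_unfold)
qed

lemma schwartz_wigner_product_swapped:
  fixes f g :: "'a::euclidean_space \<Rightarrow> complex"
  assumes f: "schwartz f" and g: "schwartz g"
  shows "schwartz (\<lambda>(K, u). f (u - K /\<^sub>R 2) * cnj (g (u + K /\<^sub>R 2)))"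
proof -
  let ?l = "\<lambda>p :: 'a \<times> 'a. (snd p, - fst p)"
  have "schwartz (\<lambda>p. (\<lambda>(u, y). f (u + y /\<^sub>R 2) * cnj (g (u - y /\<^sub>R 2))) (?l p + 0))"
  proof (rule schwartz_compose_affine[OF schwartz_wigner_product[OF f g], where K = 1])
    show "bounded_linear ?l" by (intro bounded_linear_Pair bounded_linear_snd bounded_linear_minus bounded_linear_fst)
    show "norm p \<le> 1 * norm (?l p)" for p :: "'a \<times> 'a"
      by (cases p) (simp add: norm_Pair add.commute)
  qed
  then show ?thesis by (simp add: case_prod_unfold)
qed

text \<open>The bilinear dot product keeps the integrand holomorphic in \<open>(a, b)\<close>; this is the integral that turns out
to be the entire extension of the smoothed Wigner transform.\<close>

definition swt_complex ::
    "real \<Rightarrow> real \<Rightarrow> (real^'n \<Rightarrow> complex) \<Rightarrow> (real^'n \<Rightarrow> complex) \<Rightarrow>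
     (complex^'n) \<times> (complex^'n) \<Rightarrow> complex" where
  "swt_complex \<sigma>\<^sub>x \<sigma>\<^sub>k f g = (\<lambda>(a, b).
     (sqrt 2 / \<sigma>\<^sub>x) ^ CARD('n) *
     (LINT (u, y)|lborel.
        exp (- 2 * pi * \<i> * (b \<bullet>\<^sub>c cvec y) - pi * \<sigma>\<^sub>k\<^sup>2 * (y \<bullet> y) / 2
             - 2 * pi * ((cvec u - a) \<bullet>\<^sub>c (cvec u - a)) / \<sigma>\<^sub>x\<^sup>2)
        * f (u + y /\<^sub>R 2) * cnj (g (u - y /\<^sub>R 2))))"

lemma swt_complex_cvec: "swt_complex \<sigma>\<^sub>x \<sigma>\<^sub>k f g (cvec x, cvec k) = swt \<sigma>\<^sub>x \<sigma>\<^sub>k f g (x, k)"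
  unfolding swt_complex_def swt_def by (simp add: cdot_cvec cvec_diff[symmetric])

text \<open>The imaginary part of \<open>a\<close> contributes a constant factor to the modulus of the exponential, and the
growth \<open>exp(2\<pi> Im b \<bullet> y)\<close> is absorbed by the Gaussian in \<open>y\<close>; so the exponential is bounded.\<close>

lemma swt_complex_integrable:
  fixes f g :: "real^'n \<Rightarrow> complex" and a b :: "complex^'n" and \<sigma>\<^sub>x \<sigma>\<^sub>k :: real
  assumes f: "schwartz f" and g: "schwartz g" and \<sigma>: "\<sigma>\<^sub>x > 0" "\<sigma>\<^sub>k > 0"
  shows "integrable lborel (\<lambda>(u, y).
        exp (- 2 * pi * \<i> * (b \<bullet>\<^sub>c cvec y) - pi * \<sigma>\<^sub>k\<^sup>2 * (y \<bullet> y) / 2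
             - 2 * pi * ((cvec u - a) \<bullet>\<^sub>c (cvec u - a)) / \<sigma>\<^sub>x\<^sup>2)
        * f (u + y /\<^sub>R 2) * cnj (g (u - y /\<^sub>R 2)))"
proof -
  define p q r s where "p = vec_Re a" and "q = vec_Im a" and "r = vec_Re b" and "s = vec_Im b"
  have a: "a = cvec p + \<i> *s cvec q" and b: "b = cvec r + \<i> *s cvec s"
    unfolding p_def q_def r_def s_def by (rule cvec_Re_Im)+
  let ?e = "\<lambda>u y. exp (- 2 * pi * \<i> * (b \<bullet>\<^sub>c cvec y) - pi * \<sigma>\<^sub>k\<^sup>2 * (y \<bullet> y) / 2
             - 2 * pi * ((cvec u - a) \<bullet>\<^sub>c (cvec u - a)) / \<sigma>\<^sub>x\<^sup>2)"
  define A c where "A = 2 * pi * norm s" and "c = pi * \<sigma>\<^sub>k\<^sup>2 / 2"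
  have c: "c > 0" using \<sigma> by (simp add: c_def)
  define B where "B = exp (A\<^sup>2 / (4 * c) + 2 * pi * (q \<bullet> q) / \<sigma>\<^sub>x\<^sup>2)"
  have e_le: "norm (?e u y) \<le> B" for u y
  proof -
    have "norm (?e u y) = exp (2 * pi * (s \<bullet> y) - c * (norm y)\<^sup>2
        - 2 * pi * ((u - p) \<bullet> (u - p)) / \<sigma>\<^sub>x\<^sup>2 + 2 * pi * (q \<bullet> q) / \<sigma>\<^sub>x\<^sup>2)"
      unfolding norm_exp_eq_Re
      apply (rule arg_cong[of _ _ exp])
      unfolding a b cdot_simps c_def power2_norm_eq_inner
      using \<sigma> by (simp add: inner_diff_left inner_diff_right field_simps)
    also have "\<dots> \<le> B"
    proof -
      have "s \<bullet> y \<le> norm s * norm y" by (rule norm_cauchy_schwarz)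
      then have "2 * pi * (s \<bullet> y) \<le> A * norm y" by (simp add: A_def)
      moreover have "0 \<le> 2 * pi * ((u - p) \<bullet> (u - p)) / \<sigma>\<^sub>x\<^sup>2" by simp
      ultimately show ?thesis
        using linear_minus_square_le[OF c, of A "norm y"] unfolding B_def exp_le_cancel_iff by linarith
    qed
    finally show ?thesis .
  qed
  have N: "integrable lborel (\<lambda>(u, y). f (u + y /\<^sub>R 2) * cnj (g (u - y /\<^sub>R 2)))"
    by (rule schwartz_integrable[OF schwartz_wigner_product[OF f g]])
  show ?thesis
  proof (rule Bochner_Integration.integrable_bound)
    show "integrable lborel (\<lambda>p. B * norm (case p of (u, y) \<Rightarrow> f (u + y /\<^sub>R 2) * cnj (g (u - y /\<^sub>R 2))))"
      by (intro integrable_mult_right integrable_norm N)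
    show "(\<lambda>(u, y). ?e u y * f (u + y /\<^sub>R 2) * cnj (g (u - y /\<^sub>R 2))) \<in> borel_measurable lborel"
      unfolding case_prod_unfold measurable_lborel2
      by (intro borel_measurable_continuous_onI continuous_intros \<sigma>
          continuous_on_compose2[OF schwartz_continuous[OF f, of UNIV]]
          continuous_on_compose2[OF schwartz_continuous[OF g, of UNIV]]) (use \<sigma> in auto)
    show "AE p in lborel. norm (case p of (u, y) \<Rightarrow> ?e u y * f (u + y /\<^sub>R 2) * cnj (g (u - y /\<^sub>R 2)))
      \<le> norm (B * norm (case p of (u, y) \<Rightarrow> f (u + y /\<^sub>R 2) * cnj (g (u - y /\<^sub>R 2))))"
    proof (rule AE_I2)
      fix p :: "(real^'n) \<times> (real^'n)"
      obtain u y where p: "p = (u, y)" by fastforce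
      have "norm (?e u y) * (norm (f (u + y /\<^sub>R 2)) * norm (g (u - y /\<^sub>R 2)))
          \<le> B * (norm (f (u + y /\<^sub>R 2)) * norm (g (u - y /\<^sub>R 2)))"
        by (intro mult_right_mono e_le) auto
      moreover have "B > 0" by (simp add: B_def)
      ultimately show "norm (case p of (u, y) \<Rightarrow> ?e u y * f (u + y /\<^sub>R 2) * cnj (g (u - y /\<^sub>R 2)))
        \<le> norm (B * norm (case p of (u, y) \<Rightarrow> f (u + y /\<^sub>R 2) * cnj (g (u - y /\<^sub>R 2))))"
        by (simp only: p prod.case norm_mult complex_mod_cnj real_norm_def abs_norm_cancel abs_of_pos mult.assoc)
    qed
  qed
qed


section \<open>The Fourier transform and the entire extension of the smoothed Wigner transform\<close>

text \<open>The integrand of the smoothed Wigner transform without its phase.  The sign of \<open>y\<close> is reversed, so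
that the phase becomes the kernel of the partial Fourier transform.\<close>

definition wigner_density ::
    "real \<Rightarrow> real \<Rightarrow> (real^'n \<Rightarrow> complex) \<Rightarrow> (real^'n \<Rightarrow> complex) \<Rightarrow>
     (real^'n) \<times> (real^'n) \<times> (real^'n) \<Rightarrow> complex" where
  "wigner_density \<sigma>\<^sub>x \<sigma>\<^sub>k f g = (\<lambda>(y, x, u).
     of_real ((sqrt 2 / \<sigma>\<^sub>x) ^ CARD('n)) *
     (exp (of_real (- (pi * \<sigma>\<^sub>k\<^sup>2 / 2) * (y \<bullet> y))) * exp (of_real (- (2 * pi / \<sigma>\<^sub>x\<^sup>2) * ((u - x) \<bullet> (u - x))))
      * f (u - y /\<^sub>R 2) * cnj (g (u + y /\<^sub>R 2))))"

text \<open>Decay in \<open>y\<close> comes from the first Gaussian, decay in \<open>u\<close> then from \<open>f\<close>, and decay in \<open>x\<close> from the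
Gaussian in \<open>u - x\<close>.\<close>

lemma schwartz_wigner_density:
  fixes f g :: "real^'n \<Rightarrow> complex" and \<sigma>\<^sub>x \<sigma>\<^sub>k :: real
  assumes f: "schwartz f" and g: "schwartz g" and \<sigma>: "\<sigma>\<^sub>x > 0" "\<sigma>\<^sub>k > 0"
  shows "schwartz (wigner_density \<sigma>\<^sub>x \<sigma>\<^sub>k f g)"
proof -
  let ?y = "\<lambda>v::(real^'n) \<times> (real^'n) \<times> (real^'n). fst v"
  let ?x = "\<lambda>v::(real^'n) \<times> (real^'n) \<times> (real^'n). fst (snd v)"
  let ?u = "\<lambda>v::(real^'n) \<times> (real^'n) \<times> (real^'n). snd (snd v)"
  have bl: "bounded_linear ?y" "bounded_linear ?x" "bounded_linear ?u" "bounded_linear (\<lambda>v. ?y v /\<^sub>R 2)"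
    by (intro bounded_linear_intros)+
  have "schwartz (\<lambda>v. exp (of_real (- (pi * \<sigma>\<^sub>k\<^sup>2 / 2) * ((?y v + 0) \<bullet> (?y v + 0))))
      * exp (of_real (- (2 * pi / \<sigma>\<^sub>x\<^sup>2) * (((?u v - ?x v) + 0) \<bullet> ((?u v - ?x v) + 0))))
      * f ((?u v - ?y v /\<^sub>R 2) + 0) * cnj (g ((?u v + ?y v /\<^sub>R 2) + 0)))"
  proof (rule schwartz_prod4[where K = 5 and ?F3.0 = f and ?F4.0 = "\<lambda>x. cnj (g x)"
        and ?F1.0 = "\<lambda>x. exp (of_real (- (pi * \<sigma>\<^sub>k\<^sup>2 / 2) * (x \<bullet> x)))"
        and ?F2.0 = "\<lambda>x. exp (of_real (- (2 * pi / \<sigma>\<^sub>x\<^sup>2) * (x \<bullet> x)))"])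
    show "schwartz (\<lambda>x::real^'n. exp (of_real (- (pi * \<sigma>\<^sub>k\<^sup>2 / 2) * (x \<bullet> x))))"
      "schwartz (\<lambda>x::real^'n. exp (of_real (- (2 * pi / \<sigma>\<^sub>x\<^sup>2) * (x \<bullet> x))))"
      using \<sigma> by (intro schwartz_real_gaussian; simp)+
    show "schwartz f" "schwartz (\<lambda>x. cnj (g x))" by (intro f schwartz_cnj g)+
    show "bounded_linear ?y" "bounded_linear (\<lambda>v. ?u v - ?x v)" "bounded_linear (\<lambda>v. ?u v - ?y v /\<^sub>R 2)"
      "bounded_linear (\<lambda>v. ?u v + ?y v /\<^sub>R 2)"
      by (intro bl bounded_linear_add bounded_linear_sub)+
    fix v :: "(real^'n) \<times> (real^'n) \<times> (real^'n)"
    obtain y x u where v: "v = (y, x, u)" by (cases v)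
    have "norm v \<le> norm y + norm (x, u)" unfolding v by (rule norm_Pair_le)
    also have "norm (x, u) \<le> norm x + norm u" by (rule norm_Pair_le)
    finally have n: "norm v \<le> norm y + (norm x + norm u)" by simp
    have "u = (u - y /\<^sub>R 2) + y /\<^sub>R 2" by simp
    then have nu: "2 * norm u \<le> 2 * norm (u - y /\<^sub>R 2) + norm y"
      using norm_triangle_ineq[of "u - y /\<^sub>R 2" "y /\<^sub>R 2"] by simp
    have "x = u - (u - x)" by simp
    then have nx: "norm x \<le> norm u + norm (u - x)" by (metis norm_triangle_ineq4)
    show "norm v \<le> 5 * (norm (?y v) + norm (?u v - ?x v) + norm (?u v - ?y v /\<^sub>R 2) + norm (?u v + ?y v /\<^sub>R 2))"
    proof -
      have "N \<le> 5 * (b + d + e + h)"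
        if "N \<le> b + (c + a)" "2 * a \<le> 2 * e + b" "c \<le> a + d" "0 \<le> b" "0 \<le> d" "0 \<le> e" "0 \<le> h"
        for N a b c d e h :: real
        using that unfolding distrib_left by linarith
      from this[OF n nu nx] show ?thesis by (simp add: v)
    qed
  qed
  then show ?thesis
    unfolding wigner_density_def case_prod_unfold by (intro schwartz_cmult) simp
qed

text \<open>In this form the integrability of the smoothed Wigner transform and its Fourier transform in \<open>k\<close> are
instances of the general facts on marginals of partial Fourier transforms.\<close>

lemma swt_eq_marginal:
  fixes f g :: "real^'n \<Rightarrow> complex" and \<sigma>\<^sub>x \<sigma>\<^sub>k :: real
  assumes f: "schwartz f" and g: "schwartz g" and \<sigma>: "\<sigma>\<^sub>x > 0" "\<sigma>\<^sub>k > 0"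
  shows "swt \<sigma>\<^sub>x \<sigma>\<^sub>k f g (x, k) = (LINT u|lborel. partial_fourier (wigner_density \<sigma>\<^sub>x \<sigma>\<^sub>k f g) k (x, u))"
proof -
  let ?C = "complex_of_real ((sqrt 2 / \<sigma>\<^sub>x) ^ CARD('n))"
  let ?h = "\<lambda>u y. exp (- 2 * pi * \<i> * (cvec k \<bullet>\<^sub>c cvec y) - pi * \<sigma>\<^sub>k\<^sup>2 * (y \<bullet> y) / 2
             - 2 * pi * ((cvec u - cvec x) \<bullet>\<^sub>c (cvec u - cvec x)) / \<sigma>\<^sub>x\<^sup>2)
        * f (u + y /\<^sub>R 2) * cnj (g (u - y /\<^sub>R 2))"
  have "swt \<sigma>\<^sub>x \<sigma>\<^sub>k f g (x, k) = ?C * (LINT (u, y)|lborel. ?h u y)"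
    unfolding swt_complex_cvec[symmetric] swt_complex_def prod.case by simp
  also have "\<dots> = ?C * (LINT u|lborel. LINT y|lborel. ?h u y)"
    by (subst lborel_fubini[OF swt_complex_integrable[OF f g \<sigma>]]) (rule refl)
  also have "\<dots> = (LINT u|lborel. partial_fourier (wigner_density \<sigma>\<^sub>x \<sigma>\<^sub>k f g) k (x, u))"
    unfolding integral_mult_right_zero[symmetric]
  proof (intro Bochner_Integration.integral_cong refl)
    fix u
    have c: "continuous_on UNIV (?h u)"
      by (intro continuous_intros continuous_on_compose2[OF schwartz_continuous[OF f, of UNIV]]
          continuous_on_compose2[OF schwartz_continuous[OF g, of UNIV]]) (use \<sigma> in auto)
    have "(LINT y|lborel. ?C * ?h u y) = (LINT y|lborel. ?C * ?h u (- y))"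
      by (rule lborel_integral_uminus[symmetric], intro borel_measurable_times borel_measurable_const borel_measurable_continuous_onI c)
    also have "\<dots> = partial_fourier (wigner_density \<sigma>\<^sub>x \<sigma>\<^sub>k f g) k (x, u)"
      unfolding partial_fourier_def wigner_density_def
    proof (intro Bochner_Integration.integral_cong refl)
      fix y
      have "exp (- 2 * pi * \<i> * (cvec k \<bullet>\<^sub>c cvec (- y)) - pi * \<sigma>\<^sub>k\<^sup>2 * (- y \<bullet> - y) / 2
             - 2 * pi * ((cvec u - cvec x) \<bullet>\<^sub>c (cvec u - cvec x)) / \<sigma>\<^sub>x\<^sup>2)
         = exp (2 * pi * \<i> * of_real (k \<bullet> y)) * (exp (of_real (- (pi * \<sigma>\<^sub>k\<^sup>2 / 2) * (y \<bullet> y)))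
            * exp (of_real (- (2 * pi / \<sigma>\<^sub>x\<^sup>2) * ((u - x) \<bullet> (u - x)))))"
        unfolding exp_add[symmetric] cvec_diff[symmetric] cdot_cvec by (simp add: field_simps)
      then show "?C * ?h u (- y) = exp (2 * pi * \<i> * of_real (k \<bullet> y)) * (case (y, x, u) of (y, x, u) \<Rightarrow>
         ?C * (exp (of_real (- (pi * \<sigma>\<^sub>k\<^sup>2 / 2) * (y \<bullet> y))) * exp (of_real (- (2 * pi / \<sigma>\<^sub>x\<^sup>2) * ((u - x) \<bullet> (u - x))))
         * f (u - y /\<^sub>R 2) * cnj (g (u + y /\<^sub>R 2))))"
        by simp
    qed
    finally show "(LINT y|lborel. ?C * ?h u y) = partial_fourier (wigner_density \<sigma>\<^sub>x \<sigma>\<^sub>k f g) k (x, u)" .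
  qed
  finally show ?thesis .
qed

text \<open>Inversion in \<open>k\<close> sets \<open>y = -K\<close> in the defining integral, and the integral over \<open>x\<close> is the transform of
a Gaussian centred at \<open>u\<close>.  The result is the Wigner transform on the Fourier side, times the
Gaussian multiplier that describes the smoothing.\<close>

lemma fourier_swt:
  fixes f g :: "real^'n \<Rightarrow> complex" and \<sigma>\<^sub>x \<sigma>\<^sub>k :: real
  assumes f: "schwartz f" and g: "schwartz g" and \<sigma>: "\<sigma>\<^sub>x > 0" "\<sigma>\<^sub>k > 0"
  shows "fourier (swt \<sigma>\<^sub>x \<sigma>\<^sub>k f g) (X, K) =
     exp (of_real (- (pi / 2) * (\<sigma>\<^sub>x\<^sup>2 * (X \<bullet> X) + \<sigma>\<^sub>k\<^sup>2 * (K \<bullet> K)))) *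
     (LINT u|lborel. exp (- 2 * pi * \<i> * of_real (X \<bullet> u)) * (f (u - K /\<^sub>R 2) * cnj (g (u + K /\<^sub>R 2))))"
proof -
  define M where "M = wigner_density \<sigma>\<^sub>x \<sigma>\<^sub>k f g"
  have M: "schwartz M" unfolding M_def by (rule schwartz_wigner_density[OF f g \<sigma>])
  define A where "A k x = (LINT u|lborel. partial_fourier M k (x, u))" for k x
  let ?e = "\<lambda>r. exp (- 2 * pi * \<i> * of_real r)"
  have iA: "integrable lborel (\<lambda>(k, x). A k x)"
    unfolding A_def by (rule integrable_partial_fourier_marginal[OF M])
  have mA: "(\<lambda>(x, k). A k x) \<in> borel_measurable borel"
    using lborel_integrable_swap[OF iA] by auto
  have e: "(\<lambda>p :: (real^'n) \<times> (real^'n). ?e ((X, K) \<bullet> p)) \<in> borel_measurable borel"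
    by (intro borel_measurable_continuous_onI continuous_intros)
  have "fourier (swt \<sigma>\<^sub>x \<sigma>\<^sub>k f g) (X, K) = (LINT (x, k)|lborel. ?e ((X, K) \<bullet> (x, k)) * A k x)"
    unfolding fourier_def A_def M_def swt_eq_marginal[OF f g \<sigma>, symmetric]
    by (simp add: case_prod_unfold inner_prod_def)
  also have "\<dots> = (LINT (k, x)|lborel. ?e ((X, K) \<bullet> (x, k)) * A k x)"
    by (rule lborel_integral_swap)
      (use borel_measurable_times[OF e mA] in \<open>simp add: case_prod_unfold inner_prod_def\<close>)
  also have "\<dots> = fourier (\<lambda>(k, x). A k x) (K, X)"
    unfolding fourier_def by (simp add: case_prod_unfold inner_prod_def add.commute)
  also have "\<dots> = (LINT (x, u)|lborel. ?e (X \<bullet> x) * M (K, x, u))"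
    unfolding A_def by (rule fourier_partial_fourier_marginal[OF M])
  also have "\<dots> = (LINT u|lborel. LINT x|lborel. ?e (X \<bullet> x) * M (K, x, u))"
  proof (rule lborel_fubini_swap)
    show "integrable lborel (\<lambda>(x, u). ?e (X \<bullet> x) * M (K, x, u))"
      using integrable_exp_mult[OF schwartz_integrable[OF schwartz_slice_snd[OF M, of K]], of "(- X, 0)"]
      by (simp add: case_prod_unfold inner_prod_def)
  qed
  also have "\<dots> = (LINT u|lborel. exp (of_real (- (pi / 2) * (\<sigma>\<^sub>x\<^sup>2 * (X \<bullet> X) + \<sigma>\<^sub>k\<^sup>2 * (K \<bullet> K)))) *
      (?e (X \<bullet> u) * (f (u - K /\<^sub>R 2) * cnj (g (u + K /\<^sub>R 2)))))"
  proof (intro Bochner_Integration.integral_cong refl)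
    fix u
    let ?C = "complex_of_real ((sqrt 2 / \<sigma>\<^sub>x) ^ CARD('n))"
    let ?h = "\<lambda>x. ?e (X \<bullet> x) * exp (of_real (- (2 * pi / \<sigma>\<^sub>x\<^sup>2) * ((u - x) \<bullet> (u - x))))"
    let ?R = "exp (of_real (- (pi * \<sigma>\<^sub>k\<^sup>2 / 2) * (K \<bullet> K))) * (f (u - K /\<^sub>R 2) * cnj (g (u + K /\<^sub>R 2)))"
    have c: "2 / \<sigma>\<^sub>x\<^sup>2 > 0" using \<sigma> by simp
    have "(LINT x|lborel. ?h x) = (LINT x|lborel. ?h (x + u))"
      by (rule lborel_integral_translate[symmetric], intro borel_measurable_continuous_onI continuous_intros)
    also have "\<dots> = (LINT x|lborel. ?e (X \<bullet> u) *
        exp (of_real (- pi * (2 / \<sigma>\<^sub>x\<^sup>2) * (x \<bullet> x)) + 2 * pi * \<i> * of_real (x \<bullet> (- X))))"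
      unfolding exp_add[symmetric]
      by (intro Bochner_Integration.integral_cong refl arg_cong[of _ _ exp])
        (simp add: inner_commute algebra_simps)
    also have "\<dots> = ?e (X \<bullet> u) * complex_of_real ((1 / sqrt (2 / \<sigma>\<^sub>x\<^sup>2)) ^ CARD('n)
        * exp (- pi * (X \<bullet> X) / (2 / \<sigma>\<^sub>x\<^sup>2)))"
      by (simp only: integral_mult_right_zero gaussian_fourier[OF c]) simp
    finally have h: "(LINT x|lborel. ?h x) = \<dots>" .
    have "(sqrt 2 / \<sigma>\<^sub>x) ^ CARD('n) * (1 / sqrt (2 / \<sigma>\<^sub>x\<^sup>2)) ^ CARD('n) = 1"
      unfolding power_mult_distrib[symmetric] using \<sigma> by (simp add: real_sqrt_divide)
    then have C: "?C * complex_of_real ((1 / sqrt (2 / \<sigma>\<^sub>x\<^sup>2)) ^ CARD('n)) = 1"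
      unfolding of_real_mult[symmetric] by simp
    have "(LINT x|lborel. ?e (X \<bullet> x) * M (K, x, u)) = (LINT x|lborel. (?C * ?R) * ?h x)"
      by (simp add: M_def wigner_density_def mult_ac)
    also have "\<dots> = (?C * ?R) * (LINT x|lborel. ?h x)" by (rule integral_mult_right_zero)
    also have "\<dots> = (?C * complex_of_real ((1 / sqrt (2 / \<sigma>\<^sub>x\<^sup>2)) ^ CARD('n))) *
        (exp (of_real (- pi * (X \<bullet> X) / (2 / \<sigma>\<^sub>x\<^sup>2))) * exp (of_real (- (pi * \<sigma>\<^sub>k\<^sup>2 / 2) * (K \<bullet> K)))) *
         (?e (X \<bullet> u) * (f (u - K /\<^sub>R 2) * cnj (g (u + K /\<^sub>R 2))))"
      unfolding h by (simp only: of_real_mult exp_of_real[symmetric] mult_ac)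
    also have "exp (of_real (- pi * (X \<bullet> X) / (2 / \<sigma>\<^sub>x\<^sup>2))) * exp (of_real (- (pi * \<sigma>\<^sub>k\<^sup>2 / 2) * (K \<bullet> K)))
        = (exp (of_real (- (pi / 2) * (\<sigma>\<^sub>x\<^sup>2 * (X \<bullet> X) + \<sigma>\<^sub>k\<^sup>2 * (K \<bullet> K)))) :: complex)"
      unfolding exp_add[symmetric] of_real_add[symmetric]
      by (rule arg_cong[of _ _ "\<lambda>r. exp (of_real r)"]) (simp add: field_simps)
    finally show "(LINT x|lborel. ?e (X \<bullet> x) * M (K, x, u)) =
        exp (of_real (- (pi / 2) * (\<sigma>\<^sub>x\<^sup>2 * (X \<bullet> X) + \<sigma>\<^sub>k\<^sup>2 * (K \<bullet> K)))) *
        (?e (X \<bullet> u) * (f (u - K /\<^sub>R 2) * cnj (g (u + K /\<^sub>R 2))))"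
      unfolding C by simp
  qed
  finally show ?thesis by (simp only: integral_mult_right_zero)
qed

text \<open>The integral over \<open>X\<close> in the inversion formula at a complex point \<open>a\<close>; it reproduces the Gaussian in
\<open>u - a\<close> of the smoothed Wigner transform.\<close>

lemma gaussian_fourier_cdot:
  fixes a :: "complex^'n" and u :: "real^'n"
  assumes s: "s > 0"
  shows "(LINT X|lborel. exp (2 * pi * \<i> * (cvec X \<bullet>\<^sub>c a) - 2 * pi * \<i> * (X \<bullet> u) - pi / 2 * s\<^sup>2 * (X \<bullet> X)))
     = of_real ((sqrt 2 / s) ^ CARD('n)) * exp (- 2 * pi * ((cvec u - a) \<bullet>\<^sub>c (cvec u - a)) / s\<^sup>2)"
proof -
  define p q where "p = vec_Re a - u" and "q = - vec_Im a"
  have a: "a = cvec (p + u) - \<i> *s cvec q"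
    using cvec_Re_Im[of a] by (simp add: p_def q_def vec_eq_iff cvec_def)
  have c: "s\<^sup>2 / 2 > 0" using s by simp
  have sq: "1 / sqrt (s\<^sup>2 / 2) = sqrt 2 / s" using s by (simp add: real_sqrt_divide)
  have "(LINT X|lborel. exp (2 * pi * \<i> * (cvec X \<bullet>\<^sub>c a) - 2 * pi * \<i> * (X \<bullet> u) - pi / 2 * s\<^sup>2 * (X \<bullet> X)))
     = (LINT x|lborel. exp (of_real (- pi * (s\<^sup>2 / 2) * (x \<bullet> x) + 2 * pi * (x \<bullet> q)) + 2 * pi * \<i> * of_real (x \<bullet> p)))"
    unfolding a cdot_simps
    by (intro Bochner_Integration.integral_cong refl arg_cong[of _ _ exp])
      (simp add: inner_add_right algebra_simps)
  also have "\<dots> = complex_of_real ((1 / sqrt (s\<^sup>2 / 2)) ^ DIM(real^'n)) *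
         exp (of_real (- pi / (s\<^sup>2 / 2) * (p \<bullet> p - q \<bullet> q)) + 2 * pi * \<i> * of_real ((p \<bullet> q) / (s\<^sup>2 / 2)))"
    by (rule gaussian_fourier_complex[OF c])
  also have "of_real (- pi / (s\<^sup>2 / 2) * (p \<bullet> p - q \<bullet> q)) + 2 * pi * \<i> * of_real ((p \<bullet> q) / (s\<^sup>2 / 2))
      = - 2 * pi * ((cvec u - a) \<bullet>\<^sub>c (cvec u - a)) / s\<^sup>2"
    unfolding a cdot_simps using s
    by (simp add: inner_add_right inner_add_left inner_commute field_simps)
  finally show ?thesis unfolding sq by simp
qed

text \<open>After inserting the formula for the Fourier transform, the integral over \<open>X\<close> can be carried out
first, since its Gaussian dominates the growth caused by the imaginary part of \<open>a\<close>.  What remains is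
the integral over \<open>u\<close> and \<open>K = -y\<close> in the definition.\<close>

lemma swt_complex_eq_fourier_integral:
  fixes f g :: "real^'n \<Rightarrow> complex" and \<sigma>\<^sub>x \<sigma>\<^sub>k :: real
  assumes f: "schwartz f" and g: "schwartz g" and \<sigma>: "\<sigma>\<^sub>x > 0" "\<sigma>\<^sub>k > 0"
  shows "swt_complex \<sigma>\<^sub>x \<sigma>\<^sub>k f g (a, b) =
    (LINT (X, K)|lborel. exp (2 * pi * \<i> * (cvec X \<bullet>\<^sub>c a + cvec K \<bullet>\<^sub>c b)) * fourier (swt \<sigma>\<^sub>x \<sigma>\<^sub>k f g) (X, K))"
proof -
  let ?N = "\<lambda>K u. f (u - K /\<^sub>R 2) * cnj (g (u + K /\<^sub>R 2))"
  let ?eX = "\<lambda>X u. exp (2 * pi * \<i> * (cvec X \<bullet>\<^sub>c a) - 2 * pi * \<i> * (X \<bullet> u) - pi / 2 * \<sigma>\<^sub>x\<^sup>2 * (X \<bullet> X))"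
  let ?eK = "\<lambda>K. exp (2 * pi * \<i> * (cvec K \<bullet>\<^sub>c b) - pi * \<sigma>\<^sub>k\<^sup>2 * (K \<bullet> K) / 2)"
  let ?J = "\<lambda>X K u. ?eX X u * (?eK K * ?N K u)"
  let ?C = "complex_of_real ((sqrt 2 / \<sigma>\<^sub>x) ^ CARD('n))"
  let ?G = "\<lambda>u. exp (- 2 * pi * ((cvec u - a) \<bullet>\<^sub>c (cvec u - a)) / \<sigma>\<^sub>x\<^sup>2)"
  have N: "schwartz (\<lambda>(K, u). ?N K u)" by (rule schwartz_wigner_product_swapped[OF f g])
  have cx: "pi / 2 * \<sigma>\<^sub>x\<^sup>2 > 0" and ck: "pi / 2 * \<sigma>\<^sub>k\<^sup>2 > 0" using \<sigma> by auto
  define A where "A = 2 * pi * norm (vec_Im a)"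
  define B where "B = 2 * pi * norm (vec_Im b)"
  have Im_le: "Re (2 * pi * \<i> * (cvec X \<bullet>\<^sub>c c)) \<le> 2 * pi * norm (vec_Im c) * norm X" for X and c :: "complex^'n"
  proof -
    have "Re (2 * pi * \<i> * (cvec X \<bullet>\<^sub>c c)) = 2 * pi * (X \<bullet> (- vec_Im c))"
      by (subst cvec_Re_Im[of c], unfold cdot_simps) simp
    also have "\<dots> \<le> 2 * pi * (norm X * norm (- vec_Im c))"
      by (intro mult_left_mono norm_cauchy_schwarz) auto
    also have "\<dots> = 2 * pi * norm (vec_Im c) * norm X" by simp
    finally show ?thesis .
  qed
  define F where "F X = exp (A * norm X) * norm (exp (of_real (- (pi / 2 * \<sigma>\<^sub>x\<^sup>2) * (X \<bullet> X))) :: complex)" for X :: "real^'n"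
  have F: "integrable lborel F"
    unfolding F_def
  proof (rule integrable_exp_norm_mult_gaussian[where C = 1, OF _ _ cx])
    show "(\<lambda>X :: real^'n. exp (complex_of_real (- (pi / 2 * \<sigma>\<^sub>x\<^sup>2) * (X \<bullet> X)))) \<in> borel_measurable borel"
      by (intro borel_measurable_continuous_onI continuous_intros)
  qed (simp add: norm_exp_eq_Re)
  have eX_le: "norm (?eX X u) \<le> F X" for X u
  proof -
    have "Re (2 * pi * \<i> * (cvec X \<bullet>\<^sub>c a) - 2 * pi * \<i> * (X \<bullet> u) - pi / 2 * \<sigma>\<^sub>x\<^sup>2 * (X \<bullet> X))
        = Re (2 * pi * \<i> * (cvec X \<bullet>\<^sub>c a)) - pi / 2 * \<sigma>\<^sub>x\<^sup>2 * (X \<bullet> X)"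
      by simp
    also have "\<dots> \<le> A * norm X - pi / 2 * \<sigma>\<^sub>x\<^sup>2 * (X \<bullet> X)"
      unfolding A_def by (intro diff_right_mono Im_le)
    finally show ?thesis
      unfolding F_def norm_exp_eq_Re exp_add[symmetric] exp_le_cancel_iff Re_complex_of_real by simp
  qed
  define D where "D = exp (B\<^sup>2 / (4 * (pi / 2 * \<sigma>\<^sub>k\<^sup>2)))"
  have eK_le: "norm (?eK K) \<le> D" for K
  proof -
    have "Re (2 * pi * \<i> * (cvec K \<bullet>\<^sub>c b) - pi * \<sigma>\<^sub>k\<^sup>2 * (K \<bullet> K) / 2)
        = Re (2 * pi * \<i> * (cvec K \<bullet>\<^sub>c b)) - pi / 2 * \<sigma>\<^sub>k\<^sup>2 * (norm K)\<^sup>2"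
      by (simp add: power2_norm_eq_inner)
    also have "\<dots> \<le> B * norm K - pi / 2 * \<sigma>\<^sub>k\<^sup>2 * (norm K)\<^sup>2"
      unfolding B_def by (intro diff_right_mono Im_le)
    also have "\<dots> \<le> B\<^sup>2 / (4 * (pi / 2 * \<sigma>\<^sub>k\<^sup>2))" by (rule linear_minus_square_le[OF ck])
    finally show ?thesis unfolding D_def norm_exp_eq_Re exp_le_cancel_iff .
  qed
  have "(LINT (X, K)|lborel. exp (2 * pi * \<i> * (cvec X \<bullet>\<^sub>c a + cvec K \<bullet>\<^sub>c b)) * fourier (swt \<sigma>\<^sub>x \<sigma>\<^sub>k f g) (X, K))
      = (LINT (X, K)|lborel. LINT u|lborel. ?J X K u)"
  proof (intro Bochner_Integration.integral_cong refl)
    fix p :: "(real^'n) \<times> (real^'n)"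
    obtain X K where p: "p = (X, K)" by fastforce
    have e: "exp (2 * pi * \<i> * (cvec X \<bullet>\<^sub>c a + cvec K \<bullet>\<^sub>c b)) *
       (exp (of_real (- (pi / 2) * (\<sigma>\<^sub>x\<^sup>2 * (X \<bullet> X) + \<sigma>\<^sub>k\<^sup>2 * (K \<bullet> K)))) *
       exp (- 2 * pi * \<i> * of_real (X \<bullet> u))) = ?eX X u * ?eK K" for u
      unfolding exp_add[symmetric] by (rule arg_cong[of _ _ exp]) (simp add: field_simps)
    have "exp (2 * pi * \<i> * (cvec X \<bullet>\<^sub>c a + cvec K \<bullet>\<^sub>c b)) * fourier (swt \<sigma>\<^sub>x \<sigma>\<^sub>k f g) (X, K) =
        (LINT u|lborel. (exp (2 * pi * \<i> * (cvec X \<bullet>\<^sub>c a + cvec K \<bullet>\<^sub>c b)) *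
       (exp (of_real (- (pi / 2) * (\<sigma>\<^sub>x\<^sup>2 * (X \<bullet> X) + \<sigma>\<^sub>k\<^sup>2 * (K \<bullet> K)))) *
       exp (- 2 * pi * \<i> * of_real (X \<bullet> u)))) * ?N K u)"
      unfolding fourier_swt[OF f g \<sigma>] integral_mult_right_zero[symmetric] by (simp only: mult.assoc)
    then show "(case p of (X, K) \<Rightarrow> exp (2 * pi * \<i> * (cvec X \<bullet>\<^sub>c a + cvec K \<bullet>\<^sub>c b)) * fourier (swt \<sigma>\<^sub>x \<sigma>\<^sub>k f g) (X, K))
       = (case p of (X, K) \<Rightarrow> LINT u|lborel. ?J X K u)"
      unfolding p prod.case e by (simp only: mult.assoc)
  qed
  also have "\<dots> = (LINT (K, u)|lborel. LINT X|lborel. ?J X K u)"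
  proof (rule lborel_fubini3[where f = F and h = "\<lambda>(K, u). D * norm (?N K u)"])
    show "(\<lambda>(X, t). ?J X (fst t) (snd t)) \<in> borel_measurable borel"
      unfolding case_prod_unfold
      by (intro borel_measurable_continuous_onI continuous_intros
          continuous_on_compose2[OF schwartz_continuous[OF f, of UNIV]]
          continuous_on_compose2[OF schwartz_continuous[OF g, of UNIV]]) auto
    show "integrable lborel F" by (rule F)
    have "integrable lborel (\<lambda>p. D * norm (case p of (K, u) \<Rightarrow> ?N K u))"
      by (intro integrable_mult_right integrable_norm schwartz_integrable N)
    then show "integrable lborel (\<lambda>(K, u). D * norm (?N K u))" by (simp add: case_prod_unfold)
    have "integrable lborel (\<lambda>u. ?N K u)" for K
      using schwartz_integrable[OF schwartz_slice_snd[OF N, of K]] by (simp only: prod.case)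
    then show "integrable lborel (\<lambda>u. case (K, u) of (K, u) \<Rightarrow> D * norm (?N K u))" for K
      unfolding prod.case by (intro integrable_mult_right integrable_norm)
    have "norm (?J X K u) = norm (?eX X u) * (norm (?eK K) * norm (?N K u))" for X K u
      by (simp only: norm_mult)
    also have "\<dots> X K u \<le> F X * (D * norm (?N K u))" for X K u
      by (intro mult_mono eX_le eK_le) (auto simp: F_def D_def)
    finally show "norm (?J X K u) \<le> F X * (case (K, u) of (K, u) \<Rightarrow> D * norm (?N K u))" for X K u
      by simp
  qed
  also have "\<dots> = (LINT (K, u)|lborel. ?C * (?G u * (?eK K * ?N K u)))"
    unfolding integral_mult_left_zero gaussian_fourier_cdot[OF \<sigma>(1)] by (simp only: mult.assoc of_real_power)
  also have "\<dots> = ?C * (LINT (K, u)|lborel. ?G u * (?eK K * ?N K u))"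
    unfolding case_prod_unfold by (rule integral_mult_right_zero)
  also have "(LINT (K, u)|lborel. ?G u * (?eK K * ?N K u)) = (LINT u|lborel. LINT K|lborel. ?G u * (?eK K * ?N K u))"
  proof (rule lborel_fubini_swap, rule lborel_integrable_swap)
    \<comment> \<open>up to the sign of the phase, this is the integrand at \<open>(a, -b)\<close> with \<open>f\<close> and \<open>g\<close> replaced by the
      conjugates of \<open>g\<close> and \<open>f\<close>\<close>
    have eq: "exp (- 2 * pi * \<i> * (- b \<bullet>\<^sub>c cvec K) - pi * \<sigma>\<^sub>k\<^sup>2 * (K \<bullet> K) / 2
             - 2 * pi * ((cvec u - a) \<bullet>\<^sub>c (cvec u - a)) / \<sigma>\<^sub>x\<^sup>2)
        * cnj (g (u + K /\<^sub>R 2)) * cnj (cnj (f (u - K /\<^sub>R 2))) = ?G u * (?eK K * ?N K u)" for u K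
    proof -
      have "exp (- 2 * pi * \<i> * (- b \<bullet>\<^sub>c cvec K) - pi * \<sigma>\<^sub>k\<^sup>2 * (K \<bullet> K) / 2
             - 2 * pi * ((cvec u - a) \<bullet>\<^sub>c (cvec u - a)) / \<sigma>\<^sub>x\<^sup>2) = ?G u * ?eK K"
        unfolding exp_add[symmetric]
        by (rule arg_cong[of _ _ exp]) (simp add: cdot_def sum_negf mult.commute[of "b $ _"])
      then show ?thesis by simp
    qed
    show "integrable lborel (\<lambda>(u, K). ?G u * (?eK K * ?N K u))"
      using swt_complex_integrable[OF schwartz_cnj[OF g] schwartz_cnj[OF f] \<sigma>, of "- b" a]
      unfolding eq .
  qed
  also have "\<dots> = (LINT u|lborel. LINT y|lborel. ?G u * (?eK (- y) * ?N (- y) u))"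
  proof (rule Bochner_Integration.integral_cong[OF refl])
    show "(LINT K|lborel. ?G u * (?eK K * ?N K u)) = (LINT y|lborel. ?G u * (?eK (- y) * ?N (- y) u))" for u
      by (rule lborel_integral_uminus[symmetric], intro borel_measurable_continuous_onI continuous_intros
          continuous_on_compose2[OF schwartz_continuous[OF f, of UNIV]]
          continuous_on_compose2[OF schwartz_continuous[OF g, of UNIV]]) auto
  qed
  also have "\<dots> = (LINT u|lborel. LINT y|lborel. exp (- 2 * pi * \<i> * (b \<bullet>\<^sub>c cvec y) - pi * \<sigma>\<^sub>k\<^sup>2 * (y \<bullet> y) / 2
             - 2 * pi * ((cvec u - a) \<bullet>\<^sub>c (cvec u - a)) / \<sigma>\<^sub>x\<^sup>2)
        * f (u + y /\<^sub>R 2) * cnj (g (u - y /\<^sub>R 2)))"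
  proof (intro Bochner_Integration.integral_cong refl)
    fix u y :: "real^'n"
    have "?G u * ?eK (- y) = exp (- 2 * pi * \<i> * (b \<bullet>\<^sub>c cvec y) - pi * \<sigma>\<^sub>k\<^sup>2 * (y \<bullet> y) / 2
             - 2 * pi * ((cvec u - a) \<bullet>\<^sub>c (cvec u - a)) / \<sigma>\<^sub>x\<^sup>2)"
      unfolding exp_add[symmetric]
      by (rule arg_cong[of _ _ exp]) (simp add: cdot_def cvec_def sum_negf mult.commute[of "b $ _"])
    then show "?G u * (?eK (- y) * ?N (- y) u) = exp (- 2 * pi * \<i> * (b \<bullet>\<^sub>c cvec y) - pi * \<sigma>\<^sub>k\<^sup>2 * (y \<bullet> y) / 2
             - 2 * pi * ((cvec u - a) \<bullet>\<^sub>c (cvec u - a)) / \<sigma>\<^sub>x\<^sup>2)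
        * f (u + y /\<^sub>R 2) * cnj (g (u - y /\<^sub>R 2))"
      unfolding mult.assoc[symmetric] by simp
  qed
  also have "?C * \<dots> = swt_complex \<sigma>\<^sub>x \<sigma>\<^sub>k f g (a, b)"
    using lborel_fubini[OF swt_complex_integrable[OF f g \<sigma>, of b a]]
    unfolding swt_complex_def by (simp only: prod.case of_real_power)
  finally show ?thesis ..
qed

lemma fourier_swt_measurable:
  fixes f g :: "real^'n \<Rightarrow> complex" and \<sigma>\<^sub>x \<sigma>\<^sub>k :: real
  assumes f: "schwartz f" and g: "schwartz g" and \<sigma>: "\<sigma>\<^sub>x > 0" "\<sigma>\<^sub>k > 0"
  shows "fourier (swt \<sigma>\<^sub>x \<sigma>\<^sub>k f g) \<in> borel_measurable borel"
proof -
  have "continuous_on UNIV (\<lambda>q :: ((real^'n) \<times> (real^'n)) \<times> (real^'n). exp (- 2 * pi * \<i> * of_real (fst (fst q) \<bullet> snd q)) *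
      (f (snd q - snd (fst q) /\<^sub>R 2) * cnj (g (snd q + snd (fst q) /\<^sub>R 2))))"
    by (intro continuous_intros
          continuous_on_compose2[OF schwartz_continuous[OF f, of UNIV]]
          continuous_on_compose2[OF schwartz_continuous[OF g, of UNIV]]) auto
  then have 1: "(\<lambda>p. LINT u|lborel. exp (- 2 * pi * \<i> * of_real (fst p \<bullet> u)) *
      (f (u - snd p /\<^sub>R 2) * cnj (g (u + snd p /\<^sub>R 2)))) \<in> borel_measurable borel"
    by (intro borel_measurable_lborel_integral) (simp add: case_prod_unfold borel_measurable_continuous_onI)
  have 2: "(\<lambda>p :: (real^'n) \<times> (real^'n). exp (complex_of_real (- (pi / 2) * (\<sigma>\<^sub>x\<^sup>2 * (fst p \<bullet> fst p) + \<sigma>\<^sub>k\<^sup>2 * (snd p \<bullet> snd p)))))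
      \<in> borel_measurable borel"
    by (intro borel_measurable_continuous_onI continuous_intros)
  show ?thesis
    using borel_measurable_times[OF 2 1] unfolding fourier_swt[OF f g \<sigma>, symmetric] by simp
qed

lemma fourier_swt_gaussian_bound:
  fixes f g :: "real^'n \<Rightarrow> complex" and \<sigma>\<^sub>x \<sigma>\<^sub>k :: real
  assumes f: "schwartz f" and g: "schwartz g" and \<sigma>: "\<sigma>\<^sub>x > 0" "\<sigma>\<^sub>k > 0"
  shows "\<exists>C. \<forall>p. norm (fourier (swt \<sigma>\<^sub>x \<sigma>\<^sub>k f g) p) \<le> C * exp (- (pi / 2 * min (\<sigma>\<^sub>x\<^sup>2) (\<sigma>\<^sub>k\<^sup>2)) * (p \<bullet> p))"
proof -
  let ?N = "\<lambda>K u. f (u - K /\<^sub>R 2) * cnj (g (u + K /\<^sub>R 2))"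
  have N: "schwartz (\<lambda>(K, u). ?N K u)" by (rule schwartz_wigner_product_swapped[OF f g])
  obtain B where B: "B \<ge> 0" "\<And>p. norm (case p of (K, u) \<Rightarrow> ?N K u) \<le> B * weight p"
    using schwartz_le_weight[OF N] by blast
  let ?C = "B * (LINT u|lborel. weight (u :: real^'n))"
  have "norm (fourier (swt \<sigma>\<^sub>x \<sigma>\<^sub>k f g) (X, K)) \<le> ?C * exp (- (pi / 2 * min (\<sigma>\<^sub>x\<^sup>2) (\<sigma>\<^sub>k\<^sup>2)) * ((X, K) \<bullet> (X, K)))" for X K
  proof -
    have le: "norm (?N K u) \<le> B * weight u" for u
    proof -
      have "norm (?N K u) \<le> B * (weight K * weight u)" using B(2)[of "(K, u)"] by (simp add: weight_Pair)
      also have "\<dots> \<le> B * (1 * weight u)"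
        using weight_le_1[of K] weight_pos[of u] B(1) by (intro mult_left_mono mult_right_mono) auto
      finally show ?thesis by simp
    qed
    let ?I = "LINT u|lborel. exp (- 2 * pi * \<i> * of_real (X \<bullet> u)) * ?N K u"
    have iN: "integrable lborel (?N K)"
      using schwartz_integrable[OF schwartz_slice_snd[OF N, of K]] by (simp only: prod.case)
    have "norm ?I \<le> (LINT u|lborel. norm (exp (- 2 * pi * \<i> * of_real (X \<bullet> u)) * ?N K u))"
      by (rule integral_norm_bound)
    also have "\<dots> = (LINT u|lborel. norm (?N K u))"
      by (simp only: norm_mult norm_exp_imaginary' mult_1)
    also have "\<dots> \<le> (LINT u|lborel. B * weight (u :: real^'n))"
      by (intro integral_mono le integrable_norm iN integrable_mult_right integrable_weight)
    finally have I: "norm ?I \<le> ?C" by simp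
    have "norm (fourier (swt \<sigma>\<^sub>x \<sigma>\<^sub>k f g) (X, K)) = exp (- (pi / 2) * (\<sigma>\<^sub>x\<^sup>2 * (X \<bullet> X) + \<sigma>\<^sub>k\<^sup>2 * (K \<bullet> K))) * norm ?I"
      unfolding fourier_swt[OF f g \<sigma>] norm_mult by (simp add: norm_exp_eq_Re)
    also have "\<dots> \<le> exp (- (pi / 2 * min (\<sigma>\<^sub>x\<^sup>2) (\<sigma>\<^sub>k\<^sup>2)) * ((X, K) \<bullet> (X, K))) * ?C"
    proof (intro mult_mono I)
      have "min (\<sigma>\<^sub>x\<^sup>2) (\<sigma>\<^sub>k\<^sup>2) * (X \<bullet> X) \<le> \<sigma>\<^sub>x\<^sup>2 * (X \<bullet> X)" "min (\<sigma>\<^sub>x\<^sup>2) (\<sigma>\<^sub>k\<^sup>2) * (K \<bullet> K) \<le> \<sigma>\<^sub>k\<^sup>2 * (K \<bullet> K)"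
        by (intro mult_right_mono; simp)+
      then have "pi / 2 * (min (\<sigma>\<^sub>x\<^sup>2) (\<sigma>\<^sub>k\<^sup>2) * (X \<bullet> X) + min (\<sigma>\<^sub>x\<^sup>2) (\<sigma>\<^sub>k\<^sup>2) * (K \<bullet> K))
          \<le> pi / 2 * (\<sigma>\<^sub>x\<^sup>2 * (X \<bullet> X) + \<sigma>\<^sub>k\<^sup>2 * (K \<bullet> K))"
        by (intro mult_left_mono add_mono) auto
      then show "exp (- (pi / 2) * (\<sigma>\<^sub>x\<^sup>2 * (X \<bullet> X) + \<sigma>\<^sub>k\<^sup>2 * (K \<bullet> K)))
          \<le> exp (- (pi / 2 * min (\<sigma>\<^sub>x\<^sup>2) (\<sigma>\<^sub>k\<^sup>2)) * ((X, K) \<bullet> (X, K)))"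
        by (simp add: algebra_simps)
    qed auto
    finally show ?thesis by (simp only: mult.commute)
  qed
  then show ?thesis by (intro exI[of _ ?C]) auto
qed

text \<open>The Gaussian bound on the Fourier transform makes the inversion integral entire.\<close>

lemma entire_extension_swt:
  fixes f g :: "real^'n \<Rightarrow> complex" and \<sigma>\<^sub>x \<sigma>\<^sub>k :: real
  assumes f: "schwartz f" and g: "schwartz g" and \<sigma>: "\<sigma>\<^sub>x > 0" "\<sigma>\<^sub>k > 0"
  shows "entire_extension (swt \<sigma>\<^sub>x \<sigma>\<^sub>k f g) = swt_complex \<sigma>\<^sub>x \<sigma>\<^sub>k f g"
proof (rule entire_extension_eqI)
  obtain C where C: "\<And>p. norm (fourier (swt \<sigma>\<^sub>x \<sigma>\<^sub>k f g) p) \<le> C * exp (- (pi / 2 * min (\<sigma>\<^sub>x\<^sup>2) (\<sigma>\<^sub>k\<^sup>2)) * (p \<bullet> p))"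
    using fourier_swt_gaussian_bound[OF f g \<sigma>] by blast
  have c: "pi / 2 * min (\<sigma>\<^sub>x\<^sup>2) (\<sigma>\<^sub>k\<^sup>2) > 0" using \<sigma> by simp
  have "swt_complex \<sigma>\<^sub>x \<sigma>\<^sub>k f g = (\<lambda>(a, b).
      LINT (X, K)|lborel. exp (2 * pi * \<i> * (cvec X \<bullet>\<^sub>c a + cvec K \<bullet>\<^sub>c b)) * fourier (swt \<sigma>\<^sub>x \<sigma>\<^sub>k f g) (X, K))"
    by (rule ext) (auto simp only: split_paired_all prod.case swt_complex_eq_fourier_integral[OF f g \<sigma>])
  then show "entire (swt_complex \<sigma>\<^sub>x \<sigma>\<^sub>k f g)"
    using entire_exp_integral[OF fourier_swt_measurable[OF f g \<sigma>] C c] by simp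
  show "swt_complex \<sigma>\<^sub>x \<sigma>\<^sub>k f g (cvec x, cvec k) = swt \<sigma>\<^sub>x \<sigma>\<^sub>k f g (x, k)" for x k
    by (rule swt_complex_cvec)
qed


section \<open>The three test functions\<close>

text \<open>Shifting \<open>(X, K)\<close> by \<open>(S/2, T/2)\<close> splits the exponent into a part independent of \<open>(X, K)\<close>, which is
the prefactor on the right, and the phase of the inversion integral at the complex point.\<close>

lemma smoothed_op_integral:
  fixes f g :: "real^'n \<Rightarrow> complex" and \<sigma>\<^sub>x \<sigma>\<^sub>k :: real and x k S T :: "real^'n"
  assumes f: "schwartz f" and g: "schwartz g" and \<sigma>: "\<sigma>\<^sub>x > 0" "\<sigma>\<^sub>k > 0"
  shows "(LINT (X, K)|lborel.
         exp (2 * pi * \<i> *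
              (cvec (S /\<^sub>R 2) \<bullet>\<^sub>c (cvec (x - K) + (\<i> * (complex_of_real \<sigma>\<^sub>x)\<^sup>2) *s cvec X)
               + cvec (T /\<^sub>R 2) \<bullet>\<^sub>c (cvec (k + X) + (\<i> * (complex_of_real \<sigma>\<^sub>k)\<^sup>2) *s cvec K)
               + x \<bullet> X + k \<bullet> K))
         * fourier (swt \<sigma>\<^sub>x \<sigma>\<^sub>k f g) (X - S /\<^sub>R 2, K - T /\<^sub>R 2))
     = exp (2 * pi * \<i> * (S \<bullet> x + T \<bullet> k)
            - pi / 2 * (\<sigma>\<^sub>x\<^sup>2 * (S \<bullet> S) + \<sigma>\<^sub>k\<^sup>2 * (T \<bullet> T)))
       * swt_complex \<sigma>\<^sub>x \<sigma>\<^sub>k f g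
           (cvec x + (1 / 2) *s (cvec T + (\<i> * (complex_of_real \<sigma>\<^sub>x)\<^sup>2) *s cvec S),
            cvec k - (1 / 2) *s (cvec S - (\<i> * (complex_of_real \<sigma>\<^sub>k)\<^sup>2) *s cvec T))"
proof -
  let ?s = "S /\<^sub>R 2" and ?t = "T /\<^sub>R 2"
  let ?V = "fourier (swt \<sigma>\<^sub>x \<sigma>\<^sub>k f g)"
  let ?q = "\<lambda>X K. cvec ?s \<bullet>\<^sub>c (cvec (x - K) + (\<i> * (complex_of_real \<sigma>\<^sub>x)\<^sup>2) *s cvec X)
               + cvec ?t \<bullet>\<^sub>c (cvec (k + X) + (\<i> * (complex_of_real \<sigma>\<^sub>k)\<^sup>2) *s cvec K) + x \<bullet> X + k \<bullet> K"
  let ?a = "cvec x + (1 / 2) *s (cvec T + (\<i> * (complex_of_real \<sigma>\<^sub>x)\<^sup>2) *s cvec S)"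
  let ?b = "cvec k - (1 / 2) *s (cvec S - (\<i> * (complex_of_real \<sigma>\<^sub>k)\<^sup>2) *s cvec T)"
  let ?E = "exp (2 * pi * \<i> * (S \<bullet> x + T \<bullet> k)
            - pi / 2 * (\<sigma>\<^sub>x\<^sup>2 * (S \<bullet> S) + \<sigma>\<^sub>k\<^sup>2 * (T \<bullet> T)))"
  define \<Phi> where "\<Phi> p = exp (2 * pi * \<i> * ?q (fst p) (snd p)) * ?V (fst p - ?s, snd p - ?t)" for p
  have m1: "(\<lambda>p. exp (2 * pi * \<i> * ?q (fst p) (snd p))) \<in> borel_measurable borel"
    unfolding cdot_simps by (intro borel_measurable_continuous_onI continuous_intros)
  have m2: "(\<lambda>p. ?V (fst p - ?s, snd p - ?t)) \<in> borel_measurable borel"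
    by (rule measurable_compose[OF _ fourier_swt_measurable[OF f g \<sigma>]],
        intro borel_measurable_continuous_onI continuous_intros)
  have m: "\<Phi> \<in> borel_measurable borel"
    using borel_measurable_times[OF m1 m2] unfolding \<Phi>_def .
  have shift: "\<Phi> (p + (?s, ?t)) = ?E * (exp (2 * pi * \<i> * (cvec (fst p) \<bullet>\<^sub>c ?a + cvec (snd p) \<bullet>\<^sub>c ?b)) * ?V p)" for p
  proof -
    obtain X K where p: "p = (X, K)" by fastforce
    have "exp (2 * pi * \<i> * ?q (X + ?s) (K + ?t)) = ?E * exp (2 * pi * \<i> * (cvec X \<bullet>\<^sub>c ?a + cvec K \<bullet>\<^sub>c ?b))"
      unfolding exp_add[symmetric] cdot_simps
      by (rule arg_cong[of _ _ exp])
        (simp add: inner_add_left inner_add_right inner_diff_left inner_diff_right inner_commute complex_eq_iff field_simps)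
    then show ?thesis unfolding \<Phi>_def p by simp
  qed
  have "(LINT (X, K)|lborel. exp (2 * pi * \<i> * ?q X K) * ?V (X - ?s, K - ?t)) = (LINT p|lborel. \<Phi> p)"
    unfolding \<Phi>_def by (simp add: case_prod_unfold)
  also have "\<dots> = (LINT p|lborel. \<Phi> (p + (?s, ?t)))"
    by (rule lborel_integral_translate[OF m, symmetric])
  also have "\<dots> = ?E * (LINT p|lborel. exp (2 * pi * \<i> * (cvec (fst p) \<bullet>\<^sub>c ?a + cvec (snd p) \<bullet>\<^sub>c ?b)) * ?V p)"
    unfolding shift by (rule integral_mult_right_zero)
  also have "(LINT p|lborel. exp (2 * pi * \<i> * (cvec (fst p) \<bullet>\<^sub>c ?a + cvec (snd p) \<bullet>\<^sub>c ?b)) * ?V p)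
      = swt_complex \<sigma>\<^sub>x \<sigma>\<^sub>k f g (?a, ?b)"
    unfolding swt_complex_eq_fourier_integral[OF f g \<sigma>] by (simp add: case_prod_unfold)
  finally show ?thesis .
qed

text \<open>The integrand of the Weyl test function without the phase \<open>exp(-2\<pi>i \<kappa> T)\<close>, for the function \<open>h\<close> that
the smoothed Wigner transform of a distribution pairs with.\<close>

definition weyl_density ::
    "real \<Rightarrow> real \<Rightarrow> (real^'n \<Rightarrow> complex) \<Rightarrow> (real^'n \<Rightarrow> complex) \<Rightarrow> real^'n \<Rightarrow> real^'n \<Rightarrow>
     (real^'n) \<times> (real^'n) \<times> (real^'n) \<Rightarrow> complex" where
  "weyl_density \<sigma>\<^sub>x \<sigma>\<^sub>k f g x k = (\<lambda>(z, T, y).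
     of_real ((sqrt 2 / \<sigma>\<^sub>x) ^ CARD('n)) *
     (exp (of_real (- (pi * \<sigma>\<^sub>k\<^sup>2 / 2) * (y \<bullet> y)) + \<i> * of_real ((- (2 * pi) *\<^sub>R k) \<bullet> y))
      * exp (of_real (- (2 * pi / \<sigma>\<^sub>x\<^sup>2) * ((z - T /\<^sub>R 2 - y /\<^sub>R 2 - x) \<bullet> (z - T /\<^sub>R 2 - y /\<^sub>R 2 - x))))
      * f (z + T /\<^sub>R 2) * cnj (g (z - T /\<^sub>R 2 - y))))"

text \<open>The arguments \<open>z + T/2\<close>, \<open>z - T/2 - y\<close> and \<open>y\<close> of \<open>f\<close>, \<open>g\<close> and the first Gaussian determine
\<open>(z, T, y)\<close>.\<close>

lemma schwartz_weyl_density: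
  fixes f g :: "real^'n \<Rightarrow> complex" and \<sigma>\<^sub>x \<sigma>\<^sub>k :: real
  assumes f: "schwartz f" and g: "schwartz g" and \<sigma>: "\<sigma>\<^sub>x > 0" "\<sigma>\<^sub>k > 0"
  shows "schwartz (weyl_density \<sigma>\<^sub>x \<sigma>\<^sub>k f g x k)"
proof -
  let ?z = "\<lambda>v::(real^'n) \<times> (real^'n) \<times> (real^'n). fst v"
  let ?T = "\<lambda>v::(real^'n) \<times> (real^'n) \<times> (real^'n). fst (snd v)"
  let ?y = "\<lambda>v::(real^'n) \<times> (real^'n) \<times> (real^'n). snd (snd v)"
  have bl: "bounded_linear ?z" "bounded_linear ?y" "bounded_linear (\<lambda>v. ?T v /\<^sub>R 2)" "bounded_linear (\<lambda>v. ?y v /\<^sub>R 2)"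
    by (intro bounded_linear_intros)+
  let ?F1 = "\<lambda>y. exp (of_real (- (pi * \<sigma>\<^sub>k\<^sup>2 / 2) * (y \<bullet> y)) + \<i> * of_real ((- (2 * pi) *\<^sub>R k) \<bullet> y))"
  let ?F2 = "\<lambda>d :: real^'n. exp (of_real (- (2 * pi / \<sigma>\<^sub>x\<^sup>2) * (d \<bullet> d)))"
  have "schwartz (\<lambda>v. ?F1 (?y v + 0) * ?F2 ((?z v - ?T v /\<^sub>R 2 - ?y v /\<^sub>R 2) + - x)
      * f ((?z v + ?T v /\<^sub>R 2) + 0) * cnj (g ((?z v - ?T v /\<^sub>R 2 - ?y v) + 0)))"
  proof (rule schwartz_prod4[where K = 5 and ?F3.0 = f and ?F4.0 = "\<lambda>x. cnj (g x)" and ?F1.0 = ?F1 and ?F2.0 = ?F2])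
    show "schwartz ?F1" using \<sigma> by (intro schwartz_gaussian) simp
    show "schwartz ?F2" using \<sigma> by (intro schwartz_real_gaussian) simp
    show "schwartz f" "schwartz (\<lambda>x. cnj (g x))" by (intro f schwartz_cnj g)+
    show "bounded_linear ?y" "bounded_linear (\<lambda>v. ?z v - ?T v /\<^sub>R 2 - ?y v /\<^sub>R 2)" "bounded_linear (\<lambda>v. ?z v + ?T v /\<^sub>R 2)"
      "bounded_linear (\<lambda>v. ?z v - ?T v /\<^sub>R 2 - ?y v)"
      by (intro bl bounded_linear_add bounded_linear_sub)+
    fix v :: "(real^'n) \<times> (real^'n) \<times> (real^'n)"
    obtain z T y where v: "v = (z, T, y)" by (cases v)
    \<comment> \<open>\<open>z\<close> and \<open>T\<close> in terms of the arguments \<open>p\<close> of \<open>f\<close> and \<open>q\<close> of \<open>g\<close>, and of \<open>y\<close>\<close>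
    define p q where "p = z + T /\<^sub>R 2" and "q = z - T /\<^sub>R 2 - y"
    have z: "2 *\<^sub>R z = p + q + y" and T: "T = p - q - y"
      by (simp_all add: p_def q_def vec_eq_iff field_simps)
    have "norm v \<le> norm z + norm (T, y)" unfolding v by (rule norm_Pair_le)
    also have "norm (T, y) \<le> norm T + norm y" by (rule norm_Pair_le)
    finally have n: "norm v \<le> norm z + (norm T + norm y)" by simp
    have nz: "2 * norm z \<le> norm p + norm q + norm y"
    proof -
      have "2 * norm z = norm (p + q + y)" unfolding z[symmetric] by simp
      then show ?thesis using norm_triangle_ineq[of "p + q" y] norm_triangle_ineq[of p q] by linarith
    qed
    have nT: "norm T \<le> norm p + norm q + norm y"
      unfolding T using norm_triangle_ineq4[of "p - q" y] norm_triangle_ineq4[of p q] by linarith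
    have "N \<le> 5 * (c + d + e + h)"
      if "N \<le> a + (b + c)" "2 * a \<le> e + h + c" "b \<le> e + h + c" "0 \<le> c" "0 \<le> d" "0 \<le> e" "0 \<le> h"
      for N a b c d e h :: real
      using that unfolding distrib_left by linarith
    from this[OF n nz nT]
    show "norm v \<le> 5 * (norm (?y v) + norm (?z v - ?T v /\<^sub>R 2 - ?y v /\<^sub>R 2) + norm (?z v + ?T v /\<^sub>R 2) + norm (?z v - ?T v /\<^sub>R 2 - ?y v))"
      by (simp add: v p_def q_def)
  qed
  then show ?thesis
    unfolding weyl_density_def case_prod_unfold by (intro schwartz_cmult) simp
qed

text \<open>Multiplied by the prefactor, the Gaussians at complex arguments become Gaussians at arguments
translated by \<open>T\<close> and \<open>T/2\<close>, times the phase \<open>exp(2\<pi>i S (u + y/2 - T/2))\<close>; all real exponential factors cancel.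
Replacing \<open>y\<close> by \<open>y + T\<close> and then \<open>u\<close> by \<open>z - y/2\<close> turns the phase into \<open>exp(2\<pi>i S z)\<close>.\<close>

lemma swt_complex_eq_partial_fourier:
  fixes f g :: "real^'n \<Rightarrow> complex" and \<sigma>\<^sub>x \<sigma>\<^sub>k :: real and x k S T :: "real^'n"
  assumes f: "schwartz f" and g: "schwartz g" and \<sigma>: "\<sigma>\<^sub>x > 0" "\<sigma>\<^sub>k > 0"
  shows "exp (2 * pi * \<i> * (S \<bullet> x + T \<bullet> k)
            - pi / 2 * (\<sigma>\<^sub>x\<^sup>2 * (S \<bullet> S) + \<sigma>\<^sub>k\<^sup>2 * (T \<bullet> T)))
       * swt_complex \<sigma>\<^sub>x \<sigma>\<^sub>k f g
           (cvec x + (1 / 2) *s (cvec T + (\<i> * (complex_of_real \<sigma>\<^sub>x)\<^sup>2) *s cvec S),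
            cvec k - (1 / 2) *s (cvec S - (\<i> * (complex_of_real \<sigma>\<^sub>k)\<^sup>2) *s cvec T))
     = (LINT y|lborel. partial_fourier (weyl_density \<sigma>\<^sub>x \<sigma>\<^sub>k f g x k) S (T, y))"
proof -
  let ?a = "cvec x + (1 / 2) *s (cvec T + (\<i> * (complex_of_real \<sigma>\<^sub>x)\<^sup>2) *s cvec S)"
  let ?b = "cvec k - (1 / 2) *s (cvec S - (\<i> * (complex_of_real \<sigma>\<^sub>k)\<^sup>2) *s cvec T)"
  let ?E = "exp (2 * pi * \<i> * (S \<bullet> x + T \<bullet> k)
            - pi / 2 * (\<sigma>\<^sub>x\<^sup>2 * (S \<bullet> S) + \<sigma>\<^sub>k\<^sup>2 * (T \<bullet> T)))"
  let ?C = "complex_of_real ((sqrt 2 / \<sigma>\<^sub>x) ^ CARD('n))"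
  let ?e = "\<lambda>u y. exp (- 2 * pi * \<i> * (?b \<bullet>\<^sub>c cvec y) - pi * \<sigma>\<^sub>k\<^sup>2 * (y \<bullet> y) / 2
             - 2 * pi * ((cvec u - ?a) \<bullet>\<^sub>c (cvec u - ?a)) / \<sigma>\<^sub>x\<^sup>2)"
  let ?h = "\<lambda>u y. ?e u y * f (u + y /\<^sub>R 2) * cnj (g (u - y /\<^sub>R 2))"
  have i: "integrable lborel (\<lambda>(u, y). ?h u y)" by (rule swt_complex_integrable[OF f g \<sigma>])
  have cont: "continuous_on UNIV (\<lambda>p. ?h (l p) (m p))"
    if "continuous_on UNIV l" "continuous_on UNIV m" for l m :: "'z::euclidean_space \<Rightarrow> real^'n"
    using that \<sigma>
    by (intro continuous_intros continuous_on_compose2[OF schwartz_continuous[OF f, of UNIV]]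
          continuous_on_compose2[OF schwartz_continuous[OF g, of UNIV]]) auto
  have "swt_complex \<sigma>\<^sub>x \<sigma>\<^sub>k f g (?a, ?b) = ?C * (LINT (u, y)|lborel. ?h u y)"
    unfolding swt_complex_def by (simp only: prod.case of_real_power)
  also have "(LINT (u, y)|lborel. ?h u y) = (LINT y|lborel. LINT u|lborel. ?h u y)"
    by (rule lborel_fubini_swap[OF i])
  also have "\<dots> = (LINT y|lborel. LINT u|lborel. ?h u (y + T))"
  proof (rule lborel_integral_translate[symmetric], rule borel_measurable_lborel_integral)
    show "(\<lambda>(y, u). ?h u y) \<in> borel_measurable borel"
      unfolding case_prod_unfold
      by (rule borel_measurable_continuous_onI, rule cont) (intro continuous_intros)+
  qed
  also have "\<dots> = (LINT y|lborel. LINT z|lborel. ?h (z + - (y /\<^sub>R 2)) (y + T))"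
  proof (rule Bochner_Integration.integral_cong[OF refl])
    show "(LINT u|lborel. ?h u (y + T)) = (LINT z|lborel. ?h (z + - (y /\<^sub>R 2)) (y + T))" for y
      by (rule lborel_integral_translate[symmetric], rule borel_measurable_continuous_onI, rule cont)
        (intro continuous_intros)+
  qed
  finally have "?E * swt_complex \<sigma>\<^sub>x \<sigma>\<^sub>k f g (?a, ?b) =
      (LINT y|lborel. LINT z|lborel. ?E * (?C * ?h (z + - (y /\<^sub>R 2)) (y + T)))"
    by (simp only: integral_mult_right_zero)
  also have "\<dots> = (LINT y|lborel. partial_fourier (weyl_density \<sigma>\<^sub>x \<sigma>\<^sub>k f g x k) S (T, y))"
    unfolding partial_fourier_def
  proof (intro Bochner_Integration.integral_cong refl)
    fix y z :: "real^'n"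
    have arg: "z + - (y /\<^sub>R 2) + (y + T) /\<^sub>R 2 = z + T /\<^sub>R 2"
      "z + - (y /\<^sub>R 2) - (y + T) /\<^sub>R 2 = z - T /\<^sub>R 2 - y"
      by (simp_all add: vec_eq_iff field_simps)
    have "?E * ?e (z + - (y /\<^sub>R 2)) (y + T) = exp (2 * pi * \<i> * of_real (S \<bullet> z)) *
      (exp (of_real (- (pi * \<sigma>\<^sub>k\<^sup>2 / 2) * (y \<bullet> y)) + \<i> * of_real ((- (2 * pi) *\<^sub>R k) \<bullet> y))
      * exp (of_real (- (2 * pi / \<sigma>\<^sub>x\<^sup>2) * ((z - T /\<^sub>R 2 - y /\<^sub>R 2 - x) \<bullet> (z - T /\<^sub>R 2 - y /\<^sub>R 2 - x)))))"
      unfolding exp_add[symmetric]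
      apply (rule arg_cong[of _ _ exp])
      unfolding cdot_simps diff_conv_add_uminus[symmetric]
      using \<sigma>
      by (simp add: inner_add_left inner_add_right inner_diff_left inner_diff_right inner_commute complex_eq_iff field_simps power2_eq_square)
    then show "?E * (?C * ?h (z + - (y /\<^sub>R 2)) (y + T))
       = exp (2 * pi * \<i> * of_real (S \<bullet> z)) * weyl_density \<sigma>\<^sub>x \<sigma>\<^sub>k f g x k (z, T, y)"
      unfolding weyl_density_def prod.case arg by (simp only: mult_ac)
  qed
  finally show ?thesis .
qed

text \<open>Both sides are the same double integral, with \<open>v = -T\<close>.\<close>

lemma weyl_op_test_function:
  fixes f g :: "real^'n \<Rightarrow> complex" and \<sigma>\<^sub>x \<sigma>\<^sub>k :: real and x k z \<kappa> :: "real^'n"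
  assumes f: "schwartz f" and g: "schwartz g" and \<sigma>: "\<sigma>\<^sub>x > 0" "\<sigma>\<^sub>k > 0"
  defines "h \<equiv> \<lambda>p. (sqrt 2 / \<sigma>\<^sub>x) ^ CARD('n) *
       (LINT y|lborel.
          exp (- 2 * pi * \<i> * (k \<bullet> y) - pi * \<sigma>\<^sub>k\<^sup>2 * (y \<bullet> y) / 2
               - 2 * pi * ((p - y /\<^sub>R 2 - x) \<bullet> (p - y /\<^sub>R 2 - x)) / \<sigma>\<^sub>x\<^sup>2)
          * cnj (g (p - y)))"
  shows "(LINT v|lborel. exp (2 * pi * \<i> * (\<kappa> \<bullet> v)) * f (z - v /\<^sub>R 2) * h (z + v /\<^sub>R 2)) =
    (LINT (T, y)|lborel. exp (- 2 * pi * \<i> * of_real (\<kappa> \<bullet> T)) * weyl_density \<sigma>\<^sub>x \<sigma>\<^sub>k f g x k (z, T, y))"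
proof -
  let ?e = "\<lambda>p y. exp (- 2 * pi * \<i> * (k \<bullet> y) - pi * \<sigma>\<^sub>k\<^sup>2 * (y \<bullet> y) / 2
               - 2 * pi * ((p - y /\<^sub>R 2 - x) \<bullet> (p - y /\<^sub>R 2 - x)) / \<sigma>\<^sub>x\<^sup>2)"
  let ?C = "complex_of_real ((sqrt 2 / \<sigma>\<^sub>x) ^ CARD('n))"
  have "continuous_on UNIV (\<lambda>q. ?e (z + fst q /\<^sub>R 2) (snd q) * cnj (g (z + fst q /\<^sub>R 2 - snd q)))"
    by (intro continuous_intros continuous_on_compose2[OF schwartz_continuous[OF g, of UNIV]]) (use \<sigma> in auto)
  then have "(\<lambda>v. LINT y|lborel. ?e (z + v /\<^sub>R 2) y * cnj (g (z + v /\<^sub>R 2 - y))) \<in> borel_measurable borel"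
    by (intro borel_measurable_lborel_integral) (simp only: case_prod_unfold borel_measurable_continuous_onI)
  then have mh: "(\<lambda>v. h (z + v /\<^sub>R 2)) \<in> borel_measurable borel"
    unfolding h_def by (intro borel_measurable_times borel_measurable_const)
  have me: "(\<lambda>v. exp (2 * pi * \<i> * (\<kappa> \<bullet> v)) * f (z - v /\<^sub>R 2)) \<in> borel_measurable borel"
    by (intro borel_measurable_continuous_onI continuous_intros
        continuous_on_compose2[OF schwartz_continuous[OF f, of UNIV]]) auto
  have "(LINT v|lborel. exp (2 * pi * \<i> * (\<kappa> \<bullet> v)) * f (z - v /\<^sub>R 2) * h (z + v /\<^sub>R 2))
      = (LINT T|lborel. exp (2 * pi * \<i> * (\<kappa> \<bullet> - T)) * f (z - - T /\<^sub>R 2) * h (z + - T /\<^sub>R 2))"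
    by (rule lborel_integral_uminus[symmetric, OF borel_measurable_times[OF me mh]])
  also have "\<dots> = (LINT T|lborel. LINT y|lborel. exp (- 2 * pi * \<i> * of_real (\<kappa> \<bullet> T)) * weyl_density \<sigma>\<^sub>x \<sigma>\<^sub>k f g x k (z, T, y))"
  proof (rule Bochner_Integration.integral_cong[OF refl])
    fix T
    have "exp (2 * pi * \<i> * (\<kappa> \<bullet> - T)) * f (z - - T /\<^sub>R 2) * h (z + - T /\<^sub>R 2)
       = (LINT y|lborel. exp (- 2 * pi * \<i> * of_real (\<kappa> \<bullet> T)) * f (z + T /\<^sub>R 2) *
           (?C * (?e (z - T /\<^sub>R 2) y * cnj (g (z - T /\<^sub>R 2 - y)))))"
      unfolding h_def by (simp add: integral_mult_right_zero)
    also have "\<dots> = (LINT y|lborel. exp (- 2 * pi * \<i> * of_real (\<kappa> \<bullet> T)) * weyl_density \<sigma>\<^sub>x \<sigma>\<^sub>k f g x k (z, T, y))"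
    proof (rule Bochner_Integration.integral_cong[OF refl])
      fix y
      have "?e (z - T /\<^sub>R 2) y = exp (of_real (- (pi * \<sigma>\<^sub>k\<^sup>2 / 2) * (y \<bullet> y)) + \<i> * of_real ((- (2 * pi) *\<^sub>R k) \<bullet> y))
        * exp (of_real (- (2 * pi / \<sigma>\<^sub>x\<^sup>2) * ((z - T /\<^sub>R 2 - y /\<^sub>R 2 - x) \<bullet> (z - T /\<^sub>R 2 - y /\<^sub>R 2 - x))))"
        unfolding exp_add[symmetric] by (rule arg_cong[of _ _ exp]) (simp add: field_simps)
      then show "exp (- 2 * pi * \<i> * of_real (\<kappa> \<bullet> T)) * f (z + T /\<^sub>R 2) *
           (?C * (?e (z - T /\<^sub>R 2) y * cnj (g (z - T /\<^sub>R 2 - y))))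
         = exp (- 2 * pi * \<i> * of_real (\<kappa> \<bullet> T)) * weyl_density \<sigma>\<^sub>x \<sigma>\<^sub>k f g x k (z, T, y)"
        unfolding weyl_density_def prod.case by (simp only: mult_ac)
    qed
    finally show "exp (2 * pi * \<i> * (\<kappa> \<bullet> - T)) * f (z - - T /\<^sub>R 2) * h (z + - T /\<^sub>R 2)
      = (LINT y|lborel. exp (- 2 * pi * \<i> * of_real (\<kappa> \<bullet> T)) * weyl_density \<sigma>\<^sub>x \<sigma>\<^sub>k f g x k (z, T, y))" .
  qed
  also have "\<dots> = (LINT (T, y)|lborel. exp (- 2 * pi * \<i> * of_real (\<kappa> \<bullet> T)) * weyl_density \<sigma>\<^sub>x \<sigma>\<^sub>k f g x k (z, T, y))"
  proof (rule lborel_fubini[symmetric])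
    show "integrable lborel (\<lambda>(T, y). exp (- 2 * pi * \<i> * of_real (\<kappa> \<bullet> T)) * weyl_density \<sigma>\<^sub>x \<sigma>\<^sub>k f g x k (z, T, y))"
      using integrable_exp_mult[OF schwartz_integrable[OF schwartz_slice_snd[OF schwartz_weyl_density[OF f g \<sigma>], of x k z]], of "(- \<kappa>, 0)"]
      by (simp add: case_prod_unfold inner_prod_def)
  qed
  finally show ?thesis .
qed

theorem theorem1p4:
  fixes \<sigma>\<^sub>x \<sigma>\<^sub>k :: real
    and f g :: "real^'n \<Rightarrow> complex"
    and L :: "((real^'n) \<times> (real^'n) \<Rightarrow> complex) \<Rightarrow> complex"
    and x k :: "real^'n"
  assumes "\<sigma>\<^sub>x > 0" and "\<sigma>\<^sub>k > 0"
    and "schwartz f" and "schwartz g"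
    and "tempered_distribution L"
  shows "swt_dist \<sigma>\<^sub>x \<sigma>\<^sub>k (weyl_op L f) g (x, k) = smoothed_op \<sigma>\<^sub>x \<sigma>\<^sub>k L (swt \<sigma>\<^sub>x \<sigma>\<^sub>k f g) (x, k)
       \<and> smoothed_op \<sigma>\<^sub>x \<sigma>\<^sub>k L (swt \<sigma>\<^sub>x \<sigma>\<^sub>k f g) (x, k) = smoothed_op' \<sigma>\<^sub>x \<sigma>\<^sub>k L (swt \<sigma>\<^sub>x \<sigma>\<^sub>k f g) (x, k)"
proof -
  note hyps = assms(3,4,1,2)
  define M where "M = weyl_density \<sigma>\<^sub>x \<sigma>\<^sub>k f g x k"
  have M: "schwartz M" unfolding M_def by (rule schwartz_weyl_density[OF hyps])
  define A where "A = (\<lambda>(S, T). LINT y|lborel. partial_fourier M S (T, y))"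
  have 1: "smoothed_op' \<sigma>\<^sub>x \<sigma>\<^sub>k L (swt \<sigma>\<^sub>x \<sigma>\<^sub>k f g) (x, k) = L (fourier A)"
    unfolding smoothed_op'_def fourier_dist_def prod.case A_def M_def entire_extension_swt[OF hyps]
      swt_complex_eq_partial_fourier[OF hyps] ..
  have 2: "smoothed_op \<sigma>\<^sub>x \<sigma>\<^sub>k L (swt \<sigma>\<^sub>x \<sigma>\<^sub>k f g) (x, k) = L (fourier A)"
  proof -
    define \<psi> where "\<psi> = (\<lambda>(S, T).
       LINT (X, K)|lborel.
         exp (2 * pi * \<i> *
              (cvec S \<bullet>\<^sub>c (cvec (x - K) + (\<i> * (complex_of_real \<sigma>\<^sub>x)\<^sup>2) *s cvec X)
               + cvec T \<bullet>\<^sub>c (cvec (k + X) + (\<i> * (complex_of_real \<sigma>\<^sub>k)\<^sup>2) *s cvec K)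
               + x \<bullet> X + k \<bullet> K))
         * fourier (swt \<sigma>\<^sub>x \<sigma>\<^sub>k f g) (X - S, K - T))"
    \<comment> \<open>the dilation by \<open>2\<close> halves the arguments, and its Jacobian cancels the factor \<open>2\<^sup>2\<^sup>n\<close>\<close>
    have "\<psi> (p /\<^sub>R 2) = A p" for p
    proof -
      obtain S T where p: "p = (S, T)" by fastforce
      have "p /\<^sub>R 2 = (S /\<^sub>R 2, T /\<^sub>R 2)" by (simp add: p)
      then show ?thesis
        unfolding \<psi>_def A_def M_def p by (simp only: prod.case smoothed_op_integral[OF hyps]
          swt_complex_eq_partial_fourier[OF hyps])
    qed
    then have "(\<lambda>p. \<psi> (p /\<^sub>R 2)) = A" by blast
    then show ?thesis
      unfolding smoothed_op_def prod.case \<psi>_def[symmetric] dilate_dist_def fourier_dist_def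
      by (simp add: mult_2)
  qed
  have "swt_dist \<sigma>\<^sub>x \<sigma>\<^sub>k (weyl_op L f) g (x, k) = L (fourier A)"
  proof -
    have "fourier A = (\<lambda>(z, \<kappa>). LINT (T, y)|lborel. exp (- 2 * pi * \<i> * of_real (\<kappa> \<bullet> T)) * M (z, T, y))"
      using fourier_partial_fourier_marginal[OF M] unfolding A_def by (simp add: fun_eq_iff)
    then show ?thesis
      unfolding swt_dist_def weyl_op_def prod.case weyl_op_test_function[OF hyps] M_def by simp
  qed
  with 1 2 show ?thesis by simp
qed

end
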